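(* Consider the $k$-component Gaussian mixture classification problem, the SGD, and the empirical test matrices described in the context, with regularization $\beta>0$, step size $\delta=O(1/d)$, and initialization $x_0^c\sim\mathcal N(0,I_d/d)$ independently for $c\in[k]$. There exist $\alpha_0,\lambda_0>0$ such that if $\lambda\ge\lambda_0$ and $\widetilde M\ge\alpha_0 d$, the following holds. For every $\varepsilon>0$ there exists $T_0(\varepsilon)$ such that for any fixed time horizon $T_f$ with $T_0<T_f<M/d$, with probability $1-o_d(1)$, for every $c\in[k]$ and all $\ell\in[T_0\delta^{-1},T_f\delta^{-1}]$, the vector $x^c_\ell$ lives in $E_k(\nabla^2_{cc}\widehat R(\mathbf x_\ell))$ and lives in $E_k(\widehat G_{cc}(\mathbf x_\ell))$, in both cases up to error $O(\varepsilon+\lambda^{-1})$.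
   Context: Let $k\ge 2$ be fixed, and let $p_1,\dots,p_k\in(0,1)$ with $\sum_a p_a=1$ and $\beta>0$ be fixed (independent of $d$). For each dimension $d$, let $\mu_1,\dots,\mu_k\in\mathbb R^d$ be linearly independent unit vectors whose Gram matrix $(\overline m_{ab})=(\mu_a\cdot\mu_b)$ does not depend on $d$. Let $\lambda>0$. A data point is $\mathbf Y=(y,Y)$ where $y\in\mathbb R^k$ is a one-hot vector with $\mathbb P(y=e_a)=p_a$ and, given $y=e_a$, $Y=\mu_a+Z$ with $Z\sim\mathcal N(0,I_d/\lambda)$. Parameters are $\mathbf x=(x^1,\dots,x^k)\in(\mathbb R^d)^k$ and the loss is the cross-entropy $L(\mathbf x,\mathbf Y)=-\sum_{c}y_c\,x^c\cdot Y+\log\sum_{c}\exp(x^c\cdot Y)$. Given i.i.d. training samples $\mathbf Y^1,\dots,\mathbf Y^M$, the (online) SGD is $\mathbf x_\ell=\mathbf x_{\ell-1}-\delta\big(\nabla L(\mathbf x_{\ell-1},\mathbf Y^\ell)+\beta\mathbf x_{\ell-1}\big)$. Independently, given i.i.d. test samples $\widetilde{\mathbf Y}^1,\dots,\widetilde{\mathbf Y}^{\widetilde M}$ with the same law, the empirical test Hessian and G-matrix are $\nabla^2\widehat R(\mathbf x)=\frac1{\widetilde M}\sum_{\ell}\nabla^2L(\mathbf x,\widetilde{\mathbf Y}^\ell)$ and $\widehat G(\mathbf x)=\frac1{\widetilde M}\sum_\ell\nabla L(\mathbf x,\widetilde{\mathbf Y}^\ell)^{\otimes2}$ (the penalty $\beta\|\mathbf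 x\|^2$ is not included); $\nabla^2_{bc}\widehat R$, $\widehat G_{bc}$ denote the $d\times d$ blocks indexed by the coordinates of $x^b$ and $x^c$. For a matrix $A$, $E_k(A)$ is the span of the $k$ eigenvectors of $A$ with largest absolute eigenvalues. A vector $v$ lives in a subspace $B$ up to error $\varepsilon$ if $\|P_Bv\|/\|v\|\ge1-\varepsilon$, with $P_B$ the orthogonal projection onto $B$. Asymptotics are as $d\to\infty$; $O(\cdot)$ constants do not depend on $d$ (nor on $\varepsilon,\lambda$) but may depend on $k,\beta,(p_a),(\overline m_{ab})$. *)

theory Defs
  imports "HOL-Probability.Probability"
begin

text \<open>Vectors of R^d are represented as functions nat => real, only the coordinates
 i < d being relevant.  A parameter x = (x^0,...,x^(k-1)) in (R^d)^k is a function
 nat => nat => real, x c i being coordinate i of x^c.  Classes are indexed by 0..k-1.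
 A data point (y,Y) with y = e_a is represented as the pair (a, Y).\<close>

definition dotp :: "nat \<Rightarrow> (nat \<Rightarrow> real) \<Rightarrow> (nat \<Rightarrow> real) \<Rightarrow> real" where
  "dotp d u v = (\<Sum>i<d. u i * v i)"

definition vnorm :: "nat \<Rightarrow> (nat \<Rightarrow> real) \<Rightarrow> real" where
  "vnorm d u = sqrt (dotp d u u)"

definition xent_loss :: "nat \<Rightarrow> nat \<Rightarrow> (nat \<Rightarrow> nat \<Rightarrow> real) \<Rightarrow> nat \<times> (nat \<Rightarrow> real) \<Rightarrow> real" where
  "xent_loss k d x Yp = - dotp d (x (fst Yp)) (snd Yp) + ln (\<Sum>c<k. exp (dotp d (x c) (snd Yp)))"

definition partial_deriv :: "((nat \<Rightarrow> nat \<Rightarrow> real) \<Rightarrow> real) \<Rightarrow> (nat \<Rightarrow> nat \<Rightarrow> real) \<Rightarrow> nat \<Rightarrow> nat \<Rightarrow> real" where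
  "partial_deriv f x c i = deriv (\<lambda>t. f (x(c := (x c)(i := x c i + t)))) 0"

definition hess_entry :: "((nat \<Rightarrow> nat \<Rightarrow> real) \<Rightarrow> real) \<Rightarrow> (nat \<Rightarrow> nat \<Rightarrow> real) \<Rightarrow> nat \<Rightarrow> nat \<Rightarrow> nat \<Rightarrow> nat \<Rightarrow> real" where
  "hess_entry f x b j c i = partial_deriv (\<lambda>z. partial_deriv f z c i) x b j"

definition data_point :: "(nat \<Rightarrow> nat \<Rightarrow> real) \<Rightarrow> nat \<times> (nat \<Rightarrow> real) \<Rightarrow> nat \<times> (nat \<Rightarrow> real)" where
  "data_point mu s = (fst s, \<lambda>i. mu (fst s) i + snd s i)"

fun sgd :: "nat \<Rightarrow> nat \<Rightarrow> real \<Rightarrow> real \<Rightarrow> (nat \<Rightarrow> nat \<times> (nat \<Rightarrow> real)) \<Rightarrow> (nat \<Rightarrow> nat \<Rightarrow> real)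
            \<Rightarrow> nat \<Rightarrow> nat \<Rightarrow> nat \<Rightarrow> real" where
  "sgd k d \<delta> \<beta> Ys x0 0 = x0"
| "sgd k d \<delta> \<beta> Ys x0 (Suc l) =
     (\<lambda>c i. sgd k d \<delta> \<beta> Ys x0 l c i
        - \<delta> * (partial_deriv (\<lambda>z. xent_loss k d z (Ys (Suc l))) (sgd k d \<delta> \<beta> Ys x0 l) c i
               + \<beta> * sgd k d \<delta> \<beta> Ys x0 l c i))"

definition emp_hess_block :: "nat \<Rightarrow> nat \<Rightarrow> nat \<Rightarrow> (nat \<Rightarrow> nat \<times> (nat \<Rightarrow> real)) \<Rightarrow> (nat \<Rightarrow> nat \<Rightarrow> real)
                               \<Rightarrow> nat \<Rightarrow> nat \<Rightarrow> nat \<Rightarrow> real" where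
  "emp_hess_block k d Mt Yt x c = (\<lambda>i j. (1 / real Mt) *
      (\<Sum>l\<in>{1..Mt}. hess_entry (\<lambda>z. xent_loss k d z (Yt l)) x c i c j))"

definition emp_G_block :: "nat \<Rightarrow> nat \<Rightarrow> nat \<Rightarrow> (nat \<Rightarrow> nat \<times> (nat \<Rightarrow> real)) \<Rightarrow> (nat \<Rightarrow> nat \<Rightarrow> real)
                               \<Rightarrow> nat \<Rightarrow> nat \<Rightarrow> nat \<Rightarrow> real" where
  "emp_G_block k d Mt Yt x c = (\<lambda>i j. (1 / real Mt) *
      (\<Sum>l\<in>{1..Mt}. partial_deriv (\<lambda>z. xent_loss k d z (Yt l)) x c i
                    * partial_deriv (\<lambda>z. xent_loss k d z (Yt l)) x c j))"

text \<open>u_0,...,u_(d-1) is an orthonormal eigenbasis of the d x d matrix A ordered by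
 decreasing absolute value of the eigenvalues; then E_k(A) = span(u_0..u_(k-1)).\<close>
definition ordered_eigenbasis :: "nat \<Rightarrow> (nat \<Rightarrow> nat \<Rightarrow> real) \<Rightarrow> (nat \<Rightarrow> nat \<Rightarrow> real) \<Rightarrow> bool" where
  "ordered_eigenbasis d A u \<longleftrightarrow>
     (\<exists>lam :: nat \<Rightarrow> real.
        (\<forall>j<d. \<forall>j'<d. dotp d (u j) (u j') = (if j = j' then 1 else 0))
      \<and> (\<forall>j<d. \<forall>i<d. (\<Sum>i'<d. A i i' * u j i') = lam j * u j i)
      \<and> (\<forall>j j'. j \<le> j' \<and> j' < d \<longrightarrow> \<bar>lam j'\<bar> \<le> \<bar>lam j\<bar>))"

text \<open>v lives in E_k(A) up to error err: ||P v|| >= (1 - err) ||v||, where P is the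
 orthogonal projection onto E_k(A), for every admissible choice of E_k(A).\<close>
definition lives_in_Ek :: "nat \<Rightarrow> nat \<Rightarrow> (nat \<Rightarrow> nat \<Rightarrow> real) \<Rightarrow> (nat \<Rightarrow> real) \<Rightarrow> real \<Rightarrow> bool" where
  "lives_in_Ek d k A v err \<longleftrightarrow>
     (\<forall>u. ordered_eigenbasis d A u \<longrightarrow>
          sqrt (\<Sum>j<k. (dotp d (u j) v)\<^sup>2) \<ge> (1 - err) * vnorm d v)"

definition gauss_vec :: "nat \<Rightarrow> real \<Rightarrow> (nat \<Rightarrow> real) measure" where
  "gauss_vec d v = (\<Pi>\<^sub>M i\<in>{..<d}. density lborel (normal_density 0 (sqrt v)))"

definition sample_measure :: "nat pmf \<Rightarrow> nat \<Rightarrow> real \<Rightarrow> (nat \<times> (nat \<Rightarrow> real)) measure" where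
  "sample_measure P d lam = measure_pmf P \<Otimes>\<^sub>M gauss_vec d (1 / lam)"

text \<open>Joint probability space: training samples 1..M, initialization x_0^c ~ N(0,I_d/d)
 for c < k, test samples 1..Mt, all independent.\<close>
definition Omega :: "nat pmf \<Rightarrow> nat \<Rightarrow> nat \<Rightarrow> real \<Rightarrow> nat \<Rightarrow> nat \<Rightarrow>
     (((nat \<Rightarrow> nat \<times> (nat \<Rightarrow> real)) \<times> (nat \<Rightarrow> nat \<Rightarrow> real)) \<times> (nat \<Rightarrow> nat \<times> (nat \<Rightarrow> real))) measure" where
  "Omega P k d lam M Mt =
     ((\<Pi>\<^sub>M l\<in>{1..M}. sample_measure P d lam) \<Otimes>\<^sub>M (\<Pi>\<^sub>M c\<in>{..<k}. gauss_vec d (1 / real d)))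
       \<Otimes>\<^sub>M (\<Pi>\<^sub>M l\<in>{1..Mt}. sample_measure P d lam)"

text \<open>The event of the theorem for dimension d: for all c < k and all l with
 T0/delta <= l <= Tf/delta (and l <= M, so that x_l is defined), x_l^c lives in
 E_k of the (c,c) test Hessian block and of the (c,c) test G block, up to error err.\<close>
definition alignment_event :: "nat pmf \<Rightarrow> nat \<Rightarrow> nat \<Rightarrow> (nat \<Rightarrow> nat \<Rightarrow> real) \<Rightarrow> real \<Rightarrow> real \<Rightarrow> real
      \<Rightarrow> nat \<Rightarrow> nat \<Rightarrow> real \<Rightarrow> real \<Rightarrow> real \<Rightarrow> _ set" where
  "alignment_event P k d mu lam \<beta> \<delta> M Mt T0 Tf err =
     {\<omega> \<in> space (Omega P k d lam M Mt).
        \<forall>c<k. \<forall>l::nat. T0 / \<delta> \<le> real l \<and> real l \<le> Tf / \<delta> \<and> l \<le> M \<longrightarrow>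
          (let Ys = (\<lambda>m. data_point mu (fst (fst \<omega>) m));
               x0 = snd (fst \<omega>);
               Yt = (\<lambda>m. data_point mu (snd \<omega> m));
               x = sgd k d \<delta> \<beta> Ys x0 l
           in lives_in_Ek d k (emp_hess_block k d Mt Yt x c) (x c) err
            \<and> lives_in_Ek d k (emp_G_block k d Mt Yt x c) (x c) err)}"

end

(*
  Both test blocks have the form (1/Mt) sum_l w_l Y_l Y_l^T with weights w_l in [0,1] that depend on
  the iterate, where Y_l = mu_a + Z_l. An upper bound O(1/lam) for the operator norm of
  (1/Mt) sum_l Z_l Z_l^T holds for all weights at once, so one event for the test noise serves all
  times. On it the k+1-st eigenvalue is O(1/lam), and a vector p in the span of the lower
  eigenvectors satisfies |p . mu_a|^2 = O(1/lam) |p|^2, provided the weights are bounded below for a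
  positive fraction of each class. As the error is measured by the norm of the projection, only the
  square of the distance to the span matters, so distances O(lam^(-1/2)) suffice.

  Unrolling the SGD gives x_l^c = rho^l x_0^c + sum_a s_a mu_a + N_l with rho = 1 - delta beta and
  |s_a| <= 1/beta. The noise N_l is a discounted sum of multiples of the Z_m with coefficients bounded
  by delta; operator norm bounds for the noise on windows of length 1/delta give |N_l| = O(lam^(-1/2))
  for all l at once. The coefficient s_c is a sum of nonnegative terms, each of order delta at a good
  step, and every window contains order 1/delta good steps. Pairing x_l^c with the dual basis of the
  mu_a then bounds the norm of x_l^c below.
*)
theory Submission
  imports Defs
begin

text \<open>Only an upper bound on \<delta> is given, so the number \<open>Tf / \<delta>\<close> of
  steps is not controlled by \<open>d\<close> and a union bound over steps is impossible. Windows of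
  length about \<open>1 / \<delta>\<close> leave, for each class,
  \<open>\<lceil>Tf\<rceil> + 1\<close> events with failure probability exponentially small in
  \<open>d\<close>; what happens inside a window is then deterministic.

  The count of good steps is where dependence matters. The chance of a good step is controlled only
  while the iterate is bounded, which is itself a high-probability fact about the same samples.
  Declaring every step outside a ball good removes the circularity: the count becomes a Chernoff
  bound valid for every past, and the norm bound, which needs only residuals of modulus at most 1,
  shows afterwards that the exception never occurs.

  The spectral part needs no gap and no perturbation theorem, so it covers every admissible
  eigenbasis.

  All constants are fixed before \<open>lam\<close>: the radius \<open>R\<close> is computed from
  \<open>K\<close> instead of the noise level \<open>B = K / lam\<close>, so the lower bounds on
  weights and iterates do not deteriorate as \<open>lam\<close> grows.\<close>

section \<open>Linear algebra in coordinates\<close>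

text \<open>Gaussian elimination, by induction on the equations. This is the only dimension count of
  the development: completeness of orthonormal families, the eigenvalue bound and the dual basis of
  the means all rest on it.\<close>

lemma homogeneous_system_nontrivial:
  fixes a :: "'i \<Rightarrow> 'j \<Rightarrow> real"
  assumes "finite I" "finite J" "card I < card J"
  shows "\<exists>y. (\<exists>j\<in>J. y j \<noteq> 0) \<and> (\<forall>i\<in>I. (\<Sum>j\<in>J. a i j * y j) = 0)"
  using assms
proof (induction I arbitrary: J a rule: finite_induct)
  case empty
  then have "J \<noteq> {}" by auto
  then show ?case by (intro exI[of _ "\<lambda>_. 1"]) auto
next
  case (insert i0 I)
  show ?case
  proof (cases "\<forall>j\<in>J. a i0 j = 0")
    case True
    have "card I < card J" using insert by simp
    from insert.IH[OF insert.prems(1) this, of a]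
    obtain y where "\<exists>j\<in>J. y j \<noteq> 0" "\<forall>i\<in>I. (\<Sum>j\<in>J. a i j * y j) = 0" by blast
    then show ?thesis using True by (intro exI[of _ y]) auto
  next
    case False
    then obtain j0 where j0: "j0 \<in> J" "a i0 j0 \<noteq> 0" by blast
    define J' where "J' = J - {j0}"
    have J': "finite J'" "j0 \<notin> J'" "J = insert j0 J'"
      using j0 insert.prems by (auto simp: J'_def)
    have "card I < card J'" using insert J' by simp
    \<comment> \<open>Equation \<open>i0\<close> is solved for the unknown \<open>j0\<close>; the
      coefficients passed to the induction hypothesis are those left after substituting it into the
      other equations.\<close>
    from insert.IH[OF J'(1) this, of "\<lambda>i j. a i j - a i j0 * a i0 j / a i0 j0"]
    obtain y where y: "\<exists>j\<in>J'. y j \<noteq> 0"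
      "\<forall>i\<in>I. (\<Sum>j\<in>J'. (a i j - a i j0 * a i0 j / a i0 j0) * y j) = 0" by blast
    define t where "t = - (\<Sum>j\<in>J'. a i0 j * y j) / a i0 j0"
    have sum: "(\<Sum>j\<in>J. a i j * (y(j0 := t)) j) = a i j0 * t + (\<Sum>j\<in>J'. a i j * y j)" for i
    proof -
      have "(\<Sum>j\<in>J'. a i j * (y(j0 := t)) j) = (\<Sum>j\<in>J'. a i j * y j)"
        using J' by (intro sum.cong) auto
      then show ?thesis using J' by simp
    qed
    show ?thesis
    proof (intro exI[of _ "y(j0 := t)"] conjI ballI)
      show "\<exists>j\<in>J. (y(j0 := t)) j \<noteq> 0" using y(1) J' by auto
      fix i assume "i \<in> insert i0 I"
      then show "(\<Sum>j\<in>J. a i j * (y(j0 := t)) j) = 0"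
      proof
        assume "i = i0"
        then show ?thesis using j0 unfolding sum by (simp add: t_def)
      next
        assume "i \<in> I"
        then have "(\<Sum>j\<in>J'. (a i j - a i j0 * a i0 j / a i0 j0) * y j) = 0" using y by blast
        also have "(\<Sum>j\<in>J'. (a i j - a i j0 * a i0 j / a i0 j0) * y j)
           = (\<Sum>j\<in>J'. a i j * y j) - a i j0 / a i0 j0 * (\<Sum>j\<in>J'. a i0 j * y j)"
          by (simp add: sum_subtractf sum_distrib_left algebra_simps)
        finally show ?thesis unfolding sum by (simp add: t_def)
      qed
    qed
  qed
qed

section \<open>Inner product and norm on the first \<open>d\<close> coordinates\<close>

lemma power2_sum_le: "(a + b)\<^sup>2 \<le> 2 * a\<^sup>2 + 2 * b\<^sup>2" for a b :: real
  using sum_squares_ge_zero[of "a - b" 0] by (simp add: power2_eq_square algebra_simps)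

lemma dotp_commute: "dotp d u v = dotp d v u"
  by (simp add: dotp_def mult.commute)

lemma dotp_cong: "(\<And>i. i < d \<Longrightarrow> u i = u' i) \<Longrightarrow> (\<And>i. i < d \<Longrightarrow> v i = v' i) \<Longrightarrow> dotp d u v = dotp d u' v'"
  unfolding dotp_def by (intro sum.cong) auto

lemma dotp_add_right: "dotp d u (\<lambda>i. v i + w i) = dotp d u v + dotp d u w"
  by (simp add: dotp_def sum.distrib algebra_simps)

lemma dotp_scale_right: "dotp d u (\<lambda>i. c * v i) = c * dotp d u v"
  by (simp add: dotp_def sum_distrib_left algebra_simps)

lemma dotp_sum_right: "dotp d u (\<lambda>i. \<Sum>j\<in>J. v j i) = (\<Sum>j\<in>J. dotp d u (v j))"
  unfolding dotp_def by (subst sum.swap) (simp add: sum_distrib_left)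

lemma dotp_add_left: "dotp d (\<lambda>i. v i + w i) u = dotp d v u + dotp d w u"
  by (simp add: dotp_def sum.distrib algebra_simps)

lemma dotp_scale_left: "dotp d (\<lambda>i. c * v i) u = c * dotp d v u"
  by (simp add: dotp_def sum_distrib_left algebra_simps)

lemma dotp_sum_left: "dotp d (\<lambda>i. \<Sum>j\<in>J. v j i) u = (\<Sum>j\<in>J. dotp d (v j) u)"
  unfolding dotp_def by (subst sum.swap) (simp add: sum_distrib_right)

lemma dotp_self_nonneg: "0 \<le> dotp d u u"
  by (simp add: dotp_def sum_nonneg)

lemma vnorm_nonneg [simp]: "0 \<le> vnorm d u"
  by (simp add: vnorm_def dotp_self_nonneg)

lemma vnorm_square: "(vnorm d u)\<^sup>2 = dotp d u u"
  by (simp add: vnorm_def dotp_self_nonneg)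

lemma vnorm_eq_L2_set: "vnorm d u = L2_set u {..<d}"
  by (simp add: vnorm_def dotp_def L2_set_def power2_eq_square)

lemma vnorm_cong: "(\<And>i. i < d \<Longrightarrow> u i = u' i) \<Longrightarrow> vnorm d u = vnorm d u'"
  unfolding vnorm_def by (metis dotp_cong)

lemma vnorm_triangle: "vnorm d (\<lambda>i. u i + v i) \<le> vnorm d u + vnorm d v"
  unfolding vnorm_eq_L2_set by (rule L2_set_triangle_ineq)

lemma vnorm_scale: "vnorm d (\<lambda>i. c * u i) = \<bar>c\<bar> * vnorm d u"
  by (simp add: vnorm_def dotp_scale_left dotp_scale_right real_sqrt_mult
      flip: mult.assoc power2_eq_square)

lemma vnorm_zero [simp]: "vnorm d (\<lambda>i. 0) = 0"
  by (simp add: vnorm_def dotp_def)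

lemma vnorm_sum: "finite J \<Longrightarrow> vnorm d (\<lambda>i. \<Sum>j\<in>J. v j i) \<le> (\<Sum>j\<in>J. vnorm d (v j))"
proof (induction J rule: finite_induct)
  case (insert j J)
  then show ?case using vnorm_triangle[of d "v j" "\<lambda>i. \<Sum>j\<in>J. v j i"] by simp
qed simp

lemma abs_dotp_le: "\<bar>dotp d u v\<bar> \<le> vnorm d u * vnorm d v"
proof -
  have "\<bar>dotp d u v\<bar> \<le> (\<Sum>i<d. \<bar>u i\<bar> * \<bar>v i\<bar>)"
    unfolding dotp_def by (rule order_trans[OF sum_abs]) (simp add: abs_mult)
  also have "\<dots> \<le> vnorm d u * vnorm d v"
    unfolding vnorm_eq_L2_set by (rule L2_set_mult_ineq)
  finally show ?thesis .
qed

section \<open>Orthonormal families and top eigenspaces\<close>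

lemma dotp_self_orthonormal_sum:
  assumes orth: "\<And>j j'. j < d \<Longrightarrow> j' < d \<Longrightarrow> dotp d (u j) (u j') = (if j = j' then 1 else 0)"
    and J: "J \<subseteq> {..<d}"
  shows "dotp d (\<lambda>i. \<Sum>j\<in>J. b j * u j i) (\<lambda>i. \<Sum>j\<in>J. c j * u j i) = (\<Sum>j\<in>J. b j * c j)"
proof -
  have fin: "finite J" using J finite_subset by blast
  have "dotp d (\<lambda>i. \<Sum>j\<in>J. b j * u j i) (\<lambda>i. \<Sum>j\<in>J. c j * u j i)
     = (\<Sum>j\<in>J. b j * (\<Sum>j'\<in>J. c j' * dotp d (u j) (u j')))"
    by (simp add: dotp_sum_left dotp_sum_right dotp_scale_left dotp_scale_right sum_distrib_left)
  also have "\<dots> = (\<Sum>j\<in>J. b j * (\<Sum>j'\<in>J. if j = j' then c j' else 0))"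
    using J by (intro sum.cong refl arg_cong2[where f="(*)"]) (auto simp: orth subset_iff)
  also have "\<dots> = (\<Sum>j\<in>J. b j * c j)"
    using fin by simp
  finally show ?thesis .
qed

text \<open>The remainder \<open>r\<close> is orthogonal to every \<open>u j\<close>. The
  \<open>d + 1\<close> vectors \<open>u 0, ..., u (d-1), r\<close> are dependent; pairing a
  dependence with \<open>u j\<close> kills its \<open>j\<close>-th coefficient, so the coefficient
  of \<open>r\<close> is nonzero and \<open>r\<close> vanishes.\<close>

lemma orthonormal_expansion:
  assumes orth: "\<And>j j'. j < d \<Longrightarrow> j' < d \<Longrightarrow> dotp d (u j) (u j') = (if j = j' then 1 else 0)"
    and i: "i < d"
  shows "v i = (\<Sum>j<d. dotp d (u j) v * u j i)"
proof -
  define r where "r i = v i - (\<Sum>j<d. dotp d (u j) v * u j i)" for i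
  have r_orth: "dotp d (u j) r = 0" if "j < d" for j
  proof -
    have "dotp d (u j) r = dotp d (u j) (\<lambda>i. v i + (-1) * (\<Sum>j<d. dotp d (u j) v * u j i))"
      by (simp add: r_def[abs_def])
    also have "\<dots> = dotp d (u j) v - (\<Sum>j'<d. dotp d (u j') v * dotp d (u j) (u j'))"
      by (simp only: dotp_add_right dotp_scale_right dotp_sum_right)
    also have "\<dots> = dotp d (u j) v - (\<Sum>j'<d. if j = j' then dotp d (u j') v else 0)"
      using that by (intro arg_cong2[where f="(-)"] refl sum.cong) (auto simp: orth)
    also have "\<dots> = 0" using that by simp
    finally show ?thesis .
  qed
  define e where "e j = (if j < d then u j else r)" for j
  obtain y where y: "\<exists>j\<in>{..d}. y j \<noteq> 0" "\<forall>i\<in>{..<d}. (\<Sum>j\<in>{..d}. e j i * y j) = 0"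
    using homogeneous_system_nontrivial[of "{..<d}" "{..d}" "\<lambda>i j. e j i"] by auto
  have eq: "(\<Sum>j<d. y j * u j i) + y d * r i = 0" if "i < d" for i
  proof -
    have "(\<Sum>j\<le>d. e j i * y j) = (\<Sum>j<d. e j i * y j) + e d i * y d"
      by (simp flip: lessThan_Suc_atMost)
    also have "(\<Sum>j<d. e j i * y j) = (\<Sum>j<d. y j * u j i)"
      by (intro sum.cong) (auto simp: e_def)
    finally show ?thesis using y(2) that by (simp add: e_def mult.commute)
  qed
  have y0: "y j = 0" if "j < d" for j
  proof -
    have "0 = dotp d (u j) (\<lambda>i. (\<Sum>j<d. y j * u j i) + y d * r i)"
      using eq by (simp add: dotp_def)
    also have "\<dots> = (\<Sum>j'<d. y j' * dotp d (u j) (u j'))"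
      using that by (simp add: dotp_add_right dotp_scale_right dotp_sum_right r_orth)
    also have "\<dots> = (\<Sum>j'<d. if j = j' then y j' else 0)"
      using that by (intro sum.cong) (auto simp: orth)
    also have "\<dots> = y j" using that by simp
    finally show ?thesis by simp
  qed
  have "y d \<noteq> 0" using y(1) y0 by (auto simp: le_less)
  moreover have "y d * r i = 0" using eq[OF i] y0 by simp
  ultimately have "r i = 0" by simp
  then show ?thesis by (simp add: r_def)
qed

text \<open>Let \<open>p\<close> be the part of \<open>v\<close> outside the span of the first
  \<open>k\<close> eigenvectors. Since \<open>p . p = p . v\<close> and \<open>v\<close> is a
  combination of the \<open>mu b\<close> plus \<open>r\<close>, it is enough that \<open>p\<close>
  is nearly orthogonal to each mean; this bounds the norm of \<open>p\<close> by
  \<open>k * S * sqrt (4 * B / q) + rr\<close>. By Pythagoras the loss in the projected norm is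
  governed by the square of this bound, hence the form of \<open>err\<close>.\<close>

lemma lives_in_Ek_weighted_gram:
  fixes A :: "nat \<Rightarrow> nat \<Rightarrow> real" and Y Z mu :: "nat \<Rightarrow> nat \<Rightarrow> real" and a :: "nat \<Rightarrow> nat"
  assumes kd: "k \<le> d" and n: "0 < n"
    and A: "\<And>i j. i < d \<Longrightarrow> j < d \<Longrightarrow> A i j = (1 / real n) * (\<Sum>l\<in>{1..n}. w l * (Y l i * Y l j))"
    and Y: "\<And>l i. l \<in> {1..n} \<Longrightarrow> i < d \<Longrightarrow> Y l i = mu (a l) i + Z l i"
    and a: "\<And>l. l \<in> {1..n} \<Longrightarrow> a l < k"
    and w: "\<And>l. l \<in> {1..n} \<Longrightarrow> 0 \<le> w l \<and> w l \<le> 1"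
    and Zop: "\<And>z. (\<Sum>l\<in>{1..n}. (dotp d z (Z l))\<^sup>2) \<le> B * real n * dotp d z z"
    and q0: "0 < q" and q: "\<And>b. b < k \<Longrightarrow> q * real n \<le> (\<Sum>l\<in>{l\<in>{1..n}. a l = b}. w l)"
    and v: "\<And>i. i < d \<Longrightarrow> v i = (\<Sum>b<k. s b * mu b i) + r i"
    and s: "\<And>b. b < k \<Longrightarrow> \<bar>s b\<bar> \<le> S"
    and r: "vnorm d r \<le> rr"
    and r0: "0 < r0" "r0 \<le> vnorm d v"
    and err: "(real k * S * sqrt (4 * B / q) + rr)\<^sup>2 \<le> err * r0\<^sup>2"
  shows "lives_in_Ek d k A v err"
  unfolding lives_in_Ek_def
proof (intro allI impI)
  fix u assume "ordered_eigenbasis d A u"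
  then obtain lam where L: "(\<forall>j<d. \<forall>j'<d. dotp d (u j) (u j') = (if j = j' then 1 else 0))
      \<and> (\<forall>j<d. \<forall>i<d. (\<Sum>i'<d. A i i' * u j i') = lam j * u j i)
      \<and> (\<forall>j j'. j \<le> j' \<and> j' < d \<longrightarrow> \<bar>lam j'\<bar> \<le> \<bar>lam j\<bar>)"
    unfolding ordered_eigenbasis_def by (elim exE) (rule that)
  have orth: "dotp d (u j) (u j') = (if j = j' then 1 else 0)" if "j < d" "j' < d" for j j'
    using L that by simp
  have eig: "(\<Sum>i'<d. A i i' * u j i') = lam j * u j i" if "j < d" "i < d" for j i
    using L that by simp
  have ord: "\<bar>lam j'\<bar> \<le> \<bar>lam j\<bar>" if "j \<le> j'" "j' < d" for j j'
    using L that by blast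
  define qf where "qf z = (1 / real n) * (\<Sum>l\<in>{1..n}. w l * (dotp d z (Y l))\<^sup>2)" for z
  have qf_A: "qf z = dotp d z (\<lambda>i. \<Sum>i'<d. A i i' * z i')" for z
  proof -
    have "dotp d z (\<lambda>i. \<Sum>i'<d. A i i' * z i') = (\<Sum>i<d. \<Sum>i'<d. z i * (A i i' * z i'))"
      by (simp add: dotp_def sum_distrib_left)
    also have "\<dots> = (\<Sum>i<d. \<Sum>i'<d. \<Sum>l\<in>{1..n}. (1 / real n) * (w l * ((z i * Y l i) * (z i' * Y l i'))))"
      by (intro sum.cong refl) (simp add: A sum_distrib_left sum_distrib_right mult_ac)
    also have "\<dots> = (\<Sum>i<d. \<Sum>l\<in>{1..n}. \<Sum>i'<d. (1 / real n) * (w l * ((z i * Y l i) * (z i' * Y l i'))))"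
      by (rule sum.cong[OF refl], rule sum.swap)
    also have "\<dots> = (\<Sum>l\<in>{1..n}. \<Sum>i<d. \<Sum>i'<d. (1 / real n) * (w l * ((z i * Y l i) * (z i' * Y l i'))))"
      by (rule sum.swap)
    also have "\<dots> = (\<Sum>l\<in>{1..n}. (1 / real n) * (w l * ((\<Sum>i<d. z i * Y l i) * (\<Sum>i'<d. z i' * Y l i'))))"
      by (simp only: sum_product) (simp only: sum_distrib_left)
    also have "\<dots> = qf z"
      unfolding qf_def by (simp add: sum_distrib_left dotp_def power2_eq_square)
    finally show ?thesis by simp
  qed
  have qf_nonneg: "0 \<le> qf z" for z
    unfolding qf_def using w by (intro mult_nonneg_nonneg sum_nonneg) auto
  have qf_span: "qf (\<lambda>i. \<Sum>j\<in>J. y j * u j i) = (\<Sum>j\<in>J. lam j * (y j)\<^sup>2)" if "J \<subseteq> {..<d}" for J y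
  proof -
    have "qf (\<lambda>i. \<Sum>j\<in>J. y j * u j i)
       = dotp d (\<lambda>i. \<Sum>j\<in>J. y j * u j i) (\<lambda>i. \<Sum>i'<d. A i i' * (\<Sum>j\<in>J. y j * u j i'))"
      by (rule qf_A)
    also have "\<dots> = dotp d (\<lambda>i. \<Sum>j\<in>J. y j * u j i) (\<lambda>i. \<Sum>j\<in>J. (y j * lam j) * u j i)"
    proof (rule dotp_cong[OF refl])
      fix i assume i: "i < d"
      have "(\<Sum>i'<d. A i i' * (\<Sum>j\<in>J. y j * u j i')) = (\<Sum>i'<d. \<Sum>j\<in>J. y j * (A i i' * u j i'))"
        by (simp add: sum_distrib_left mult_ac)
      also have "\<dots> = (\<Sum>j\<in>J. y j * (\<Sum>i'<d. A i i' * u j i'))"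
        by (subst sum.swap) (simp add: sum_distrib_left)
      also have "\<dots> = (\<Sum>j\<in>J. (y j * lam j) * u j i)"
        using that i by (intro sum.cong refl) (auto simp: eig subset_iff)
      finally show "(\<Sum>i'<d. A i i' * (\<Sum>j\<in>J. y j * u j i')) = \<dots>" .
    qed
    also have "\<dots> = (\<Sum>j\<in>J. y j * (y j * lam j))"
      by (rule dotp_self_orthonormal_sum[OF orth that])
    finally show ?thesis by (simp add: power2_eq_square mult_ac)
  qed
  \<comment> \<open>\<open>A\<close> is positive semidefinite, so the ordering by absolute value in
    \<open>ordered_eigenbasis\<close> is an ordering by value.\<close>
  have lam_nonneg: "0 \<le> lam j" if "j < d" for j
    using qf_nonneg[of "\<lambda>i. \<Sum>j\<in>{j}. 1 * u j i"] qf_span[of "{j}" "\<lambda>_. 1"] that by simp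
  \<comment> \<open>Courant-Fischer: the span of \<open>u 0, ..., u k\<close> contains a nonzero
    \<open>z\<close> orthogonal to the \<open>k\<close> means. On it the quadratic form sees only
    noise, while it is at least \<open>lam j * (z . z)\<close>.\<close>
  have lam_le: "lam j \<le> B" if j: "k \<le> j" "j < d" for j
  proof -
    obtain y where y: "\<exists>i\<in>{..k}. y i \<noteq> 0" "\<forall>b\<in>{..<k}. (\<Sum>j\<in>{..k}. dotp d (u j) (mu b) * y j) = 0"
      using homogeneous_system_nontrivial[of "{..<k}" "{..k}" "\<lambda>b j. dotp d (u j) (mu b)"] by auto
    define z where "z = (\<lambda>i. \<Sum>j\<in>{..k}. y j * u j i)"
    have sub: "{..k} \<subseteq> {..<d}" using j by auto
    have zz: "dotp d z z = (\<Sum>j\<le>k. (y j)\<^sup>2)"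
      using dotp_self_orthonormal_sum[OF orth sub, of y y] by (simp add: z_def power2_eq_square)
    have pos: "0 < (\<Sum>j\<le>k. (y j)\<^sup>2)"
    proof -
      obtain i where "i \<le> k" "y i \<noteq> 0" using y(1) by auto
      then show ?thesis by (intro sum_pos2[of "{..k}" i]) auto
    qed
    have zmu: "dotp d z (mu b) = 0" if "b < k" for b
      using y(2) that by (simp add: z_def dotp_sum_left dotp_scale_left mult.commute)
    have "lam j * (\<Sum>j\<le>k. (y j)\<^sup>2) \<le> (\<Sum>j\<le>k. lam j * (y j)\<^sup>2)"
      unfolding sum_distrib_left
    proof (intro sum_mono mult_right_mono)
      fix j' assume "j' \<in> {..k}"
      then show "lam j \<le> lam j'" using ord[of j' j] lam_nonneg j by force
    qed auto
    also have "\<dots> = qf z" unfolding z_def by (rule qf_span[OF sub, symmetric])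
    also have "\<dots> = (1 / real n) * (\<Sum>l\<in>{1..n}. w l * (dotp d z (Z l))\<^sup>2)"
    proof -
      have "dotp d z (Y l) = dotp d z (Z l)" if "l \<in> {1..n}" for l
      proof -
        have "dotp d z (Y l) = dotp d z (\<lambda>i. mu (a l) i + Z l i)"
          using Y[OF that] by (intro dotp_cong) auto
        then show ?thesis using zmu a[OF that] by (simp add: dotp_add_right)
      qed
      then show ?thesis unfolding qf_def by simp
    qed
    also have "\<dots> \<le> (1 / real n) * (\<Sum>l\<in>{1..n}. 1 * (dotp d z (Z l))\<^sup>2)"
      using w by (intro mult_left_mono sum_mono mult_right_mono) auto
    also have "\<dots> \<le> (1 / real n) * (B * real n * dotp d z z)"
      using Zop[of z] by (intro mult_left_mono) auto
    also have "\<dots> = B * (\<Sum>j\<le>k. (y j)\<^sup>2)" using n zz by simp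
    finally show ?thesis using pos by simp
  qed
  define K where "K = {k..<d}"
  define p where "p = (\<lambda>i. \<Sum>j\<in>K. dotp d (u j) v * u j i)"
  have Ksub: "K \<subseteq> {..<d}" by (auto simp: K_def)
  have pp: "dotp d p p = (\<Sum>j\<in>K. (dotp d (u j) v)\<^sup>2)"
    using dotp_self_orthonormal_sum[OF orth Ksub, of "\<lambda>j. dotp d (u j) v" "\<lambda>j. dotp d (u j) v"]
    by (simp add: p_def power2_eq_square)
  have pv: "dotp d p v = dotp d p p"
    unfolding pp by (simp add: p_def dotp_sum_left dotp_scale_left power2_eq_square)
  have "qf p \<le> B * dotp d p p"
  proof -
    have "qf p = (\<Sum>j\<in>K. lam j * (dotp d (u j) v)\<^sup>2)"
      unfolding p_def by (rule qf_span[OF Ksub])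
    also have "\<dots> \<le> B * dotp d p p"
      unfolding pp sum_distrib_left
      by (intro sum_mono mult_right_mono lam_le) (auto simp: K_def)
    finally show ?thesis .
  qed
  \<comment> \<open>The mean is the sample minus its noise. Splitting the square costs a factor 2,
    and the form and the noise contribute \<open>B\<close> each: this is the 4 in
    \<open>4 * B / q\<close>.\<close>
  have pmu: "\<bar>dotp d p (mu b)\<bar> \<le> sqrt (4 * B / q) * vnorm d p" if b: "b < k" for b
  proof -
    have "q * real n * (dotp d p (mu b))\<^sup>2 \<le> (\<Sum>l\<in>{l\<in>{1..n}. a l = b}. w l) * (dotp d p (mu b))\<^sup>2"
      by (intro mult_right_mono q b) auto
    also have "\<dots> = (\<Sum>l\<in>{l\<in>{1..n}. a l = b}. w l * (dotp d p (mu (a l)))\<^sup>2)"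
      by (simp add: sum_distrib_right)
    also have "\<dots> \<le> (\<Sum>l\<in>{1..n}. w l * (dotp d p (mu (a l)))\<^sup>2)"
      using w by (intro sum_mono2) auto
    also have "\<dots> \<le> (\<Sum>l\<in>{1..n}. 2 * (w l * (dotp d p (Y l))\<^sup>2) + 2 * (dotp d p (Z l))\<^sup>2)"
    proof (rule sum_mono)
      fix l assume l: "l \<in> {1..n}"
      have e: "dotp d p (Y l) = dotp d p (mu (a l)) + dotp d p (Z l)"
        unfolding dotp_add_right[symmetric] using Y[OF l] by (intro dotp_cong) auto
      have "(dotp d p (mu (a l)))\<^sup>2 \<le> 2 * (dotp d p (Y l))\<^sup>2 + 2 * (dotp d p (Z l))\<^sup>2"
        using power2_sum_le[of "dotp d p (Y l)" "- dotp d p (Z l)"] by (simp add: e)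
      then have "w l * (dotp d p (mu (a l)))\<^sup>2 \<le> w l * (2 * (dotp d p (Y l))\<^sup>2 + 2 * (dotp d p (Z l))\<^sup>2)"
        using w[OF l] by (intro mult_left_mono) auto
      also have "\<dots> = 2 * (w l * (dotp d p (Y l))\<^sup>2) + w l * (2 * (dotp d p (Z l))\<^sup>2)"
        by (simp add: algebra_simps)
      also have "\<dots> \<le> 2 * (w l * (dotp d p (Y l))\<^sup>2) + 1 * (2 * (dotp d p (Z l))\<^sup>2)"
        using w[OF l] by (intro add_mono mult_right_mono order_refl) auto
      finally show "w l * (dotp d p (mu (a l)))\<^sup>2 \<le> 2 * (w l * (dotp d p (Y l))\<^sup>2) + 2 * (dotp d p (Z l))\<^sup>2"
        by simp
    qed
    also have "\<dots> = 2 * real n * qf p + 2 * (\<Sum>l\<in>{1..n}. (dotp d p (Z l))\<^sup>2)"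
      using n by (simp add: qf_def sum.distrib sum_distrib_left)
    also have "\<dots> \<le> 2 * real n * (B * dotp d p p) + 2 * (B * real n * dotp d p p)"
      using \<open>qf p \<le> _\<close> Zop[of p] by (intro add_mono mult_left_mono) auto
    finally have "real n * (q * (dotp d p (mu b))\<^sup>2) \<le> real n * (4 * B * dotp d p p)"
      by (simp add: algebra_simps)
    then have "q * (dotp d p (mu b))\<^sup>2 \<le> 4 * B * dotp d p p"
      using n by simp
    then have "(dotp d p (mu b))\<^sup>2 \<le> (4 * B / q) * dotp d p p"
      using q0 by (simp add: field_simps)
    then have "sqrt ((dotp d p (mu b))\<^sup>2) \<le> sqrt ((4 * B / q) * dotp d p p)"
      by (rule real_sqrt_le_mono)
    then show ?thesis by (simp only: real_sqrt_mult vnorm_def real_sqrt_abs)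
  qed
  have "dotp d p p = dotp d p (\<lambda>i. (\<Sum>b<k. s b * mu b i) + r i)"
    unfolding pv[symmetric] using v by (intro dotp_cong) auto
  also have "\<dots> = (\<Sum>b<k. s b * dotp d p (mu b)) + dotp d p r"
    by (simp add: dotp_add_right dotp_sum_right dotp_scale_right)
  also have "\<dots> \<le> (\<Sum>b<k. S * (sqrt (4 * B / q) * vnorm d p)) + vnorm d p * rr"
  proof (intro add_mono sum_mono)
    fix b assume "b \<in> {..<k}"
    then have b: "b < k" by simp
    have "s b * dotp d p (mu b) \<le> \<bar>s b\<bar> * \<bar>dotp d p (mu b)\<bar>"
      by (simp flip: abs_mult)
    also have "\<dots> \<le> S * (sqrt (4 * B / q) * vnorm d p)"
      using s[OF b] by (intro mult_mono pmu[OF b]) auto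
    finally show "s b * dotp d p (mu b) \<le> \<dots>" .
  next
    have "dotp d p r \<le> vnorm d p * vnorm d r" using abs_dotp_le[of d p r] by simp
    also have "\<dots> \<le> vnorm d p * rr" using r by (intro mult_left_mono) auto
    finally show "dotp d p r \<le> vnorm d p * rr" .
  qed
  also have "\<dots> = (real k * S * sqrt (4 * B / q) + rr) * vnorm d p"
    by (simp add: algebra_simps)
  finally have "vnorm d p * vnorm d p \<le> (real k * S * sqrt (4 * B / q) + rr) * vnorm d p"
    by (simp flip: vnorm_square power2_eq_square)
  \<comment> \<open>Dividing by the norm of \<open>p\<close> needs it to be nonzero; the squared
    bound that follows holds in the zero case as well.\<close>
  then have "vnorm d p = 0 \<or> vnorm d p \<le> real k * S * sqrt (4 * B / q) + rr"
    using vnorm_nonneg[of d p] by (metis mult_le_cancel_right_pos order_le_less)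
  then have "(vnorm d p)\<^sup>2 \<le> (real k * S * sqrt (4 * B / q) + rr)\<^sup>2"
    by (auto intro: power_mono)
  also note err
  finally have perr: "dotp d p p \<le> err * r0\<^sup>2" by (simp add: vnorm_square)
  have err0: "0 \<le> err" using perr dotp_self_nonneg[of d p] r0
    by (smt (verit) mult_neg_pos zero_less_power)
  have parseval: "(vnorm d v)\<^sup>2 = (\<Sum>j<d. (dotp d (u j) v)\<^sup>2)"
  proof -
    have "dotp d v v = dotp d (\<lambda>i. \<Sum>j<d. dotp d (u j) v * u j i) (\<lambda>i. \<Sum>j<d. dotp d (u j) v * u j i)"
      by (intro dotp_cong orthonormal_expansion[OF orth])
    also have "\<dots> = (\<Sum>j<d. dotp d (u j) v * dotp d (u j) v)"
      by (rule dotp_self_orthonormal_sum[OF orth]) auto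
    finally show ?thesis by (simp only: vnorm_square) (simp add: power2_eq_square)
  qed
  have "(\<Sum>j<d. (dotp d (u j) v)\<^sup>2) = (\<Sum>j<k. (dotp d (u j) v)\<^sup>2) + dotp d p p"
    unfolding pp K_def using kd
    by (simp add: lessThan_atLeast0 sum.atLeastLessThan_concat)
  then have top: "(\<Sum>j<k. (dotp d (u j) v)\<^sup>2) \<ge> (vnorm d v)\<^sup>2 - err * (vnorm d v)\<^sup>2"
    using parseval perr mult_left_mono[OF power_mono[OF r0(2), of 2] err0] r0 by linarith
  show "sqrt (\<Sum>j<k. (dotp d (u j) v)\<^sup>2) \<ge> (1 - err) * vnorm d v"
  \<comment> \<open>For \<open>err <= 1\<close> one uses \<open>(1 - err)^2 <= 1 - err\<close>; for
    \<open>err > 1\<close> the left-hand side is not positive.\<close>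
  proof (cases "err \<le> 1")
    case True
    have "((1 - err) * vnorm d v)\<^sup>2 = (1 - err)\<^sup>2 * (vnorm d v)\<^sup>2"
      by (simp add: power_mult_distrib)
    also have "\<dots> \<le> (1 - err) * (vnorm d v)\<^sup>2"
      using True err0 by (intro mult_right_mono) (auto simp: power2_eq_square algebra_simps mult_left_le)
    also have "\<dots> \<le> (\<Sum>j<k. (dotp d (u j) v)\<^sup>2)" using top by (simp add: algebra_simps)
    finally show ?thesis by (rule real_le_rsqrt)
  next
    case False
    then have "(1 - err) * vnorm d v \<le> 0" by (simp add: mult_le_0_iff)
    also have "0 \<le> sqrt (\<Sum>j<k. (dotp d (u j) v)\<^sup>2)" by (simp add: sum_nonneg)
    finally show ?thesis .
  qed
qed

text \<open>An injective square matrix is surjective. The right-hand side, with a minus sign,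
  becomes an additional column; the resulting \<open>k\<close> equations in \<open>k + 1\<close>
  unknowns have a nontrivial solution, whose last entry cannot vanish by injectivity and is
  normalised to 1.\<close>

lemma gram_dual_coefficients:
  fixes G :: "nat \<Rightarrow> nat \<Rightarrow> real"
  assumes inj: "\<And>w. (\<And>a. a < k \<Longrightarrow> (\<Sum>b<k. G a b * w b) = 0) \<Longrightarrow> (\<And>a. a < k \<Longrightarrow> w a = 0)"
    and c: "c < k"
  shows "\<exists>w. \<forall>a<k. (\<Sum>b<k. G a b * w b) = (if a = c then 1 else 0)"
proof -
  define H where "H a b = (if b < k then G a b else if a = c then -1 else 0)" for a b
  obtain y where y: "\<exists>b\<in>{..k}. y b \<noteq> 0" "\<forall>a\<in>{..<k}. (\<Sum>b\<in>{..k}. H a b * y b) = 0"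
    using homogeneous_system_nontrivial[of "{..<k}" "{..k}" H] by auto
  have eq: "(\<Sum>b<k. G a b * y b) = (if a = c then y k else 0)" if "a < k" for a
  proof -
    have "(\<Sum>b\<le>k. H a b * y b) = (\<Sum>b<k. H a b * y b) + H a k * y k"
      by (simp flip: lessThan_Suc_atMost)
    also have "(\<Sum>b<k. H a b * y b) = (\<Sum>b<k. G a b * y b)"
      by (intro sum.cong) (auto simp: H_def)
    finally show ?thesis using y(2) that by (auto simp: H_def split: if_splits)
  qed
  have "y k \<noteq> 0"
  proof
    assume 0: "y k = 0"
    have "y a = 0" if "a < k" for a
      by (rule inj[OF _ that]) (simp add: eq 0)
    with 0 y(1) show False by (auto simp: le_less)
  qed
  then have "(\<Sum>b<k. G a b * (y b / y k)) = (if a = c then 1 else 0)" if "a < k" for a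
    using eq[OF that] by (simp flip: sum_divide_distrib)
  then show ?thesis by (intro exI[of _ "\<lambda>b. y b / y k"]) simp
qed

section \<open>Gradient and Hessian of the cross-entropy loss\<close>

definition softmax :: "nat \<Rightarrow> nat \<Rightarrow> (nat \<Rightarrow> nat \<Rightarrow> real) \<Rightarrow> (nat \<Rightarrow> real) \<Rightarrow> nat \<Rightarrow> real" where
  "softmax k d x Y c = exp (dotp d (x c) Y) / (\<Sum>b<k. exp (dotp d (x b) Y))"

text \<open>Minus the derivative of the loss in the logit of class \<open>c\<close>, so that an SGD
  step adds \<open>\<delta> * residual\<close> times the sample. With this sign the coefficient is
  nonnegative on samples of class \<open>c\<close>.\<close>

definition residual :: "nat \<Rightarrow> nat \<Rightarrow> (nat \<Rightarrow> nat \<Rightarrow> real) \<Rightarrow> nat \<times> (nat \<Rightarrow> real) \<Rightarrow> nat \<Rightarrow> real" where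
  "residual k d x Yp c = (if fst Yp = c then 1 else 0) - softmax k d x (snd Yp) c"

lemma dotp_fun_upd:
  assumes "i < d"
  shows "dotp d (u(i := s)) Y = dotp d u Y + (s - u i) * Y i"
proof -
  have "dotp d (u(i := s)) Y = s * Y i + (\<Sum>j\<in>{..<d} - {i}. u j * Y j)"
    unfolding dotp_def using assms by (subst sum.remove[of _ i]) auto
  moreover have "dotp d u Y = u i * Y i + (\<Sum>j\<in>{..<d} - {i}. u j * Y j)"
    unfolding dotp_def using assms by (subst sum.remove[of _ i]) auto
  ultimately show ?thesis by (simp add: algebra_simps)
qed

lemma dotp_perturb:
  assumes "i < d"
  shows "dotp d ((x(c := (x c)(i := x c i + t))) b) Y = dotp d (x b) Y + (if b = c then t * Y i else 0)"
  using dotp_fun_upd[OF assms, of "x c" "x c i + t" Y] by auto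

lemma sum_exp_pos: "0 < k \<Longrightarrow> 0 < (\<Sum>b<(k::nat). exp (u b :: real))"
  by (intro sum_pos) auto

text \<open>Moving one coordinate changes one logit only. Both derivatives of the loss thereby
  become derivatives of explicit functions of one real variable.\<close>

lemma sum_exp_perturb:
  assumes "c < (k::nat)"
  shows "(\<Sum>b<k. exp (u b + (if b = c then s else 0))) = (\<Sum>b<k. exp (u b)) + exp (u c) * (exp s - 1 :: real)"
proof -
  have "(\<Sum>b<k. exp (u b + (if b = c then s else 0)))
      = (\<Sum>b<k. exp (u b) + (if b = c then exp (u c) * (exp s - 1) else 0))"
    by (intro sum.cong) (auto simp: exp_add algebra_simps)
  then show ?thesis using assms by (simp add: sum.distrib)
qed

lemma partial_deriv_xent_loss:
  assumes c: "c < k" and i: "i < d"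
  shows "partial_deriv (\<lambda>z. xent_loss k d z Yp) x c i = - residual k d x Yp c * snd Yp i"
proof -
  define Y where "Y = snd Yp"
  define S where "S = (\<Sum>b<k. exp (dotp d (x b) Y))"
  define e where "e = exp (dotp d (x c) Y)"
  have S: "0 < S" unfolding S_def using c by (intro sum_exp_pos) auto
  have eq: "xent_loss k d (x(c := (x c)(i := x c i + t))) Yp
     = - (dotp d (x (fst Yp)) Y + (if fst Yp = c then t * Y i else 0)) + ln (S + e * (exp (t * Y i) - 1))" for t
    unfolding xent_loss_def dotp_perturb[OF i] Y_def[symmetric] S_def e_def
    by (simp only: sum_exp_perturb[OF c])
  have "((\<lambda>t. - (dotp d (x (fst Yp)) Y + (if fst Yp = c then t * Y i else 0)) + ln (S + e * (exp (t * Y i) - 1)))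
      has_field_derivative - residual k d x Yp c * snd Yp i) (at 0)"
    using S by (cases "fst Yp = c")
      (auto intro!: derivative_eq_intros
        simp: residual_def softmax_def Y_def[symmetric] S_def[symmetric] e_def[symmetric] field_simps)
  then show ?thesis
    unfolding partial_deriv_def eq by (rule DERIV_imp_deriv)
qed

lemma softmax_perturb:
  assumes "c < k" "j < d"
  shows "softmax k d (x(c := (x c)(j := x c j + t))) Y c
    = exp (dotp d (x c) Y + t * Y j) / ((\<Sum>b<k. exp (dotp d (x b) Y)) + exp (dotp d (x c) Y) * (exp (t * Y j) - 1))"
  unfolding softmax_def dotp_perturb[OF assms(2)] sum_exp_perturb[OF assms(1)] by simp

lemma hess_entry_xent_loss:
  assumes c: "c < k" and i: "i < d" and j: "j < d"
  shows "hess_entry (\<lambda>z. xent_loss k d z Yp) x c j c i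
     = softmax k d x (snd Yp) c * (1 - softmax k d x (snd Yp) c) * (snd Yp j * snd Yp i)"
proof -
  define Y where "Y = snd Yp"
  define S where "S = (\<Sum>b<k. exp (dotp d (x b) Y))"
  define u where "u = dotp d (x c) Y"
  have Y: "snd Yp = Y" by (simp add: Y_def)
  have S: "0 < S" unfolding S_def using c by (intro sum_exp_pos) auto
  have eq: "- residual k d (x(c := (x c)(j := x c j + t))) Yp c * Y i
    = (exp (u + t * Y j) / (S + exp u * (exp (t * Y j) - 1)) - (if fst Yp = c then 1 else 0)) * Y i" for t
    unfolding residual_def Y softmax_perturb[OF c j] S_def[symmetric] u_def[symmetric]
    by simp
  have "((\<lambda>t. (exp (u + t * Y j) / (S + exp u * (exp (t * Y j) - 1)) - (if fst Yp = c then 1 else 0)) * Y i)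
      has_field_derivative softmax k d x Y c * (1 - softmax k d x Y c) * (Y j * Y i)) (at 0)"
    using S
    by (auto intro!: derivative_eq_intros
        simp: softmax_def S_def[symmetric] u_def[symmetric] field_simps power2_eq_square)
  then show ?thesis
    \<comment> \<open>The formula for the first derivative holds at every point, so it may be
      substituted under the outer derivative.\<close>
    unfolding hess_entry_def partial_deriv_xent_loss[OF c i]
    unfolding partial_deriv_def Y eq by (rule DERIV_imp_deriv)
qed

section \<open>Size of softmax and residual, and the two matrix blocks\<close>

lemma softmax_bounds:
  assumes "c < k"
  shows "0 < softmax k d x Y c" "softmax k d x Y c \<le> 1"
proof -
  have S: "0 < (\<Sum>b<k. exp (dotp d (x b) Y))" using assms by (intro sum_exp_pos) auto
  then show "0 < softmax k d x Y c" by (simp add: softmax_def)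
  have "exp (dotp d (x c) Y) \<le> (\<Sum>b<k. exp (dotp d (x b) Y))"
    using assms by (intro member_le_sum) auto
  then show "softmax k d x Y c \<le> 1" using S by (simp add: softmax_def)
qed

lemma abs_residual_le_1: "c < k \<Longrightarrow> \<bar>residual k d x Yp c\<bar> \<le> 1"
  using softmax_bounds[of c k d x "snd Yp"] by (auto simp: residual_def)

lemma sum_softmax: "0 < k \<Longrightarrow> (\<Sum>c<k. softmax k d x Y c) = 1"
  using sum_exp_pos[of k "\<lambda>b. dotp d (x b) Y"]
  by (simp add: softmax_def flip: sum_divide_distrib)

lemma softmax_lower_bound:
  assumes c: "c < k" and U: "\<And>b. b < k \<Longrightarrow> \<bar>dotp d (x b) Y\<bar> \<le> U"
  shows "exp (- 2 * U) / real k \<le> softmax k d x Y c"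
proof -
  have S: "0 < (\<Sum>b<k. exp (dotp d (x b) Y))" using c by (intro sum_exp_pos) auto
  have "(\<Sum>b<k. exp (dotp d (x b) Y)) \<le> (\<Sum>b<k. exp U)"
    using U by (intro sum_mono) (auto simp: abs_le_iff)
  then have le: "(\<Sum>b<k. exp (dotp d (x b) Y)) \<le> real k * exp U" by simp
  have "exp (- 2 * U) / real k = exp (- U) / (real k * exp U)"
    by (simp add: exp_minus field_simps flip: exp_add)
  also have "\<dots> \<le> exp (- U) / (\<Sum>b<k. exp (dotp d (x b) Y))"
    using S le c by (intro divide_left_mono mult_pos_pos) auto
  also have "\<dots> \<le> softmax k d x Y c"
    unfolding softmax_def using S U[OF c] by (intro divide_right_mono) auto
  finally show ?thesis .
qed

text \<open>Because \<open>k >= 2\<close>, some other class \<open>b\<close> exists; it satisfies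
  the lower bound, and this mass is missing from class \<open>c\<close>.\<close>

lemma softmax_upper_bound:
  assumes k: "2 \<le> k" and c: "c < k" and U: "\<And>b. b < k \<Longrightarrow> \<bar>dotp d (x b) Y\<bar> \<le> U"
  shows "softmax k d x Y c \<le> 1 - exp (- 2 * U) / real k"
proof -
  define b where "b = (if c = 0 then 1 else 0 :: nat)"
  have b: "b < k" "b \<noteq> c" using k by (auto simp: b_def)
  have "softmax k d x Y c + softmax k d x Y b = (\<Sum>a\<in>{c, b}. softmax k d x Y a)"
    using b by simp
  also have "\<dots> \<le> (\<Sum>a<k. softmax k d x Y a)"
    using b c softmax_bounds by (intro sum_mono2) (auto intro: less_imp_le)
  finally show ?thesis
    using softmax_lower_bound[OF b(1), of d x Y U] U sum_softmax[of k d x Y] c by simp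
qed

lemma emp_hess_block_eq:
  assumes "c < k" "i < d" "j < d"
  shows "emp_hess_block k d n Yt x c i j = (1 / real n) *
    (\<Sum>l\<in>{1..n}. (softmax k d x (snd (Yt l)) c * (1 - softmax k d x (snd (Yt l)) c)) *
       (snd (Yt l) i * snd (Yt l) j))"
  unfolding emp_hess_block_def using hess_entry_xent_loss[OF assms(1,3,2)] by simp

lemma emp_G_block_eq:
  assumes "c < k" "i < d" "j < d"
  shows "emp_G_block k d n Yt x c i j = (1 / real n) *
    (\<Sum>l\<in>{1..n}. (residual k d x (Yt l) c)\<^sup>2 * (snd (Yt l) i * snd (Yt l) j))"
  unfolding emp_G_block_def using assms
  by (simp add: partial_deriv_xent_loss power2_eq_square mult_ac)

lemma sgd_Suc_eq:
  assumes "c < k" "i < d"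
  shows "sgd k d \<delta> \<beta> Ys x0 (Suc l) c i = (1 - \<delta> * \<beta>) * sgd k d \<delta> \<beta> Ys x0 l c i
     + \<delta> * residual k d (sgd k d \<delta> \<beta> Ys x0 l) (Ys (Suc l)) c * snd (Ys (Suc l)) i"
  using partial_deriv_xent_loss[OF assms] by (simp add: algebra_simps)

section \<open>Unrolling stochastic gradient descent\<close>

text \<open>Solution of the recursion \<open>u l = \<rho> * u (l - 1) + b l\<close> started at
  0.\<close>

definition discounted :: "real \<Rightarrow> (nat \<Rightarrow> real) \<Rightarrow> nat \<Rightarrow> real" where
  "discounted \<rho> b l = (\<Sum>m\<in>{1..l}. \<rho> ^ (l - m) * b m)"

lemma discounted_0 [simp]: "discounted \<rho> b 0 = 0"
  by (simp add: discounted_def)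

lemma discounted_add:
  "discounted \<rho> b (j + r) = \<rho> ^ r * discounted \<rho> b j + (\<Sum>m\<in>{j+1..j+r}. \<rho> ^ (j + r - m) * b m)"
proof -
  have "{1..j + r} = {1..j} \<union> {j+1..j+r}" by auto
  then have "discounted \<rho> b (j + r) = (\<Sum>m\<in>{1..j}. \<rho> ^ (j + r - m) * b m) + (\<Sum>m\<in>{j+1..j+r}. \<rho> ^ (j + r - m) * b m)"
    unfolding discounted_def by (simp add: sum.union_disjoint)
  also have "(\<Sum>m\<in>{1..j}. \<rho> ^ (j + r - m) * b m) = \<rho> ^ r * discounted \<rho> b j"
    unfolding discounted_def sum_distrib_left
    by (intro sum.cong refl) (auto simp: add.commute simp flip: power_add mult.assoc)
  finally show ?thesis .
qed

lemma discounted_Suc: "discounted \<rho> b (Suc l) = \<rho> * discounted \<rho> b l + b (Suc l)"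
  using discounted_add[of \<rho> b l 1] by simp

text \<open>\<open>1 / \<beta>\<close> is the fixed point of the map sending \<open>t\<close> to
  \<open>(1 - \<delta> * \<beta>) * t + \<delta>\<close>, so the bound reproduces itself at each
  step.\<close>

lemma abs_discounted_le:
  assumes "0 < \<beta>" "0 \<le> \<delta>" "\<delta> * \<beta> \<le> 1" "\<And>m. m \<in> {1..l} \<Longrightarrow> \<bar>b m\<bar> \<le> \<delta>"
  shows "\<bar>discounted (1 - \<delta> * \<beta>) b l\<bar> \<le> 1 / \<beta>"
  using assms(4)
proof (induction l)
  case (Suc l)
  have "\<bar>discounted (1 - \<delta> * \<beta>) b (Suc l)\<bar> \<le> (1 - \<delta> * \<beta>) * \<bar>discounted (1 - \<delta> * \<beta>) b l\<bar> + \<bar>b (Suc l)\<bar>"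
    unfolding discounted_Suc using assms(3)
    by (intro order_trans[OF abs_triangle_ineq]) (simp add: abs_mult)
  also have "\<dots> \<le> (1 - \<delta> * \<beta>) * (1 / \<beta>) + \<delta>"
    using Suc assms(3) by (intro add_mono mult_left_mono) auto
  also have "\<dots> = 1 / \<beta>" using assms(1) by (simp add: field_simps)
  finally show ?case .
qed (use assms in simp)

text \<open>All terms are nonnegative, so only those of window \<open>j\<close> are kept. As
  \<open>l\<close> lies in the following window, their age \<open>l - m\<close> stays below
  \<open>2 * n\<close>.\<close>

lemma discounted_ge_window:
  assumes \<rho>: "0 \<le> \<rho>" "\<rho> \<le> 1" and b: "\<And>m. m \<in> {1..l} \<Longrightarrow> 0 \<le> b m"
    and l: "(j + 1) * n \<le> l" "l \<le> (j + 2) * n"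
  shows "\<rho> ^ (2 * n) * (\<Sum>m\<in>{j*n+1..(j+1)*n}. b m) \<le> discounted \<rho> b l"
proof -
  have "\<rho> ^ (2 * n) * (\<Sum>m\<in>{j*n+1..(j+1)*n}. b m) = (\<Sum>m\<in>{j*n+1..(j+1)*n}. \<rho> ^ (2 * n) * b m)"
    by (simp add: sum_distrib_left)
  also have "\<dots> \<le> (\<Sum>m\<in>{j*n+1..(j+1)*n}. \<rho> ^ (l - m) * b m)"
    using l \<rho> b by (intro sum_mono mult_right_mono power_decreasing) (auto simp: algebra_simps)
  also have "\<dots> \<le> discounted \<rho> b l"
    unfolding discounted_def using l \<rho> b by (intro sum_mono2) auto
  finally show ?thesis .
qed

text \<open>The operator norm of a matrix equals that of its transpose.\<close>
lemma vnorm_combination_le: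
  assumes I: "finite I" and B: "0 \<le> B"
    and op: "\<And>z. (\<Sum>m\<in>I. (dotp d z (Z m))\<^sup>2) \<le> B * dotp d z z"
  shows "vnorm d (\<lambda>i. \<Sum>m\<in>I. c m * Z m i) \<le> sqrt (\<Sum>m\<in>I. (c m)\<^sup>2) * sqrt B"
proof -
  define y where "y = (\<lambda>i. \<Sum>m\<in>I. c m * Z m i)"
  have "vnorm d y * vnorm d y = dotp d y y" by (simp flip: vnorm_square power2_eq_square)
  also have "\<dots> = (\<Sum>m\<in>I. c m * dotp d y (Z m))"
    by (subst (2) y_def) (simp add: dotp_sum_right dotp_scale_right)
  also have "\<dots> \<le> (\<Sum>m\<in>I. \<bar>c m\<bar> * \<bar>dotp d y (Z m)\<bar>)"
    by (intro sum_mono) (simp flip: abs_mult)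
  also have "\<dots> \<le> L2_set c I * L2_set (\<lambda>m. dotp d y (Z m)) I"
    by (rule L2_set_mult_ineq)
  also have "\<dots> \<le> sqrt (\<Sum>m\<in>I. (c m)\<^sup>2) * (sqrt B * vnorm d y)"
    unfolding L2_set_def vnorm_def
    by (intro mult_left_mono) (auto simp: sum_nonneg op simp flip: real_sqrt_mult)
  finally have "vnorm d y * vnorm d y \<le> (sqrt (\<Sum>m\<in>I. (c m)\<^sup>2) * sqrt B) * vnorm d y"
    by (simp add: mult_ac)
  moreover have "0 \<le> sqrt (\<Sum>m\<in>I. (c m)\<^sup>2) * sqrt B" using B by (simp add: sum_nonneg)
  ultimately show ?thesis
    using vnorm_nonneg[of d y] unfolding y_def[symmetric] by (metis mult_le_cancel_right_pos order_le_less)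
qed

text \<open>The coefficients may depend on the noise, so no independence is used: Cauchy-Schwarz and
  the operator norm bound each window by \<open>D = \<delta> * sqrt (n * B)\<close>. Across complete
  windows the past shrinks by \<theta>, which sums to \<open>D / (1 - \<theta>)\<close>; the window
  cut off at \<open>l\<close> adds one more \<open>D\<close>. The intersection with
  \<open>{1..M}\<close> allows for a last window that sticks out beyond the samples.\<close>

lemma discounted_noise_le:
  fixes Z :: "nat \<Rightarrow> nat \<Rightarrow> real"
  assumes n: "0 < n" and \<rho>: "0 \<le> \<rho>" "\<rho> \<le> 1" "\<rho> ^ n \<le> \<theta>" "\<theta> < 1" and B: "0 \<le> B" and \<delta>: "0 \<le> \<delta>"
    and op: "\<And>j z. j \<le> J \<Longrightarrow> (\<Sum>m\<in>{j*n+1..(j+1)*n} \<inter> {1..M}. (dotp d z (Z m))\<^sup>2) \<le> B * dotp d z z"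
    and b: "\<And>m. m \<in> {1..M} \<Longrightarrow> \<bar>b m\<bar> \<le> \<delta>"
    and l: "l \<le> M" "l < (J + 1) * n"
  shows "vnorm d (\<lambda>i. discounted \<rho> (\<lambda>m. b m * Z m i) l) \<le> \<delta> * sqrt (real n * B) * (1 / (1 - \<theta>) + 1)"
proof -
  define D where "D = \<delta> * sqrt (real n * B)"
  define N where "N l = (\<lambda>i. discounted \<rho> (\<lambda>m. b m * Z m i) l)" for l
  have D0: "0 \<le> D" using \<delta> B by (simp add: D_def)
  have step: "vnorm d (\<lambda>i. \<Sum>m\<in>{j*n+1..j*n+r}. \<rho> ^ (j*n+r - m) * (b m * Z m i)) \<le> D"
    if j: "j \<le> J" and r: "r \<le> n" and le: "j * n + r \<le> M" for j r
  proof -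
    have sub: "{j*n+1..j*n+r} \<subseteq> {j*n+1..(j+1)*n} \<inter> {1..M}" using r le by auto
    have "vnorm d (\<lambda>i. \<Sum>m\<in>{j*n+1..j*n+r}. (\<rho> ^ (j*n+r - m) * b m) * Z m i)
       \<le> sqrt (\<Sum>m\<in>{j*n+1..j*n+r}. (\<rho> ^ (j*n+r - m) * b m)\<^sup>2) * sqrt B"
    proof (intro vnorm_combination_le B)
      fix z
      have "(\<Sum>m\<in>{j*n+1..j*n+r}. (dotp d z (Z m))\<^sup>2) \<le> (\<Sum>m\<in>{j*n+1..(j+1)*n} \<inter> {1..M}. (dotp d z (Z m))\<^sup>2)"
        using sub by (intro sum_mono2) auto
      also note op[OF j]
      finally show "(\<Sum>m\<in>{j*n+1..j*n+r}. (dotp d z (Z m))\<^sup>2) \<le> B * dotp d z z" .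
    qed simp
    also have "\<dots> \<le> sqrt (\<Sum>m\<in>{j*n+1..j*n+r}. \<delta>\<^sup>2) * sqrt B"
    proof (intro mult_right_mono real_sqrt_le_mono sum_mono)
      fix m assume m: "m \<in> {j*n+1..j*n+r}"
      have "\<bar>\<rho> ^ (j*n+r - m) * b m\<bar> = \<rho> ^ (j*n+r - m) * \<bar>b m\<bar>"
        using \<rho> by (simp add: abs_mult)
      also have "\<dots> \<le> 1 * \<delta>"
        using m le \<rho> by (intro mult_mono b power_le_one) auto
      finally have "\<bar>\<rho> ^ (j*n+r - m) * b m\<bar> \<le> \<bar>\<delta>\<bar>" using \<delta> by simp
      then show "(\<rho> ^ (j*n+r - m) * b m)\<^sup>2 \<le> \<delta>\<^sup>2" by (simp only: abs_le_square_iff)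
    qed (use B in simp)
    also have "\<dots> = \<delta> * sqrt (real r * B)"
      using \<delta> by (simp add: real_sqrt_mult)
    also have "\<dots> \<le> D" unfolding D_def using \<delta> B r by (intro mult_left_mono) (auto intro: mult_right_mono)
    finally show ?thesis by (simp add: mult.assoc)
  qed
  have N_split: "vnorm d (N (j*n+r)) \<le> \<rho> ^ r * vnorm d (N (j*n)) + D"
    if j: "j \<le> J" and r: "r \<le> n" and le: "j * n + r \<le> M" for j r
  proof -
    have "N (j*n+r) = (\<lambda>i. \<rho> ^ r * N (j*n) i + (\<Sum>m\<in>{j*n+1..j*n+r}. \<rho> ^ (j*n+r - m) * (b m * Z m i)))"
      unfolding N_def discounted_add ..
    then have "vnorm d (N (j*n+r)) \<le> vnorm d (\<lambda>i. \<rho> ^ r * N (j*n) i)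
        + vnorm d (\<lambda>i. \<Sum>m\<in>{j*n+1..j*n+r}. \<rho> ^ (j*n+r - m) * (b m * Z m i))"
      by (simp only: vnorm_triangle)
    then show ?thesis using step[OF that] \<rho> by (simp add: vnorm_scale)
  qed
  \<comment> \<open>At multiples of \<open>n\<close> the norm obeys
    \<open>t' <= \<theta> * t + D\<close>, whose fixed point is
    \<open>D / (1 - \<theta>)\<close>.\<close>
  have grid: "j * n \<le> M \<Longrightarrow> j \<le> J + 1 \<Longrightarrow> vnorm d (N (j * n)) \<le> D / (1 - \<theta>)" for j
  proof (induction j)
    case 0
    then show ?case using D0 \<rho> by (simp add: N_def)
  next
    case (Suc j)
    have "vnorm d (N (Suc j * n)) \<le> \<rho> ^ n * vnorm d (N (j*n)) + D"
      using N_split[of j n] Suc.prems by (simp add: add.commute)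
    also have "\<dots> \<le> \<theta> * (D / (1 - \<theta>)) + D"
      using Suc \<rho> D0 by (intro add_mono mult_mono) (auto intro: order_trans[OF _ \<rho>(3)])
    also have "\<dots> = D / (1 - \<theta>)" using \<rho> by (simp add: field_simps)
    finally show ?case .
  qed
  define j r where "j = l div n" and "r = l mod n"
  have jr: "l = j * n + r" "r \<le> n" using n by (auto simp: j_def r_def less_imp_le)
  have j: "j \<le> J" using l n by (simp add: j_def less_mult_imp_div_less Suc_leI flip: less_Suc_eq_le)
  have "vnorm d (N l) \<le> \<rho> ^ r * vnorm d (N (j*n)) + D"
    using N_split[OF j jr(2)] l jr(1) by simp
  also have "\<dots> \<le> 1 * (D / (1 - \<theta>)) + D"
    using grid[of j] j l jr(1) \<rho> D0 by (intro add_mono mult_mono power_le_one) auto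
  finally show ?thesis by (simp add: N_def D_def algebra_simps)
qed

lemma one_minus_ge_exp:
  fixes x :: real
  assumes "0 \<le> x" "x \<le> 1 / 2"
  shows "exp (- 2 * x) \<le> 1 - x"
proof -
  have "inverse (1 - x) \<le> 1 + 2 * x"
  proof -
    have "1 \<le> (1 + 2 * x) * (1 - x)"
      using assms mult_nonneg_nonneg[of x "1 - 2 * x"] by (simp add: algebra_simps)
    then show ?thesis using assms by (simp add: field_simps)
  qed
  also have "\<dots> \<le> exp (2 * x)" by (rule exp_ge_add_one_self)
  finally have "inverse (exp (2 * x)) \<le> inverse (inverse (1 - x))"
    using assms by (intro le_imp_inverse_le) auto
  then show ?thesis by (simp add: exp_minus)
qed

text \<open>Steps at which the iterate has left the ball of radius \<^term>\<open>R\<close> count as good, so that the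
  conditional probability of a good step is bounded below for every past.\<close>
definition good_sample :: "nat \<Rightarrow> nat \<Rightarrow> (nat \<Rightarrow> nat \<Rightarrow> nat \<Rightarrow> real) \<Rightarrow> real \<Rightarrow> (nat \<Rightarrow> nat \<times> (nat \<Rightarrow> real)) \<Rightarrow> nat \<Rightarrow> nat \<Rightarrow> bool" where
  "good_sample k d x R t c m \<longleftrightarrow>
     (fst (t m) = c \<and> (\<forall>b<k. \<bar>dotp d (x (m - 1) b) (snd (t m))\<bar> \<le> 1)) \<or> (\<exists>b<k. R < vnorm d (x (m - 1) b))"

text \<open>Origin of \<open>R + 1\<close> in the later constant \<eta>: the mean contributes at
  most \<open>R\<close> to a logit, the noise at most 1.\<close>

lemma abs_dotp_data_point_le:
  assumes "vnorm d u \<le> R" "vnorm d (mu (fst s)) = 1" "\<bar>dotp d u (snd s)\<bar> \<le> 1"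
  shows "\<bar>dotp d u (snd (data_point mu s))\<bar> \<le> R + 1"
proof -
  have "dotp d u (snd (data_point mu s)) = dotp d u (mu (fst s)) + dotp d u (snd s)"
    by (simp add: data_point_def dotp_add_right)
  moreover have "\<bar>dotp d u (mu (fst s))\<bar> \<le> R" using abs_dotp_le[of d u "mu (fst s)"] assms by simp
  ultimately show ?thesis using assms by simp
qed

lemma sgd_eq_discounted:
  assumes "c < k" "i < d"
  shows "sgd k d \<delta> \<beta> Ys x0 l c i = (1 - \<delta> * \<beta>) ^ l * x0 c i + discounted (1 - \<delta> * \<beta>)
     (\<lambda>m. \<delta> * residual k d (sgd k d \<delta> \<beta> Ys x0 (m - 1)) (Ys m) c * snd (Ys m) i) l"
proof (induction l)
  case (Suc l)
  show ?case
    unfolding sgd_Suc_eq[OF assms] discounted_Suc Suc by (simp add: algebra_simps)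
qed simp

section \<open>Deterministic bounds for the iterates on good training data\<close>

context
  fixes k d n M J :: nat and \<delta> \<beta> B R q :: real
    and mu :: "nat \<Rightarrow> nat \<Rightarrow> real" and t :: "nat \<Rightarrow> nat \<times> (nat \<Rightarrow> real)" and x0 :: "nat \<Rightarrow> nat \<Rightarrow> real"
    and x :: "nat \<Rightarrow> nat \<Rightarrow> nat \<Rightarrow> real"
  assumes x_def: "x = sgd k d \<delta> \<beta> (\<lambda>m. data_point mu (t m)) x0"
    and k: "2 \<le> k" and \<beta>: "0 < \<beta>" and \<delta>: "0 < \<delta>" "\<delta> \<le> 1" "\<delta> * \<beta> \<le> 1 / 2"
    and n: "n = nat \<lceil>1 / \<delta>\<rceil>" and B: "0 \<le> B"
    and mu_unit: "\<And>b. b < k \<Longrightarrow> vnorm d (mu b) = 1"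
    and labels: "\<And>m. m \<in> {1..M} \<Longrightarrow> fst (t m) < k"
    and x0: "\<And>c. c < k \<Longrightarrow> vnorm d (x0 c) \<le> 2"
    and op: "\<And>j z. j \<le> J \<Longrightarrow> (\<Sum>m\<in>{j*n+1..(j+1)*n} \<inter> {1..M}. (dotp d z (snd (t m)))\<^sup>2) \<le> B * real n * dotp d z z"
    and R: "2 + real k / \<beta> + 2 * sqrt B * (1 / (1 - exp (- \<beta>)) + 1) \<le> R"
    and count: "\<And>c j. c < k \<Longrightarrow> j \<le> J \<Longrightarrow> (j + 1) * n \<le> M \<Longrightarrow>
       q * real n \<le> real (card {m \<in> {j*n+1..(j+1)*n}. good_sample k d x R t c m})"
begin

lemma window_length: "1 \<le> \<delta> * real n" "\<delta> * real n \<le> 2" "0 < n"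
proof -
  have "1 / \<delta> \<le> real n" using \<delta> by (simp add: n)
  then show "1 \<le> \<delta> * real n" using \<delta> by (simp add: field_simps)
  have "real n \<le> 1 / \<delta> + 1"
    using \<delta> by (simp add: n)
  then have "\<delta> * real n \<le> \<delta> * (1 / \<delta> + 1)" using \<delta> by (intro mult_left_mono) auto
  also have "\<dots> \<le> 2" using \<delta> by (simp add: algebra_simps)
  finally show "\<delta> * real n \<le> 2" .
  show "0 < n" using \<delta> by (simp add: n)
qed

lemma le_windows:
  assumes "real l \<le> real J / \<delta>"
  shows "l \<le> J * n"
proof -
  have "1 / \<delta> \<le> real n" using \<delta> by (simp add: n)
  then have "real J * (1 / \<delta>) \<le> real J * real n" by (intro mult_left_mono) auto
  with assms have "real l \<le> real (J * n)" by simp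
  then show ?thesis by (simp only: of_nat_le_iff)
qed

lemma decay: "0 \<le> 1 - \<delta> * \<beta>" "1 - \<delta> * \<beta> \<le> 1" "(1 - \<delta> * \<beta>) ^ l \<le> exp (- \<beta> * (\<delta> * real l))"
  "exp (- 2 * \<beta> * (\<delta> * real l)) \<le> (1 - \<delta> * \<beta>) ^ l"
proof -
  show 0: "0 \<le> 1 - \<delta> * \<beta>" and "1 - \<delta> * \<beta> \<le> 1" using \<delta> \<beta> by auto
  have "(1 - \<delta> * \<beta>) ^ l \<le> exp (- (\<delta> * \<beta>)) ^ l"
    using exp_ge_add_one_self[of "- (\<delta> * \<beta>)"] 0 by (intro power_mono) auto
  then show "(1 - \<delta> * \<beta>) ^ l \<le> exp (- \<beta> * (\<delta> * real l))"
    by (simp add: mult_ac flip: exp_of_nat_mult)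
  have "exp (- 2 * (\<delta> * \<beta>)) ^ l \<le> (1 - \<delta> * \<beta>) ^ l"
    using one_minus_ge_exp[of "\<delta> * \<beta>"] \<delta> \<beta> by (intro power_mono) auto
  then show "exp (- 2 * \<beta> * (\<delta> * real l)) \<le> (1 - \<delta> * \<beta>) ^ l"
    by (simp add: mult_ac flip: exp_of_nat_mult)
qed

definition step_coeff :: "nat \<Rightarrow> nat \<Rightarrow> real" where
  "step_coeff c m = \<delta> * residual k d (x (m - 1)) (data_point mu (t m)) c"

text \<open>The coefficient of \<open>mu b\<close> in the iterate, obtained by grouping the SGD
  steps by label.\<close>

definition signal :: "nat \<Rightarrow> nat \<Rightarrow> nat \<Rightarrow> real" where
  "signal l c b = discounted (1 - \<delta> * \<beta>) (\<lambda>m. if fst (t m) = b then step_coeff c m else 0) l"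

definition remainder :: "nat \<Rightarrow> nat \<Rightarrow> nat \<Rightarrow> real" where
  "remainder l c i = (1 - \<delta> * \<beta>) ^ l * x0 c i + discounted (1 - \<delta> * \<beta>) (\<lambda>m. step_coeff c m * snd (t m) i) l"

lemma abs_step_coeff_le: "c < k \<Longrightarrow> \<bar>step_coeff c m\<bar> \<le> \<delta>"
  unfolding step_coeff_def using \<delta> abs_residual_le_1[of c k d] by (simp add: abs_mult mult_left_le)

lemma sgd_decomposition:
  assumes c: "c < k" and i: "i < d" and l: "l \<le> M"
  shows "x l c i = (\<Sum>b<k. signal l c b * mu b i) + remainder l c i"
proof -
  have "(\<Sum>b<k. signal l c b * mu b i)
      = (\<Sum>m\<in>{1..l}. \<Sum>b<k. if fst (t m) = b then (1 - \<delta> * \<beta>) ^ (l - m) * (step_coeff c m * mu b i) else 0)"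
    unfolding signal_def discounted_def sum_distrib_right
    by (subst sum.swap) (intro sum.cong, auto)
  also have "\<dots> = (\<Sum>m\<in>{1..l}. (1 - \<delta> * \<beta>) ^ (l - m) * (step_coeff c m * mu (fst (t m)) i))"
    using labels l by (intro sum.cong refl) auto
  finally have 1: "(\<Sum>b<k. signal l c b * mu b i) = \<dots>" .
  have "x l c i = (1 - \<delta> * \<beta>) ^ l * x0 c i + discounted (1 - \<delta> * \<beta>)
     (\<lambda>m. step_coeff c m * (mu (fst (t m)) i + snd (t m) i)) l"
    unfolding step_coeff_def using sgd_eq_discounted[OF c i, of \<delta> \<beta> "\<lambda>m. data_point mu (t m)" x0 l]
    by (simp add: x_def data_point_def)
  then show ?thesis
    unfolding 1 by (simp add: remainder_def discounted_def sum.distrib algebra_simps)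
qed

lemma abs_signal_le: "c < k \<Longrightarrow> \<bar>signal l c b\<bar> \<le> 1 / \<beta>"
  unfolding signal_def using \<beta> \<delta> abs_step_coeff_le by (intro abs_discounted_le) auto

lemma vnorm_remainder_le:
  assumes c: "c < k" and l: "l \<le> M" "real l \<le> real J / \<delta>"
  shows "vnorm d (remainder l c) \<le> 2 * exp (- \<beta> * (\<delta> * real l)) + 2 * sqrt B * (1 / (1 - exp (- \<beta>)) + 1)"
proof -
  have 1: "vnorm d (\<lambda>i. (1 - \<delta> * \<beta>) ^ l * x0 c i) \<le> exp (- \<beta> * (\<delta> * real l)) * 2"
    unfolding vnorm_scale using decay x0[OF c] by (intro mult_mono) auto
  have "vnorm d (\<lambda>i. discounted (1 - \<delta> * \<beta>) (\<lambda>m. step_coeff c m * snd (t m) i) l)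
       \<le> \<delta> * sqrt (real n * (B * real n)) * (1 / (1 - exp (- \<beta>)) + 1)"
  proof (rule discounted_noise_le[where J=J and M=M])
    show "(1 - \<delta> * \<beta>) ^ n \<le> exp (- \<beta>)"
      using decay(3)[of n] window_length \<beta>
      by (intro order_trans[OF decay(3)]) simp
    have "l \<le> J * n" using le_windows[OF l(2)] .
    then show "l < (J + 1) * n" using window_length by simp
  qed (use window_length decay \<beta> \<delta> B op abs_step_coeff_le[OF c] l in auto)
  \<comment> \<open>The operator norm over a window is \<open>B * n\<close> and there are
    \<open>n\<close> coefficients, so step size and length enter only through
    \<open>\<delta> * n <= 2\<close>.\<close>
  also have "\<delta> * sqrt (real n * (B * real n)) = (\<delta> * real n) * sqrt B"
    by (simp add: real_sqrt_mult)
  also have "(\<delta> * real n) * sqrt B * (1 / (1 - exp (- \<beta>)) + 1) \<le> 2 * sqrt B * (1 / (1 - exp (- \<beta>)) + 1)"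
    using window_length B \<beta> by (intro mult_right_mono) auto
  finally have 2: "vnorm d (\<lambda>i. discounted (1 - \<delta> * \<beta>) (\<lambda>m. step_coeff c m * snd (t m) i) l)
     \<le> 2 * sqrt B * (1 / (1 - exp (- \<beta>)) + 1)" .
  have "vnorm d (remainder l c) \<le> vnorm d (\<lambda>i. (1 - \<delta> * \<beta>) ^ l * x0 c i)
     + vnorm d (\<lambda>i. discounted (1 - \<delta> * \<beta>) (\<lambda>m. step_coeff c m * snd (t m) i) l)"
    unfolding remainder_def[abs_def] by (rule vnorm_triangle)
  also have "\<dots> \<le> exp (- \<beta> * (\<delta> * real l)) * 2 + 2 * sqrt B * (1 / (1 - exp (- \<beta>)) + 1)"
    by (intro add_mono 1 2)
  finally show ?thesis by (simp add: mult.commute)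
qed

text \<open>Rules out the escape clause of \<open>good_sample\<close> up to the horizon. There is no
  circularity: signal and remainder are bounded through residuals of modulus at most 1 and the noise
  operator norm, without any count of good steps.\<close>

lemma vnorm_sgd_le:
  assumes c: "c < k" and l: "l \<le> M" "real l \<le> real J / \<delta>"
  shows "vnorm d (x l c) \<le> R"
proof -
  have "vnorm d (x l c) = vnorm d (\<lambda>i. (\<Sum>b<k. signal l c b * mu b i) + remainder l c i)"
    using sgd_decomposition[OF c _ l(1)] by (intro vnorm_cong)
  also have "\<dots> \<le> vnorm d (\<lambda>i. \<Sum>b<k. signal l c b * mu b i) + vnorm d (remainder l c)"
    by (rule vnorm_triangle)
  also have "vnorm d (\<lambda>i. \<Sum>b<k. signal l c b * mu b i) \<le> (\<Sum>b<k. vnorm d (\<lambda>i. signal l c b * mu b i))"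
    by (rule vnorm_sum) simp
  also have "\<dots> \<le> (\<Sum>b<k. 1 / \<beta>)"
    using abs_signal_le[OF c] mu_unit by (intro sum_mono) (simp add: vnorm_scale)
  also have "\<dots> = real k / \<beta>" by simp
  also have "vnorm d (remainder l c) \<le> 2 * 1 + 2 * sqrt B * (1 / (1 - exp (- \<beta>)) + 1)"
    using vnorm_remainder_le[OF assms] \<beta> \<delta>
    by (intro order_trans[OF vnorm_remainder_le[OF assms]] add_right_mono mult_left_mono) auto
  finally show ?thesis using R by simp
qed

text \<open>A good step of class \<open>c\<close> contributes at least
  \<open>\<delta> * \<eta>\<close>, hence a window at least
  \<open>\<delta> * n * \<eta> * q >= \<eta> * q\<close>. It is discounted over at most
  \<open>2 * n\<close> steps, and \<open>\<delta> * n <= 2\<close> gives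
  \<open>exp (- 8 * \<beta>)\<close>. By the same estimate \<open>4 / \<delta> <= l\<close> ensures
  that a complete window precedes \<open>l\<close>.\<close>

lemma signal_ge:
  assumes c: "c < k" and l: "l \<le> M" "real l \<le> real J / \<delta>" "4 / \<delta> \<le> real l"
  shows "exp (- 8 * \<beta>) * (exp (- 2 * (R + 1)) / real k * q) \<le> signal l c c"
proof -
  define \<eta> where "\<eta> = exp (- 2 * (R + 1)) / real k"
  define b where "b m = (if fst (t m) = c then step_coeff c m else 0)" for m
  have \<eta>: "0 \<le> \<eta>" by (simp add: \<eta>_def)
  have b0: "0 \<le> b m" for m
    using \<delta> softmax_bounds(2)[OF c] by (auto simp: b_def step_coeff_def residual_def data_point_def)
  have b_good: "\<delta> * \<eta> \<le> b m" if m: "m \<in> {1..l}" and g: "good_sample k d x R t c m" for m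
  proof -
    \<comment> \<open>The iterate before step \<open>m\<close> lies in the ball, so a good step is
      good by its label and its small noise.\<close>
    have small: "vnorm d (x (m - 1) b) \<le> R" if "b < k" for b
      using m l by (intro vnorm_sgd_le that) auto
    then have ac: "fst (t m) = c" and dot: "\<And>b. b < k \<Longrightarrow> \<bar>dotp d (x (m - 1) b) (snd (t m))\<bar> \<le> 1"
      using g unfolding good_sample_def by (auto simp: not_less[symmetric])
    have "softmax k d (x (m - 1)) (snd (data_point mu (t m))) c \<le> 1 - \<eta>"
      unfolding \<eta>_def
      using k c ac by (intro softmax_upper_bound abs_dotp_data_point_le small dot mu_unit) auto
    then have "\<eta> \<le> residual k d (x (m - 1)) (data_point mu (t m)) c"
      using ac by (simp add: residual_def data_point_def)
    then show ?thesis using ac \<delta> by (simp add: b_def step_coeff_def)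
  qed
  have n0: "0 < n" using window_length by simp
  have l2n: "2 * n \<le> l"
  proof -
    have "2 * real n \<le> 4 / \<delta>" using window_length \<delta> by (simp add: field_simps)
    then show ?thesis using l(3) by linarith
  qed
  \<comment> \<open>The last complete window before \<open>l\<close>: window \<open>j\<close> ends
    at \<open>(j + 1) * n\<close>, and \<open>(j + 1) * n <= l < (j + 2) * n\<close>.\<close>
  define j where "j = l div n - 1"
  have "2 \<le> l div n" using l2n n0 by (simp add: less_eq_div_iff_mult_less_eq)
  then have j1: "l div n = j + 1" by (simp add: j_def)
  have jl: "(j + 1) * n \<le> l" using j1 by (metis div_times_less_eq_dividend)
  have lj: "l \<le> (j + 2) * n"
    using dividend_less_div_times[OF n0, of l] unfolding j1 by (simp add: algebra_simps)
  have "l \<le> J * n" using le_windows[OF l(2)] .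
  then have "(j + 1) * n \<le> J * n" using jl by linarith
  then have "j + 1 \<le> J" using n0 mult_le_cancel2 by blast
  then have jJ: "j \<le> J" by simp
  define G where "G = {m \<in> {j*n+1..(j+1)*n}. good_sample k d x R t c m}"
  have "\<delta> * \<eta> * (q * real n) \<le> \<delta> * \<eta> * real (card G)"
    unfolding G_def using count[OF c jJ] jl l \<delta> \<eta> by (intro mult_left_mono) auto
  also have "\<dots> = (\<Sum>m\<in>G. \<delta> * \<eta>)" by simp
  also have "\<dots> \<le> (\<Sum>m\<in>G. b m)"
    using jl by (intro sum_mono b_good) (auto simp: G_def)
  also have "\<dots> \<le> (\<Sum>m\<in>{j*n+1..(j+1)*n}. b m)"
    using b0 by (intro sum_mono2) (auto simp: G_def)
  finally have sum_ge: "\<delta> * \<eta> * (q * real n) \<le> (\<Sum>m\<in>{j*n+1..(j+1)*n}. b m)" .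
  have sum0: "0 \<le> (\<Sum>m\<in>{j*n+1..(j+1)*n}. b m)" using b0 by (intro sum_nonneg) auto
  have "\<eta> * q \<le> (\<Sum>m\<in>{j*n+1..(j+1)*n}. b m)"
  proof (cases "0 \<le> q")
    case True
    then have "1 * (\<eta> * q) \<le> (\<delta> * real n) * (\<eta> * q)"
      using window_length \<eta> by (intro mult_right_mono) auto
    then show ?thesis using sum_ge by (simp add: mult_ac)
  next
    case False
    then have "\<eta> * q \<le> 0" using \<eta> by (simp add: mult_le_0_iff)
    then show ?thesis using sum0 by linarith
  qed
  then have "exp (- 8 * \<beta>) * (\<eta> * q) \<le> exp (- 8 * \<beta>) * (\<Sum>m\<in>{j*n+1..(j+1)*n}. b m)"
    by (intro mult_left_mono) auto
  also have "\<dots> \<le> (1 - \<delta> * \<beta>) ^ (2 * n) * (\<Sum>m\<in>{j*n+1..(j+1)*n}. b m)"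
  proof (intro mult_right_mono sum0 order_trans[OF _ decay(4)])
    have "\<beta> * (\<delta> * real n) \<le> \<beta> * 2" using window_length \<beta> by (intro mult_left_mono) auto
    then show "exp (- 8 * \<beta>) \<le> exp (- 2 * \<beta> * (\<delta> * real (2 * n)))"
      by (simp add: mult_ac)
  qed
  also have "\<dots> \<le> signal l c c"
    unfolding signal_def b_def[symmetric]
    using decay b0 jl lj by (intro discounted_ge_window) auto
  finally show ?thesis by (simp add: \<eta>_def)
qed

end

section \<open>Gaussian tails and the operator norm on a lattice\<close>

definition normal_measure :: "real \<Rightarrow> real measure" where
  "normal_measure v = density lborel (normal_density 0 (sqrt v))"

lemma gauss_vec_eq: "gauss_vec d v = (\<Pi>\<^sub>M i\<in>{..<d}. normal_measure v)"
  by (simp add: gauss_vec_def normal_measure_def)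

lemma sets_normal_measure [measurable_cong, simp]: "sets (normal_measure v) = sets borel"
  by (simp add: normal_measure_def)

lemma space_normal_measure [simp]: "space (normal_measure v) = UNIV"
  by (simp add: normal_measure_def)

lemma prob_space_normal_measure: "0 < v \<Longrightarrow> prob_space (normal_measure v)"
  unfolding normal_measure_def by (rule prob_space_normal_density) simp

lemma prob_space_gauss_vec: "0 < v \<Longrightarrow> prob_space (gauss_vec d v)"
  unfolding gauss_vec_eq by (intro prob_space_PiM prob_space_normal_measure)

lemma nn_integral_normal_density:
  assumes "0 < \<sigma>"
  shows "(\<integral>\<^sup>+z. ennreal (normal_density \<mu> \<sigma> z) \<partial>lborel) = 1"
proof -
  interpret prob_space "density lborel (normal_density \<mu> \<sigma>)"
    by (rule prob_space_normal_density[OF assms])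
  show ?thesis using emeasure_space_1 by (simp add: emeasure_density)
qed

lemma nn_integral_normal_exp:
  assumes "0 < v"
  shows "(\<integral>\<^sup>+z. ennreal (exp (b * z)) \<partial>normal_measure v) = ennreal (exp (b\<^sup>2 * v / 2))"
proof -
  have eq: "normal_density 0 (sqrt v) z * exp (b * z) = exp (b\<^sup>2 * v / 2) * normal_density (b * v) (sqrt v) z" for z
  proof -
    have "- z\<^sup>2 / (2 * v) + b * z = b\<^sup>2 * v / 2 + - (z - b * v)\<^sup>2 / (2 * v)"
      using assms by (simp add: field_simps power2_eq_square)
    then have "exp (- z\<^sup>2 / (2 * v)) * exp (b * z) = exp (b\<^sup>2 * v / 2) * exp (- (z - b * v)\<^sup>2 / (2 * v))"
      unfolding exp_add[symmetric] by simp
    then show ?thesis using assms by (simp add: normal_density_def)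
  qed
  have "(\<integral>\<^sup>+z. ennreal (exp (b * z)) \<partial>normal_measure v)
      = (\<integral>\<^sup>+z. ennreal (exp (b\<^sup>2 * v / 2)) * ennreal (normal_density (b * v) (sqrt v) z) \<partial>lborel)"
    unfolding normal_measure_def
    by (subst nn_integral_density) (auto simp: eq simp flip: ennreal_mult)
  also have "\<dots> = ennreal (exp (b\<^sup>2 * v / 2))"
    using assms by (simp add: nn_integral_cmult nn_integral_normal_density)
  finally show ?thesis .
qed

text \<open>The factor doubles the variance of the density, at the price of the normalisation
  \<open>sqrt 2\<close>.\<close>

lemma nn_integral_normal_exp_square:
  assumes "0 < v"
  shows "(\<integral>\<^sup>+z. ennreal (exp (z\<^sup>2 / (4 * v))) \<partial>normal_measure v) = ennreal (sqrt 2)"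
proof -
  have eq: "normal_density 0 (sqrt v) z * exp (z\<^sup>2 / (4 * v)) = sqrt 2 * normal_density 0 (sqrt (2 * v)) z" for z
  proof -
    have "- z\<^sup>2 / (2 * v) + z\<^sup>2 / (4 * v) = - z\<^sup>2 / (2 * (2 * v))"
      using assms by (simp add: field_simps)
    then have "exp (- z\<^sup>2 / (2 * v)) * exp (z\<^sup>2 / (4 * v)) = exp (- z\<^sup>2 / (2 * (2 * v)))"
      unfolding exp_add[symmetric] by simp
    then have "normal_density 0 (sqrt v) z * exp (z\<^sup>2 / (4 * v)) = 1 / sqrt (2 * pi * v) * exp (- z\<^sup>2 / (2 * (2 * v)))"
      using assms by (simp add: normal_density_def)
    also have "1 / sqrt (2 * pi * v) = sqrt 2 * (1 / sqrt (2 * pi * (2 * v)))"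
    proof -
      have "sqrt (2 * pi * (2 * v)) = sqrt 2 * sqrt (2 * pi * v)"
        by (simp add: mult_ac flip: real_sqrt_mult)
      then show ?thesis by simp
    qed
    finally show ?thesis using assms by (simp add: normal_density_def)
  qed
  have "(\<integral>\<^sup>+z. ennreal (exp (z\<^sup>2 / (4 * v))) \<partial>normal_measure v)
      = (\<integral>\<^sup>+z. ennreal (sqrt 2) * ennreal (normal_density 0 (sqrt (2 * v)) z) \<partial>lborel)"
    unfolding normal_measure_def
    by (subst nn_integral_density) (auto simp: eq simp flip: ennreal_mult)
  also have "\<dots> = ennreal (sqrt 2)"
    using assms by (simp add: nn_integral_cmult nn_integral_normal_density)
  finally show ?thesis .
qed

lemma nn_integral_gauss_vec_prod:
  assumes v: "0 < v" and f: "\<And>i. i < d \<Longrightarrow> f i \<in> borel_measurable borel"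
  shows "(\<integral>\<^sup>+z. (\<Prod>i<d. f i (z i)) \<partial>gauss_vec d v) = (\<Prod>i<d. \<integral>\<^sup>+z. f i z \<partial>normal_measure v)"
proof -
  interpret product_sigma_finite "\<lambda>_. normal_measure v"
    unfolding product_sigma_finite_def
    using prob_space_imp_sigma_finite[OF prob_space_normal_measure[OF v]] by auto
  show ?thesis unfolding gauss_vec_eq using f
    by (intro product_nn_integral_prod) (auto simp: measurable_def)
qed

lemma nn_integral_gauss_vec_exp_dotp:
  assumes v: "0 < v"
  shows "(\<integral>\<^sup>+z. ennreal (exp (b * dotp d \<theta> z)) \<partial>gauss_vec d v) = ennreal (exp (b\<^sup>2 * (v * dotp d \<theta> \<theta>) / 2))"
proof -
  have "(\<integral>\<^sup>+z. ennreal (exp (b * dotp d \<theta> z)) \<partial>gauss_vec d v)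
      = (\<integral>\<^sup>+z. (\<Prod>i<d. ennreal (exp ((b * \<theta> i) * z i))) \<partial>gauss_vec d v)"
    by (simp add: dotp_def sum_distrib_left exp_sum prod_ennreal mult.assoc)
  also have "\<dots> = (\<Prod>i<d. \<integral>\<^sup>+z. ennreal (exp ((b * \<theta> i) * z)) \<partial>normal_measure v)"
    by (rule nn_integral_gauss_vec_prod[OF v]) simp
  also have "\<dots> = (\<Prod>i<d. ennreal (exp ((b * \<theta> i)\<^sup>2 * v / 2)))"
    using nn_integral_normal_exp[OF v] by simp
  also have "\<dots> = ennreal (exp (\<Sum>i<d. (b * \<theta> i)\<^sup>2 * v / 2))"
    by (simp add: exp_sum prod_ennreal)
  also have "(\<Sum>i<d. (b * \<theta> i)\<^sup>2 * v / 2) = b\<^sup>2 * (v * dotp d \<theta> \<theta>) / 2"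
    by (simp add: dotp_def sum_distrib_left sum_divide_distrib power2_eq_square mult_ac)
  finally show ?thesis .
qed

lemma borel_measurable_gauss_vec_component [measurable]:
  "i < d \<Longrightarrow> (\<lambda>z. z i) \<in> borel_measurable (gauss_vec d v)"
  unfolding gauss_vec_eq by measurable

lemma borel_measurable_dotp:
  assumes "\<And>i. i < d \<Longrightarrow> (\<lambda>w. f w i) \<in> borel_measurable M" "\<And>i. i < d \<Longrightarrow> (\<lambda>w. g w i) \<in> borel_measurable M"
  shows "(\<lambda>w. dotp d (f w) (g w)) \<in> borel_measurable M"
  unfolding dotp_def using assms by (intro borel_measurable_sum borel_measurable_times) auto

text \<open>Linearisation of the square in the exponent:
  \<^term>\<open>exp (b\<^sup>2 * s / 2)\<close> is the moment generating function of an independent centred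
  Gaussian of variance \<^term>\<open>s\<close>.\<close>
lemma nn_integral_gauss_vec_exp_dotp_square:
  assumes v: "0 < v" and a: "0 \<le> a" "a * (v * dotp d \<theta> \<theta>) \<le> 1 / 4"
  shows "(\<integral>\<^sup>+z. ennreal (exp (a * (dotp d \<theta> z)\<^sup>2)) \<partial>gauss_vec d v) \<le> ennreal (sqrt 2)"
proof -
  interpret N: prob_space "normal_measure 1" by (rule prob_space_normal_measure) simp
  interpret G: prob_space "gauss_vec d v" by (rule prob_space_gauss_vec[OF v])
  interpret pair_sigma_finite "gauss_vec d v" "normal_measure 1"
    by (intro pair_sigma_finite.intro G.sigma_finite_measure_axioms N.sigma_finite_measure_axioms)
  have m[measurable]: "(\<lambda>z. dotp d \<theta> z) \<in> borel_measurable (gauss_vec d v)"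
    by (intro borel_measurable_dotp) auto
  have "(\<integral>\<^sup>+z. ennreal (exp (a * (dotp d \<theta> z)\<^sup>2)) \<partial>gauss_vec d v)
     = (\<integral>\<^sup>+z. (\<integral>\<^sup>+g. ennreal (exp ((sqrt (2 * a) * g) * dotp d \<theta> z)) \<partial>normal_measure 1) \<partial>gauss_vec d v)"
  proof (intro nn_integral_cong)
    fix z
    show "ennreal (exp (a * (dotp d \<theta> z)\<^sup>2)) = (\<integral>\<^sup>+g. ennreal (exp ((sqrt (2 * a) * g) * dotp d \<theta> z)) \<partial>normal_measure 1)"
    proof -
      have "(sqrt (2 * a) * dotp d \<theta> z)\<^sup>2 * 1 / 2 = a * (dotp d \<theta> z)\<^sup>2"
        using a by (simp add: power_mult_distrib)
      then have "ennreal (exp (a * (dotp d \<theta> z)\<^sup>2))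
          = (\<integral>\<^sup>+g. ennreal (exp ((sqrt (2 * a) * dotp d \<theta> z) * g)) \<partial>normal_measure 1)"
        using nn_integral_normal_exp[of 1 "sqrt (2 * a) * dotp d \<theta> z"] by simp
      also have "\<dots> = (\<integral>\<^sup>+g. ennreal (exp ((sqrt (2 * a) * g) * dotp d \<theta> z)) \<partial>normal_measure 1)"
        by (intro nn_integral_cong) (simp add: mult_ac)
      finally show ?thesis .
    qed
  qed
  also have "\<dots> = (\<integral>\<^sup>+g. (\<integral>\<^sup>+z. ennreal (exp ((sqrt (2 * a) * g) * dotp d \<theta> z)) \<partial>gauss_vec d v) \<partial>normal_measure 1)"
    by (rule Fubini'[symmetric]) measurable
  also have "\<dots> = (\<integral>\<^sup>+g. ennreal (exp (a * (v * dotp d \<theta> \<theta>) * g\<^sup>2)) \<partial>normal_measure 1)"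
  proof -
    have "(sqrt (2 * a) * g)\<^sup>2 * (v * dotp d \<theta> \<theta>) / 2 = a * (v * dotp d \<theta> \<theta>) * g\<^sup>2" for g
      using a by (simp add: power_mult_distrib)
    then show ?thesis unfolding nn_integral_gauss_vec_exp_dotp[OF v] by (simp only:)
  qed
  \<comment> \<open>After the exchange of integrals only the scalar
    \<open>a * v * |\<theta>|^2 <= 1/4\<close> remains, and 1/4 is the exponent whose integral is
    known.\<close>
  also have "\<dots> \<le> (\<integral>\<^sup>+g. ennreal (exp (g\<^sup>2 / (4 * 1))) \<partial>normal_measure 1)"
    using mult_right_mono[OF a(2)] by (intro nn_integral_mono) auto
  also have "\<dots> = ennreal (sqrt 2)" by (rule nn_integral_normal_exp_square) simp
  finally show ?thesis .
qed

lemma emeasure_Chernoff: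
  assumes f: "f \<in> borel_measurable M" and b: "(\<integral>\<^sup>+x. ennreal (exp (f x)) \<partial>M) \<le> ennreal C" and C: "0 \<le> C"
  shows "emeasure M {x \<in> space M. r \<le> f x} \<le> ennreal (exp (- r) * C)"
proof -
  have "{x \<in> space M. r \<le> f x} = {x \<in> space M. 1 \<le> ennreal (exp (- r)) * ennreal (exp (f x))}"
    by (auto simp flip: ennreal_mult exp_add simp: ennreal_1[symmetric] simp del: ennreal_1)
  also have "emeasure M \<dots> \<le> ennreal (exp (- r)) * (\<integral>\<^sup>+x. ennreal (exp (f x)) * indicator (space M) x \<partial>M)"
    using f by (intro nn_integral_Markov_inequality) auto
  also have "(\<integral>\<^sup>+x. ennreal (exp (f x)) * indicator (space M) x \<partial>M) = (\<integral>\<^sup>+x. ennreal (exp (f x)) \<partial>M)"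
    by (intro nn_integral_cong) simp
  also have "ennreal (exp (- r)) * \<dots> \<le> ennreal (exp (- r)) * ennreal C"
    using b by (intro mult_left_mono) auto
  finally show ?thesis using C by (simp add: ennreal_mult)
qed

text \<open>Chernoff with exponent \<open>d * |z|^2 / 4\<close>: every coordinate contributes
  \<open>sqrt 2 <= 2\<close>, and the squared norm exceeding 4 costs \<open>exp (- d)\<close>. What
  matters is that 2 is smaller than \<open>exp 1\<close>.\<close>

lemma gauss_vec_norm_tail:
  assumes d: "0 < d"
  shows "measure (gauss_vec d (1 / real d)) {z \<in> space (gauss_vec d (1 / real d)). 4 < dotp d z z} \<le> (2 / exp 1) ^ d"
proof -
  define G where "G = gauss_vec d (1 / real d)"
  interpret G: prob_space G unfolding G_def using d by (intro prob_space_gauss_vec) simp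
  define f where "f z = (real d / 4) * dotp d z z" for z
  have fm: "f \<in> borel_measurable G"
    unfolding f_def[abs_def] G_def by (intro borel_measurable_times borel_measurable_dotp) auto
  have "(\<integral>\<^sup>+z. ennreal (exp (f z)) \<partial>G) = (\<integral>\<^sup>+z. (\<Prod>i<d. ennreal (exp ((z i)\<^sup>2 / (4 * (1 / real d))))) \<partial>G)"
    by (simp add: f_def dotp_def sum_distrib_left exp_sum prod_ennreal power2_eq_square mult_ac)
  also have "\<dots> = (\<Prod>i<d. \<integral>\<^sup>+z. ennreal (exp (z\<^sup>2 / (4 * (1 / real d)))) \<partial>normal_measure (1 / real d))"
    unfolding G_def using d by (intro nn_integral_gauss_vec_prod) auto
  also have "\<dots> = (\<Prod>i<d. ennreal (sqrt 2))"
    using d by (subst nn_integral_normal_exp_square) auto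
  also have "\<dots> = ennreal (sqrt 2 ^ d)" by (simp add: ennreal_power)
  also have "\<dots> \<le> ennreal (2 ^ d)" by (intro ennreal_leI power_mono) (auto simp: real_sqrt_le_iff intro: real_le_lsqrt)
  finally have "emeasure G {z \<in> space G. real d \<le> f z} \<le> ennreal (exp (- real d) * 2 ^ d)"
    by (intro emeasure_Chernoff fm) auto
  then have "measure G {z \<in> space G. real d \<le> f z} \<le> exp (- real d) * 2 ^ d"
    by (simp add: G.emeasure_eq_measure)
  moreover have "measure G {z \<in> space G. 4 < dotp d z z} \<le> measure G {z \<in> space G. real d \<le> f z}"
  proof (rule G.finite_measure_mono)
    show "{z \<in> space G. 4 < dotp d z z} \<subseteq> {z \<in> space G. real d \<le> f z}"
      using d by (auto simp: f_def)
    show "{z \<in> space G. real d \<le> f z} \<in> sets G" using fm by measurable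
  qed
  moreover have "exp (- real d) * 2 ^ d = (2 / exp 1) ^ d"
    by (simp add: power_divide exp_minus exp_of_nat_mult[symmetric] field_simps)
  ultimately show ?thesis unfolding G_def by linarith
qed

text \<open>The exponential tail is weakened by \<open>exp (- x) <= 1 / x\<close>. For a union over
  \<open>k\<close> directions a bound linear in \<open>v * r\<close> is enough, and it turns into an
  explicit threshold for \<open>lam\<close>.\<close>

lemma gauss_vec_dotp_tail:
  assumes v: "0 < v" and r: "dotp d \<theta> \<theta> \<le> r" "0 < r"
  shows "measure (gauss_vec d v) {z \<in> space (gauss_vec d v). 1 < \<bar>dotp d \<theta> z\<bar>} \<le> 8 * v * r"
proof -
  define G where "G = gauss_vec d v"
  interpret G: prob_space G unfolding G_def using v by (intro prob_space_gauss_vec) simp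
  define f where "f z = (1 / (4 * v * r)) * (dotp d \<theta> z)\<^sup>2" for z
  have fm: "f \<in> borel_measurable G"
    unfolding f_def[abs_def] G_def
    by (intro borel_measurable_times borel_measurable_power borel_measurable_dotp) auto
  have "(\<integral>\<^sup>+z. ennreal (exp (f z)) \<partial>G) \<le> ennreal (sqrt 2)"
    unfolding f_def G_def using v r by (intro nn_integral_gauss_vec_exp_dotp_square) (auto simp: field_simps)
  also have "\<dots> \<le> ennreal 2" by (intro ennreal_leI) (auto intro: real_le_lsqrt)
  finally have "emeasure G {z \<in> space G. 1 / (4 * v * r) \<le> f z} \<le> ennreal (exp (- (1 / (4 * v * r))) * 2)"
    by (intro emeasure_Chernoff fm) auto
  then have 1: "measure G {z \<in> space G. 1 / (4 * v * r) \<le> f z} \<le> exp (- (1 / (4 * v * r))) * 2"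
    by (simp add: G.emeasure_eq_measure)
  have 2: "measure G {z \<in> space G. 1 < \<bar>dotp d \<theta> z\<bar>} \<le> measure G {z \<in> space G. 1 / (4 * v * r) \<le> f z}"
  proof (intro G.finite_measure_mono subsetI)
    fix z assume "z \<in> {z \<in> space G. 1 < \<bar>dotp d \<theta> z\<bar>}"
    then have "z \<in> space G" "1 \<le> (dotp d \<theta> z)\<^sup>2" using power_mono[of 1 "\<bar>dotp d \<theta> z\<bar>" 2] by auto
    then show "z \<in> {z \<in> space G. 1 / (4 * v * r) \<le> f z}"
      using v r mult_left_mono[of 1 "(dotp d \<theta> z)\<^sup>2" "1 / (4 * v * r)"] by (auto simp: f_def)
  qed (use fm in auto)
  have "exp (- (1 / (4 * v * r))) = inverse (exp (1 / (4 * v * r)))" by (rule exp_minus)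
  also have "\<dots> \<le> inverse (1 / (4 * v * r))"
  proof (rule le_imp_inverse_le)
    show "1 / (4 * v * r) \<le> exp (1 / (4 * v * r))"
      using exp_ge_add_one_self[of "1 / (4 * v * r)"] by linarith
    show "0 < 1 / (4 * v * r)" using v r by simp
  qed
  finally have "exp (- (1 / (4 * v * r))) * 2 \<le> 8 * v * r" by (simp add: mult_ac)
  with 1 2 show ?thesis unfolding G_def by linarith
qed

text \<open>Divided by \<open>sqrt d\<close>, these are the lattice points of mesh
  \<open>1 / sqrt d\<close> in the ball of radius 2; they play the role of a net of the unit sphere.
  \<open>PiE\<close> fixes the values outside \<open>{..<d}\<close>, so that the points can be
  counted.\<close>

definition grid :: "nat \<Rightarrow> (nat \<Rightarrow> int) set" where
  "grid d = {\<nu> \<in> PiE {..<d} (\<lambda>_. {- int (2 * d)..int (2 * d)}). (\<Sum>i<d. (\<nu> i)\<^sup>2) \<le> int (4 * d)}"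

lemma finite_grid: "finite (grid d)"
  by (rule finite_subset[of _ "PiE {..<d} (\<lambda>_. {- int (2 * d)..int (2 * d)})"])
    (auto simp: grid_def intro!: finite_PiE)

text \<open>\<open>exp (- j^2) <= 2^(-j)\<close> for positive \<open>j\<close>, and the right-hand
  side is the partial sum \<open>1 + 2 * (1/2 + ... + 1/2^K)\<close>. In this form the induction
  closes.\<close>

lemma sum_exp_neg_square_le: "(\<Sum>j\<in>{- int K..int K}. exp (- real_of_int (j\<^sup>2))) \<le> 3 - 2 * (1/2) ^ K"
proof (induction K)
  case (Suc K)
  have eq: "{- int (Suc K)..int (Suc K)} = insert (- int (Suc K)) (insert (int (Suc K)) {- int K..int K})" by auto
  have "(\<Sum>j\<in>{- int (Suc K)..int (Suc K)}. exp (- real_of_int (j\<^sup>2)))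
     = 2 * exp (- real_of_int ((int (Suc K))\<^sup>2)) + (\<Sum>j\<in>{- int K..int K}. exp (- real_of_int (j\<^sup>2)))"
    unfolding eq by (simp add: power2_eq_square algebra_simps)
  also have "exp (- real_of_int ((int (Suc K))\<^sup>2)) \<le> (1/2) ^ Suc K"
  proof -
    have "exp (- real_of_int ((int (Suc K))\<^sup>2)) \<le> exp (- real (Suc K))"
    proof -
      have "real (Suc K) * 1 \<le> real (Suc K) * real (Suc K)"
        by (intro mult_left_mono) auto
      moreover have "real_of_int ((int (Suc K))\<^sup>2) = real (Suc K) * real (Suc K)"
        by (simp add: power2_eq_square)
      ultimately show ?thesis by (simp only: exp_le_cancel_iff neg_le_iff_le mult_1_right)
    qed
    also have "\<dots> = exp (- 1) ^ Suc K" by (simp only: exp_of_nat_mult[symmetric]) simp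
    also have "\<dots> \<le> (1/2) ^ Suc K"
    proof (rule power_mono)
      have "2 \<le> exp (1::real)" using exp_ge_add_one_self[of 1] by simp
      then show "exp (- 1) \<le> (1/2 :: real)" by (simp add: exp_minus field_simps)
    qed simp
    finally show ?thesis .
  qed
  finally show ?case using Suc by simp
qed simp

text \<open>Chernoff's bound for counting lattice points in a ball.\<close>
lemma card_grid_le: "real (card (grid d)) \<le> exp (6 * real d)"
proof -
  let ?P = "PiE {..<d} (\<lambda>_. {- int (2 * d)..int (2 * d)})"
  have fin: "finite ?P" by (intro finite_PiE) auto
  have "real (card (grid d)) = (\<Sum>\<nu>\<in>grid d. 1)" by simp
  \<comment> \<open>On the grid \<open>4 * d - |\<nu>|^2\<close> is nonnegative, so each summand is
    at least 1. Over the whole box the sum then factorises; each coordinate gives at most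
    \<open>3 <= exp 2\<close>, which raises the exponent from 4 to 6.\<close>
  also have "\<dots> \<le> (\<Sum>\<nu>\<in>grid d. exp (4 * real d) * (\<Prod>i<d. exp (- real_of_int ((\<nu> i)\<^sup>2))))"
  proof (rule sum_mono)
    fix \<nu> assume "\<nu> \<in> grid d"
    then have "(\<Sum>i<d. (\<nu> i)\<^sup>2) \<le> int (4 * d)" by (simp add: grid_def)
    then have "real_of_int (\<Sum>i<d. (\<nu> i)\<^sup>2) \<le> 4 * real d" by linarith
    then have "0 \<le> 4 * real d + (\<Sum>i<d. - real_of_int ((\<nu> i)\<^sup>2))" by (simp add: sum_negf)
    then show "1 \<le> exp (4 * real d) * (\<Prod>i<d. exp (- real_of_int ((\<nu> i)\<^sup>2)))"
      by (simp flip: exp_sum exp_add)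
  qed
  also have "\<dots> \<le> (\<Sum>\<nu>\<in>?P. exp (4 * real d) * (\<Prod>i<d. exp (- real_of_int ((\<nu> i)\<^sup>2))))"
  proof (rule sum_mono2[OF fin])
    show "grid d \<subseteq> ?P" by (auto simp: grid_def)
  qed (intro mult_nonneg_nonneg prod_nonneg, auto)
  also have "\<dots> = exp (4 * real d) * (\<Prod>i<d. \<Sum>j\<in>{- int (2 * d)..int (2 * d)}. exp (- real_of_int (j\<^sup>2)))"
    by (subst prod_sum_PiE) (auto simp: sum_distrib_left)
  also have "\<dots> \<le> exp (4 * real d) * (\<Prod>i<d. exp 2)"
  proof (intro mult_left_mono prod_mono conjI)
    have "(\<Sum>j\<in>{- int (2 * d)..int (2 * d)}. exp (- real_of_int (j\<^sup>2))) \<le> 3"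
      using sum_exp_neg_square_le[of "2 * d"] by (smt (verit) zero_le_power divide_nonneg_nonneg)
    also have "3 \<le> exp (2::real)" using exp_ge_add_one_self[of 2] by simp
    finally show "(\<Sum>j\<in>{- int (2 * d)..int (2 * d)}. exp (- real_of_int (j\<^sup>2))) \<le> exp 2" .
  qed (auto intro: sum_nonneg)
  also have "\<dots> = exp (6 * real d)"
    by (simp flip: exp_of_nat_mult exp_add)
  finally show ?thesis .
qed

lemma convex_combination_square_le:
  fixes s :: real
  assumes "0 \<le> s" "s \<le> 1"
  shows "((1 - s) * a + s * b)\<^sup>2 \<le> (1 - s) * a\<^sup>2 + s * b\<^sup>2"
proof -
  have "(1 - s) * a\<^sup>2 + s * b\<^sup>2 - ((1 - s) * a + s * b)\<^sup>2 = s * (1 - s) * (a - b)\<^sup>2"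
    by (simp add: power2_eq_square algebra_simps)
  moreover have "0 \<le> s * (1 - s) * (a - b)\<^sup>2" using assms by simp
  ultimately show ?thesis by linarith
qed

text \<open>A convex function on a box is maximal at a vertex; here the box is the cell of the
  lattice that contains \<^term>\<open>z\<close>.\<close>
lemma quadratic_le_at_vertex:
  fixes z :: "nat \<Rightarrow> real" and Z :: "'m \<Rightarrow> nat \<Rightarrow> real"
  shows "\<exists>\<nu> :: nat \<Rightarrow> int. (\<forall>i<d. \<nu> i = \<lfloor>s * z i\<rfloor> \<or> \<nu> i = \<lfloor>s * z i\<rfloor> + 1) \<and>
     (\<Sum>m\<in>I. (dotp d (\<lambda>i. s * z i) (Z m))\<^sup>2) \<le> (\<Sum>m\<in>I. (dotp d (\<lambda>i. of_int (\<nu> i)) (Z m))\<^sup>2)"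
proof -
  define Q where "Q w = (\<Sum>m\<in>I. (dotp d w (Z m))\<^sup>2)" for w
  \<comment> \<open>Coordinates are rounded one at a time; \<open>mix j\<close> has the first
    \<open>j\<close> already rounded.\<close>
  define mix where "mix j \<nu> = (\<lambda>i. if i < j then of_int (\<nu> i) else s * z i)" for j and \<nu> :: "nat \<Rightarrow> int"
  have "j \<le> d \<Longrightarrow> \<exists>\<nu> :: nat \<Rightarrow> int. (\<forall>i<d. \<nu> i = \<lfloor>s * z i\<rfloor> \<or> \<nu> i = \<lfloor>s * z i\<rfloor> + 1) \<and> Q (\<lambda>i. s * z i) \<le> Q (mix j \<nu>)" for j
  proof (induction j)
    case 0
    show ?case by (intro exI[of _ "\<lambda>i. \<lfloor>s * z i\<rfloor>"]) (simp add: mix_def)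
  next
    case (Suc j)
    then obtain \<nu> :: "nat \<Rightarrow> int" where \<nu>: "\<forall>i<d. \<nu> i = \<lfloor>s * z i\<rfloor> \<or> \<nu> i = \<lfloor>s * z i\<rfloor> + 1"
      "Q (\<lambda>i. s * z i) \<le> Q (mix j \<nu>)" by auto
    define f where "f = \<lfloor>s * z j\<rfloor>"
    define p where "p = s * z j - of_int f"
    have p: "0 \<le> p" "p \<le> 1" unfolding p_def f_def by linarith+
    let ?a = "mix (Suc j) (\<nu>(j := f))" and ?b = "mix (Suc j) (\<nu>(j := f + 1))"
    \<comment> \<open>Coordinate \<open>j\<close> is a convex combination of its two roundings, so
      by convexity one of them does not decrease \<open>Q\<close>.\<close>
    have "mix j \<nu> i = (1 - p) * ?a i + p * ?b i" for i
      by (cases i j rule: linorder_cases) (auto simp: mix_def p_def algebra_simps)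
    then have m: "mix j \<nu> = (\<lambda>i. (1 - p) * ?a i + p * ?b i)" by blast
    have "Q (mix j \<nu>) \<le> (\<Sum>m\<in>I. (1 - p) * (dotp d ?a (Z m))\<^sup>2 + p * (dotp d ?b (Z m))\<^sup>2)"
      unfolding Q_def m dotp_add_left dotp_scale_left
      by (intro sum_mono convex_combination_square_le p)
    also have "\<dots> = (1 - p) * Q ?a + p * Q ?b"
      by (simp add: Q_def sum.distrib sum_distrib_left)
    also have "\<dots> \<le> max (Q ?a) (Q ?b)"
      using p by (intro convex_bound_le) auto
    finally have "Q (\<lambda>i. s * z i) \<le> Q ?a \<or> Q (\<lambda>i. s * z i) \<le> Q ?b" using \<nu> by auto
    then show ?case
    proof
      assume "Q (\<lambda>i. s * z i) \<le> Q ?a"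
      moreover have "\<forall>i<d. (\<nu>(j := f)) i = \<lfloor>s * z i\<rfloor> \<or> (\<nu>(j := f)) i = \<lfloor>s * z i\<rfloor> + 1"
        using \<nu>(1) by (simp add: f_def)
      ultimately show ?thesis by (intro exI[of _ "\<nu>(j := f)"] conjI)
    next
      assume "Q (\<lambda>i. s * z i) \<le> Q ?b"
      moreover have "\<forall>i<d. (\<nu>(j := f + 1)) i = \<lfloor>s * z i\<rfloor> \<or> (\<nu>(j := f + 1)) i = \<lfloor>s * z i\<rfloor> + 1"
        using \<nu>(1) by (simp add: f_def)
      ultimately show ?thesis by (intro exI[of _ "\<nu>(j := f + 1)"] conjI)
    qed
  qed
  from this[of d] obtain \<nu> :: "nat \<Rightarrow> int" where \<nu>: "\<forall>i<d. \<nu> i = \<lfloor>s * z i\<rfloor> \<or> \<nu> i = \<lfloor>s * z i\<rfloor> + 1"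
    "Q (\<lambda>i. s * z i) \<le> Q (mix d \<nu>)" by auto
  have "Q (mix d \<nu>) = Q (\<lambda>i. of_int (\<nu> i))"
    unfolding Q_def by (intro sum.cong refl arg_cong[where f="\<lambda>a. a\<^sup>2"] dotp_cong) (auto simp: mix_def)
  then show ?thesis using \<nu> by (auto simp: Q_def)
qed

text \<open>Because the form is compared with its value at the vertices of a cell, the bound on the
  grid passes to the sphere without the loss of constant of the usual net argument. Homogeneity then
  gives all \<open>z\<close>.\<close>

lemma quadratic_form_bound_from_grid:
  assumes d: "0 < d"
    and g: "\<And>\<nu>. \<nu> \<in> grid d \<Longrightarrow> (\<Sum>m\<in>I. (dotp d (\<lambda>i. of_int (\<nu> i) / sqrt (real d)) (Z m))\<^sup>2) \<le> B"
  shows "(\<Sum>m\<in>I. (dotp d z (Z m))\<^sup>2) \<le> B * dotp d z z"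
proof -
  have unit: "(\<Sum>m\<in>I. (dotp d y (Z m))\<^sup>2) \<le> B" if y: "dotp d y y = 1" for y
  proof -
    obtain \<nu>' where \<nu>': "\<forall>i<d. \<nu>' i = \<lfloor>sqrt (real d) * y i\<rfloor> \<or> \<nu>' i = \<lfloor>sqrt (real d) * y i\<rfloor> + 1"
      "(\<Sum>m\<in>I. (dotp d (\<lambda>i. sqrt (real d) * y i) (Z m))\<^sup>2) \<le> (\<Sum>m\<in>I. (dotp d (\<lambda>i. of_int (\<nu>' i)) (Z m))\<^sup>2)"
      using quadratic_le_at_vertex[where d=d and s="sqrt (real d)" and z=y and I=I and Z=Z] by auto
    define \<nu> where "\<nu> = restrict \<nu>' {..<d}"
    \<comment> \<open>Rounding moves a coordinate by at most 1. Summed over \<open>d\<close>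
      coordinates of a vector of squared norm \<open>d\<close> this gives
      \<open>2 * d + 2 * d\<close>, the \<open>4 * d\<close> in \<open>grid\<close>.\<close>
    have sq: "(real_of_int (\<nu> i))\<^sup>2 \<le> 2 * (real d * (y i)\<^sup>2) + 2" if "i < d" for i
    proof -
      define e where "e = real_of_int (\<nu> i) - sqrt (real d) * y i"
      have "\<nu> i = \<lfloor>sqrt (real d) * y i\<rfloor> \<or> \<nu> i = \<lfloor>sqrt (real d) * y i\<rfloor> + 1"
        using \<nu>'(1) that by (auto simp: \<nu>_def)
      then have "\<bar>e\<bar> \<le> 1" unfolding e_def by (elim disjE) linarith+
      then have "e\<^sup>2 \<le> 1" by (simp add: abs_square_le_1)
      moreover have "(sqrt (real d) * y i + e)\<^sup>2 \<le> 2 * (sqrt (real d) * y i)\<^sup>2 + 2 * e\<^sup>2"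
        by (rule power2_sum_le)
      ultimately show ?thesis by (simp add: e_def power_mult_distrib)
    qed
    have "(\<Sum>i<d. (real_of_int (\<nu> i))\<^sup>2) \<le> (\<Sum>i<d. 2 * (real d * (y i)\<^sup>2) + 2)"
      by (intro sum_mono sq) auto
    also have "\<dots> = 2 * real d * dotp d y y + 2 * real d"
      by (simp add: sum.distrib dotp_def sum_distrib_left power2_eq_square mult_ac)
    finally have "real_of_int (\<Sum>i<d. (\<nu> i)\<^sup>2) \<le> real_of_int (int (4 * d))" using y by simp
    then have total: "(\<Sum>i<d. (\<nu> i)\<^sup>2) \<le> int (4 * d)" by (simp only: of_int_le_iff)
    have "\<nu> i \<in> {- int (2 * d)..int (2 * d)}" if "i < d" for i
    proof -
      have "(\<nu> i)\<^sup>2 \<le> (\<Sum>i<d. (\<nu> i)\<^sup>2)" using that by (intro member_le_sum) auto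
      also note total
      also have "int (4 * d) \<le> (int (2 * d))\<^sup>2"
        using d by (simp add: power2_eq_square)
      finally have "\<bar>\<nu> i\<bar> \<le> \<bar>int (2 * d)\<bar>" by (simp only: abs_le_square_iff)
      then show ?thesis by auto
    qed
    then have "\<nu> \<in> grid d" using total by (auto simp: grid_def \<nu>_def)
    from g[OF this] have "(\<Sum>m\<in>I. (dotp d (\<lambda>i. of_int (\<nu> i) / sqrt (real d)) (Z m))\<^sup>2) \<le> B" .
    moreover have "dotp d (\<lambda>i. of_int (\<nu> i) / sqrt (real d)) (Z m) = dotp d (\<lambda>i. of_int (\<nu>' i)) (Z m) / sqrt (real d)" for m
      by (simp add: dotp_def sum_divide_distrib \<nu>_def)
    ultimately have "(\<Sum>m\<in>I. (dotp d (\<lambda>i. of_int (\<nu>' i)) (Z m))\<^sup>2) / real d \<le> B"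
      by (simp add: power_divide sum_divide_distrib)
    moreover have "(\<Sum>m\<in>I. (dotp d y (Z m))\<^sup>2) = (\<Sum>m\<in>I. (dotp d (\<lambda>i. sqrt (real d) * y i) (Z m))\<^sup>2) / real d"
      using d by (simp add: dotp_scale_left power_mult_distrib flip: sum_distrib_left)
    ultimately show ?thesis using \<nu>'(2) d by (smt (verit) divide_right_mono of_nat_0_le_iff)
  qed
  show ?thesis
  proof (cases "dotp d z z = 0")
    case True
    then have "vnorm d z = 0" by (simp add: vnorm_def)
    then have "dotp d z (Z m) = 0" for m using abs_dotp_le[of d z "Z m"] by simp
    then show ?thesis using True by simp
  next
    case False
    define r where "r = vnorm d z"
    have r: "r\<^sup>2 = dotp d z z" "r \<noteq> 0" using False by (auto simp: r_def vnorm_def dotp_self_nonneg)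
    have "dotp d (\<lambda>i. (1 / r) * z i) (\<lambda>i. (1 / r) * z i) = 1"
      using r by (simp only: dotp_scale_left dotp_scale_right) (simp add: power2_eq_square field_simps flip: r(1))
    from unit[OF this] have "(\<Sum>m\<in>I. (dotp d z (Z m))\<^sup>2) / r\<^sup>2 \<le> B"
      by (simp only: dotp_scale_left) (simp add: power_divide sum_divide_distrib)
    then have "(\<Sum>m\<in>I. (dotp d z (Z m))\<^sup>2) \<le> B * r\<^sup>2"
      using r(2) by (subst (asm) pos_divide_le_eq) auto
    then show ?thesis by (simp only: r(1))
  qed
qed

section \<open>Adaptive counting and noise bounds for samples\<close>

text \<open>Replaces conditional expectations: \<open>dep\<close> says that factor \<open>m\<close>
  sees only the first \<open>m\<close> samples, and integrating out the last sample first removes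
  one factor at a time, whatever the past \<open>h\<close>.\<close>

lemma nn_integral_prod_adaptive:
  fixes F :: "nat \<Rightarrow> (nat \<Rightarrow> 'a) \<Rightarrow> ennreal"
  assumes S: "prob_space S"
    and meas: "\<And>m n. m \<in> {1..n} \<Longrightarrow> n \<le> N \<Longrightarrow> F m \<in> borel_measurable (PiM {1..n} (\<lambda>_. S))"
    and dep: "\<And>m h h'. m \<in> {1..N} \<Longrightarrow> (\<And>j. j \<in> {1..m} \<Longrightarrow> h j = h' j) \<Longrightarrow> F m h = F m h'"
    and bound: "\<And>m h. m \<in> {1..N} \<Longrightarrow> (\<integral>\<^sup>+y. F m (h(m := y)) \<partial>S) \<le> q m"
  shows "n \<le> N \<Longrightarrow> (\<integral>\<^sup>+h. (\<Prod>m\<in>{1..n}. F m h) \<partial>PiM {1..n} (\<lambda>_. S)) \<le> (\<Prod>m\<in>{1..n}. q m)"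
proof (induction n)
  case 0
  interpret prob_space "PiM {1..0::nat} (\<lambda>_. S)" by (intro prob_space_PiM S)
  show ?case using emeasure_space_1 by simp
next
  case (Suc n)
  interpret product_sigma_finite "\<lambda>_. S"
    unfolding product_sigma_finite_def using prob_space_imp_sigma_finite[OF S] by auto
  have ins: "{1..Suc n} = insert (Suc n) {1..n}" by auto
  have m': "(\<lambda>h. \<Prod>m\<in>{1..Suc n}. F m h) \<in> borel_measurable (PiM (insert (Suc n) {1..n}) (\<lambda>_. S))"
    unfolding ins[symmetric] using Suc.prems by (intro borel_measurable_prod_ennreal meas) auto
  have "(\<integral>\<^sup>+h. (\<Prod>m\<in>{1..Suc n}. F m h) \<partial>PiM {1..Suc n} (\<lambda>_. S))
      = (\<integral>\<^sup>+h. (\<integral>\<^sup>+y. (\<Prod>m\<in>{1..Suc n}. F m (h(Suc n := y))) \<partial>S) \<partial>PiM {1..n} (\<lambda>_. S))"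
    unfolding ins by (rule product_nn_integral_insert[OF _ _ m'[unfolded ins]]) auto
  also have "\<dots> \<le> (\<integral>\<^sup>+h. q (Suc n) * (\<Prod>m\<in>{1..n}. F m h) \<partial>PiM {1..n} (\<lambda>_. S))"
  proof (rule nn_integral_mono)
    fix h assume h: "h \<in> space (PiM {1..n} (\<lambda>_. S))"
    \<comment> \<open>Earlier factors do not see the new sample and leave the inner
      integral.\<close>
    have past: "F m (h(Suc n := y)) = F m h" if "m \<in> {1..n}" for m y
      using that Suc.prems by (intro dep) auto
    have [measurable]: "(\<lambda>y. F (Suc n) (h(Suc n := y))) \<in> borel_measurable S"
      using measurable_compose[OF measurable_component_update[OF h] meas[of "Suc n" "Suc n", unfolded ins]] Suc.prems
      by (simp add: ins[symmetric])
    have "(\<integral>\<^sup>+y. (\<Prod>m\<in>{1..Suc n}. F m (h(Suc n := y))) \<partial>S)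
        = (\<integral>\<^sup>+y. F (Suc n) (h(Suc n := y)) * (\<Prod>m\<in>{1..n}. F m h) \<partial>S)"
    proof (rule nn_integral_cong)
      fix y
      have "(\<Prod>m\<in>{1..n}. F m (h(Suc n := y))) = (\<Prod>m\<in>{1..n}. F m h)"
        using past by (intro prod.cong) auto
      then show "(\<Prod>m\<in>{1..Suc n}. F m (h(Suc n := y))) = F (Suc n) (h(Suc n := y)) * (\<Prod>m\<in>{1..n}. F m h)"
        unfolding ins by (subst prod.insert) auto
    qed
    also have "\<dots> = (\<integral>\<^sup>+y. F (Suc n) (h(Suc n := y)) \<partial>S) * (\<Prod>m\<in>{1..n}. F m h)"
      by (rule nn_integral_multc) measurable
    also have "\<dots> \<le> q (Suc n) * (\<Prod>m\<in>{1..n}. F m h)"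
      using Suc.prems by (intro mult_right_mono bound) auto
    finally show "(\<integral>\<^sup>+y. (\<Prod>m\<in>{1..Suc n}. F m (h(Suc n := y))) \<partial>S) \<le> \<dots>" .
  qed
  also have "\<dots> = q (Suc n) * (\<integral>\<^sup>+h. (\<Prod>m\<in>{1..n}. F m h) \<partial>PiM {1..n} (\<lambda>_. S))"
    using Suc.prems by (intro nn_integral_cmult borel_measurable_prod_ennreal meas) auto
  also have "\<dots> \<le> q (Suc n) * (\<Prod>m\<in>{1..n}. q m)"
    using Suc by (intro mult_left_mono) auto
  also have "\<dots> = (\<Prod>m\<in>{1..Suc n}. q m)" unfolding ins by (subst prod.insert) auto
  finally show ?case .
qed

text \<open>Chernoff's lower tail with exponent 1. Given any past, a step has exponential moment at
  most \<open>1 - (1 - exp (-1)) * p <= exp (- (p / 2))\<close>; staying below the level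
  \<open>p / 4\<close> per step then has probability at most \<open>exp (- (p / 4))\<close> per
  step.\<close>

lemma adaptive_count_tail:
  fixes good :: "nat \<Rightarrow> (nat \<Rightarrow> 'a) \<Rightarrow> bool"
  assumes S: "prob_space S"
    and meas: "\<And>m n. m \<in> {1..n} \<Longrightarrow> n \<le> N \<Longrightarrow> {h \<in> space (PiM {1..n} (\<lambda>_. S)). good m h} \<in> sets (PiM {1..n} (\<lambda>_. S))"
    and dep: "\<And>m h h'. m \<in> {1..N} \<Longrightarrow> (\<And>j. j \<in> {1..m} \<Longrightarrow> h j = h' j) \<Longrightarrow> good m h = good m h'"
    and cmeas: "\<And>m h. m \<in> W \<Longrightarrow> {y \<in> space S. good m (h(m := y))} \<in> sets S"
    and cond: "\<And>m h. m \<in> W \<Longrightarrow> p \<le> measure S {y \<in> space S. good m (h(m := y))}"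
    and W: "W \<subseteq> {1..N}"
  shows "measure (PiM {1..N} (\<lambda>_. S)) {h \<in> space (PiM {1..N} (\<lambda>_. S)). real (card {m \<in> W. good m h}) < p / 4 * real (card W)}
    \<le> exp (- (p / 4 * real (card W)))"
proof -
  define Q where "Q = PiM {1..N} (\<lambda>_. S)"
  interpret S: prob_space S by fact
  interpret Q: prob_space Q unfolding Q_def by (intro prob_space_PiM S)
  have finW: "finite W" using W finite_subset by blast
  \<comment> \<open>The factor is 1 outside \<open>W\<close>, so that the product may run over all
    of \<open>{1..N}\<close>.\<close>
  define F where "F m h = ennreal (if m \<in> W \<and> good m h then exp (-1) else 1)" for m h
  have Fm: "F m \<in> borel_measurable (PiM {1..n} (\<lambda>_. S))" if "m \<in> {1..n}" "n \<le> N" for m n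
    using meas[OF that] unfolding F_def[abs_def]
    by (cases "m \<in> W") (auto intro!: measurable_If measurable_compose[OF _ measurable_ennreal])
  have e1: "exp (-1) \<le> (1/2 :: real)"
    using exp_ge_add_one_self[of "1::real"] by (simp add: exp_minus field_simps)
  have Fb: "(\<integral>\<^sup>+y. F m (h(m := y)) \<partial>S) \<le> ennreal (if m \<in> W then exp (- (p / 2)) else 1)"
    if m: "m \<in> {1..N}" for m h
  proof (cases "m \<in> W")
    case True
    define G where "G = {y \<in> space S. good m (h(m := y))}"
    have G: "G \<in> sets S" unfolding G_def by (rule cmeas[OF True])
    have "integrable S (indicator G :: _ \<Rightarrow> real)"
      using G by (intro integrable_real_indicator) (simp_all add: S.emeasure_eq_measure)
    then have int: "integrable S (\<lambda>y. 1 - (1 - exp (-1)) * indicator G y :: real)"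
      by (intro Bochner_Integration.integrable_diff integrable_mult_right) auto
    have "(\<integral>\<^sup>+y. F m (h(m := y)) \<partial>S) = (\<integral>\<^sup>+y. ennreal (1 - (1 - exp (-1)) * indicator G y) \<partial>S)"
      using True by (intro nn_integral_cong) (auto simp: F_def G_def indicator_def)
    also have "\<dots> = ennreal (\<integral>y. 1 - (1 - exp (-1)) * indicator G y \<partial>S)"
      using int by (intro nn_integral_eq_integral) (auto simp: indicator_def)
    also have "(\<integral>y. 1 - (1 - exp (-1)) * indicator G y \<partial>S) = 1 - (1 - exp (-1)) * measure S G"
      using G \<open>integrable S (indicator G)\<close>
      by (subst Bochner_Integration.integral_diff) (auto simp: S.prob_space)
    finally have eq: "(\<integral>\<^sup>+y. F m (h(m := y)) \<partial>S) = ennreal (1 - (1 - exp (-1)) * measure S G)" .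
    have "1 - (1 - exp (-1)) * measure S G \<le> 1 - (1/2) * p"
    proof -
      have "(1/2) * p \<le> (1 - exp (-1)) * measure S G"
      proof (cases "0 \<le> p")
        case True
        then show ?thesis using e1 cond[OF \<open>m \<in> W\<close>, of h] unfolding G_def by (intro mult_mono) auto
      next
        case False
        have "0 \<le> (1 - exp (-1)) * measure S G" using e1 by (intro mult_nonneg_nonneg) auto
        then show ?thesis using False by linarith
      qed
      then show ?thesis by simp
    qed
    also have "\<dots> \<le> exp (- (p / 2))" using exp_ge_add_one_self[of "- (p / 2)"] by simp
    finally show ?thesis unfolding eq using True by (simp only: if_True) (rule ennreal_leI)
  qed (simp add: F_def S.emeasure_space_1)
  define f where "f h = - real (card {m \<in> W. good m h})" for h
  have fsum: "f h = (\<Sum>m\<in>W. if good m h then -1 else 0)" for h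
    unfolding f_def using finW by (simp add: sum.If_cases Int_def sum_negf)
  have fm: "f \<in> borel_measurable Q"
    unfolding fsum[abs_def] Q_def using meas[of _ N] W
    by (intro borel_measurable_sum measurable_If) auto
  have "(\<integral>\<^sup>+h. ennreal (exp (f h)) \<partial>Q) = (\<integral>\<^sup>+h. (\<Prod>m\<in>{1..N}. F m h) \<partial>Q)"
  proof (intro nn_integral_cong)
    fix h
    have "exp (f h) = (\<Prod>m\<in>W. if good m h then exp (-1) else 1)"
      unfolding fsum exp_sum[OF finW] by (intro prod.cong) auto
    also have "\<dots> = (\<Prod>m\<in>{1..N}. if m \<in> W \<and> good m h then exp (-1) else 1)"
      using W by (intro prod.mono_neutral_cong_left) auto
    finally show "ennreal (exp (f h)) = (\<Prod>m\<in>{1..N}. F m h)"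
      unfolding F_def by (subst prod_ennreal) auto
  qed
  also have "\<dots> \<le> (\<Prod>m\<in>{1..N}. ennreal (if m \<in> W then exp (- (p / 2)) else 1))"
    unfolding Q_def
  proof (rule nn_integral_prod_adaptive[OF S, where N=N])
    show "F m h = F m h'" if "m \<in> {1..N}" "\<And>j. j \<in> {1..m} \<Longrightarrow> h j = h' j" for m h h'
      using dep[OF that] by (simp add: F_def)
  qed (use Fm Fb in auto)
  also have "\<dots> = ennreal (\<Prod>m\<in>W. exp (- (p / 2)))"
  proof -
    have "(\<Prod>m\<in>{1..N}. if m \<in> W then exp (- (p / 2)) else 1) = (\<Prod>m\<in>W. exp (- (p / 2)))"
      using W by (intro prod.mono_neutral_cong_right) auto
    then show ?thesis by (subst prod_ennreal) simp_all
  qed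
  also have "(\<Prod>m\<in>W. exp (- (p / 2))) = exp (- (p / 2 * real (card W)))"
    by (simp add: mult.commute flip: exp_of_nat_mult)
  finally have "emeasure Q {h \<in> space Q. - (p / 4 * real (card W)) \<le> f h}
     \<le> ennreal (exp (- (- (p / 4 * real (card W)))) * exp (- (p / 2 * real (card W))))"
    by (intro emeasure_Chernoff fm) auto
  also have "exp (- (- (p / 4 * real (card W)))) * exp (- (p / 2 * real (card W))) = exp (- (p / 4 * real (card W)))"
    by (simp flip: exp_add)
  finally have "measure Q {h \<in> space Q. - (p / 4 * real (card W)) \<le> f h} \<le> exp (- (p / 4 * real (card W)))"
    by (simp add: Q.emeasure_eq_measure)
  moreover have "measure Q {h \<in> space Q. real (card {m \<in> W. good m h}) < p / 4 * real (card W)}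
     \<le> measure Q {h \<in> space Q. - (p / 4 * real (card W)) \<le> f h}"
  proof (rule Q.finite_measure_mono)
    show "{h \<in> space Q. real (card {m \<in> W. good m h}) < p / 4 * real (card W)}
        \<subseteq> {h \<in> space Q. - (p / 4 * real (card W)) \<le> f h}"
      by (auto simp: f_def)
    show "{h \<in> space Q. - (p / 4 * real (card W)) \<le> f h} \<in> sets Q" using fm by measurable
  qed
  ultimately show ?thesis unfolding Q_def by linarith
qed

section \<open>Label and noise of a sample\<close>

lemma prob_space_sample_measure: "0 < lam \<Longrightarrow> prob_space (sample_measure P d lam)"
  unfolding sample_measure_def by (intro prob_space_pair prob_space_gauss_vec prob_space_measure_pmf) simp

lemma measurable_sample_label: "fst \<in> sample_measure P d lam \<rightarrow>\<^sub>M count_space UNIV"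
proof -
  have "fst \<in> sample_measure P d lam \<rightarrow>\<^sub>M measure_pmf P" unfolding sample_measure_def by (rule measurable_fst)
  then show ?thesis using measurable_cong_sets[OF refl sets_measure_pmf_count_space, of "sample_measure P d lam" P] by simp
qed

lemma borel_measurable_sample_noise:
  "i < d \<Longrightarrow> (\<lambda>s. snd s i) \<in> borel_measurable (sample_measure P d lam)"
  unfolding sample_measure_def
  by (rule measurable_compose[OF measurable_snd borel_measurable_gauss_vec_component])

lemma sets_label_noise_event:
  assumes A: "\<And>s. s \<in> space (sample_measure P d lam) \<Longrightarrow> Q s \<longleftrightarrow> fst s = c \<and> (\<forall>b<(k::nat). \<bar>dotp d (\<theta> b) (snd s)\<bar> \<le> 1)"
  shows "{s \<in> space (sample_measure P d lam). Q s} \<in> sets (sample_measure P d lam)"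
proof -
  let ?S = "sample_measure P d lam"
  have m: "(\<lambda>s. dotp d (\<theta> b) (snd s)) \<in> borel_measurable ?S" for b
    by (intro borel_measurable_dotp borel_measurable_sample_noise) auto
  have "{s \<in> space ?S. fst s = c} = fst -` {c} \<inter> space ?S" by auto
  also have "\<dots> \<in> sets ?S" by (rule measurable_sets[OF measurable_sample_label]) simp
  finally have 1: "{s \<in> space ?S. fst s = c} \<in> sets ?S" .
  have 2: "{s \<in> space ?S. \<bar>dotp d (\<theta> b) (snd s)\<bar> \<le> 1} \<in> sets ?S" for b
    using m[of b] by measurable
  have "{s \<in> space ?S. Q s} = {s \<in> space ?S. fst s = c \<and> (\<forall>b\<in>{..<k}. \<bar>dotp d (\<theta> b) (snd s)\<bar> \<le> 1)}"
    using A by auto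
  also have "\<dots> \<in> sets ?S"
    by (intro sets.sets_Collect_conj sets.sets_Collect_finite_All 1 2) auto
  finally show ?thesis .
qed

text \<open>Label and noise are independent, and the union over \<open>k\<close> directions costs at
  most \<open>8 * k * r / lam\<close>. The factor 16 in the hypothesis makes this at most one
  half.\<close>

lemma measure_label_small_noise_ge:
  assumes lam: "0 < lam" and r: "\<And>b. b < k \<Longrightarrow> dotp d (\<theta> b) (\<theta> b) \<le> r" "0 < r" "16 * real k * r \<le> lam"
  shows "pmf P c / 2 \<le> measure (sample_measure P d lam)
     {s \<in> space (sample_measure P d lam). fst s = c \<and> (\<forall>b<k. \<bar>dotp d (\<theta> b) (snd s)\<bar> \<le> 1)}"
proof -
  define G where "G = gauss_vec d (1 / lam)"
  interpret G: prob_space G unfolding G_def using lam by (intro prob_space_gauss_vec) simp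
  define E where "E = {z \<in> space G. \<forall>b\<in>{..<k}. \<bar>dotp d (\<theta> b) z\<bar> \<le> 1}"
  have [measurable]: "dotp d (\<theta> b) \<in> borel_measurable G" for b
    unfolding G_def using borel_measurable_dotp[of d "\<lambda>_. \<theta> b" G "\<lambda>z. z"] by (simp add: G_def)
  have E: "E \<in> sets G" unfolding E_def by measurable
  have bad: "{z \<in> space G. 1 < \<bar>dotp d (\<theta> b) z\<bar>} \<in> sets G" for b by measurable
  have "1 - measure G E = measure G (space G - E)" using E by (simp add: G.prob_compl)
  also have "space G - E = (\<Union>b\<in>{..<k}. {z \<in> space G. 1 < \<bar>dotp d (\<theta> b) z\<bar>})"
    by (auto simp: E_def simp flip: not_le)
  also have "measure G \<dots> \<le> (\<Sum>b<k. measure G {z \<in> space G. 1 < \<bar>dotp d (\<theta> b) z\<bar>})"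
    using bad by (intro G.finite_measure_subadditive_finite) auto
  also have "\<dots> \<le> (\<Sum>b<k. 8 * (1 / lam) * r)"
    unfolding G_def using lam r by (intro sum_mono gauss_vec_dotp_tail) auto
  also have "\<dots> \<le> 1 / 2" using lam r by (simp add: field_simps)
  finally have half: "1 / 2 \<le> measure G E" by simp
  have "{s \<in> space (sample_measure P d lam). fst s = c \<and> (\<forall>b<k. \<bar>dotp d (\<theta> b) (snd s)\<bar> \<le> 1)} = {c} \<times> E"
    unfolding sample_measure_def G_def[symmetric] E_def by (auto simp: space_pair_measure)
  moreover have "emeasure (sample_measure P d lam) ({c} \<times> E) = ennreal (pmf P c) * emeasure G E"
    unfolding sample_measure_def G_def[symmetric]
    using E by (subst G.emeasure_pair_measure_Times) (auto simp: emeasure_pmf_single)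
  ultimately have "measure (sample_measure P d lam)
     {s \<in> space (sample_measure P d lam). fst s = c \<and> (\<forall>b<k. \<bar>dotp d (\<theta> b) (snd s)\<bar> \<le> 1)} = pmf P c * measure G E"
    by (simp add: measure_def enn2real_mult)
  then show ?thesis using mult_left_mono[OF half, of "pmf P c"] by simp
qed

lemma prod_mono_ennreal:
  fixes f g :: "'a \<Rightarrow> ennreal"
  assumes "\<And>i. i \<in> A \<Longrightarrow> f i \<le> g i"
  shows "prod f A \<le> prod g A"
  using assms by (induction A rule: infinite_finite_induct) (auto intro!: mult_mono)

text \<open>Operator norm bound in the form of finitely many inequalities: measurable at once, and
  accessible to a union bound.\<close>

definition noise_bounded :: "nat \<Rightarrow> (nat \<Rightarrow> nat \<times> (nat \<Rightarrow> real)) \<Rightarrow> nat set \<Rightarrow> real \<Rightarrow> bool" where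
  "noise_bounded d t I B \<longleftrightarrow>
     (\<forall>\<nu>\<in>grid d. (\<Sum>m\<in>I. (dotp d (\<lambda>i. of_int (\<nu> i) / sqrt (real d)) (snd (t m)))\<^sup>2) \<le> B)"

lemma noise_bounded_quadratic_form:
  assumes "0 < d" "noise_bounded d t I B"
  shows "(\<Sum>m\<in>I. (dotp d z (snd (t m)))\<^sup>2) \<le> B * dotp d z z"
  using assms unfolding noise_bounded_def by (intro quadratic_form_bound_from_grid) auto

lemma measurable_sample_component:
  assumes "m \<in> {1..N}"
  shows "(\<lambda>t. fst (t m)) \<in> PiM {1..N} (\<lambda>_. sample_measure P d lam) \<rightarrow>\<^sub>M count_space UNIV"
    and "i < d \<Longrightarrow> (\<lambda>t. snd (t m) i) \<in> borel_measurable (PiM {1..N} (\<lambda>_. sample_measure P d lam))"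
  using measurable_compose[OF measurable_component_singleton[OF assms] measurable_sample_label]
    measurable_compose[OF measurable_component_singleton[OF assms] borel_measurable_sample_noise]
  by auto

lemma borel_measurable_noise_quadratic:
  assumes "I \<subseteq> {1..N}"
  shows "(\<lambda>t. \<Sum>m\<in>I. (dotp d \<theta> (snd (t m)))\<^sup>2) \<in> borel_measurable (PiM {1..N} (\<lambda>_. sample_measure P d lam))"
  using assms
  by (intro borel_measurable_sum borel_measurable_power borel_measurable_dotp measurable_sample_component) auto

lemma sets_noise_bounded:
  assumes "I \<subseteq> {1..N}"
  shows "{t \<in> space (PiM {1..N} (\<lambda>_. sample_measure P d lam)). noise_bounded d t I B}
     \<in> sets (PiM {1..N} (\<lambda>_. sample_measure P d lam))"
  unfolding noise_bounded_def
proof (intro sets.sets_Collect_finite_All finite_grid)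
  fix \<nu>
  note borel_measurable_noise_quadratic[OF assms, of d "\<lambda>i. of_int (\<nu> i) / sqrt (real d)" P lam, measurable]
  show "{t \<in> space (PiM {1..N} (\<lambda>_. sample_measure P d lam)).
     (\<Sum>m\<in>I. (dotp d (\<lambda>i. of_int (\<nu> i) / sqrt (real d)) (snd (t m)))\<^sup>2) \<le> B}
     \<in> sets (PiM {1..N} (\<lambda>_. sample_measure P d lam))" by measurable
qed

text \<open>On the scaled grid squared norms are at most 4, so with noise variance
  \<open>1 / lam\<close> the exponent \<open>lam / 16\<close> meets exactly the threshold 1/4 of the
  moment bound. The level satisfies \<open>lam / 16 * B = (6 * \<kappa> + 2) * n\<close>: it pays
  \<open>6 * d <= 6 * \<kappa> * n\<close> for the grid and \<open>n\<close> for the moments, and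
  \<open>exp (- n)\<close> is left. Allowing \<open>card I <= n\<close> covers windows cut off at
  the last sample.\<close>

lemma noise_bounded_tail:
  assumes lam: "0 < lam" and d: "0 < d" and I: "I \<subseteq> {1..N}" "card I \<le> n" and \<kappa>: "real d \<le> \<kappa> * real n"
  shows "measure (PiM {1..N} (\<lambda>_. sample_measure P d lam))
    {t \<in> space (PiM {1..N} (\<lambda>_. sample_measure P d lam)). \<not> noise_bounded d t I (16 * (6 * \<kappa> + 2) * real n / lam)}
    \<le> exp (- real n)"
proof -
  define S where "S = sample_measure P d lam"
  define Q where "Q = PiM {1..N} (\<lambda>_. S)"
  have S: "prob_space S" unfolding S_def by (rule prob_space_sample_measure[OF lam])
  interpret S: prob_space S by fact
  interpret Q: prob_space Q unfolding Q_def by (intro prob_space_PiM S)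
  interpret G: prob_space "gauss_vec d (1 / lam)" using lam by (intro prob_space_gauss_vec) simp
  interpret prod: product_sigma_finite "\<lambda>_. S"
    unfolding product_sigma_finite_def using prob_space_imp_sigma_finite[OF S] by auto
  have finI: "finite I" using I finite_subset by blast
  define \<theta> :: "(nat \<Rightarrow> int) \<Rightarrow> nat \<Rightarrow> real" where "\<theta> \<nu> = (\<lambda>i. of_int (\<nu> i) / sqrt (real d))" for \<nu>
  define B where "B = 16 * (6 * \<kappa> + 2) * real n / lam"
  define f where "f \<nu> t = lam / 16 * (\<Sum>m\<in>I. (dotp d (\<theta> \<nu>) (snd (t m)))\<^sup>2)" for \<nu> and t :: "nat \<Rightarrow> nat \<times> (nat \<Rightarrow> real)"
  have \<theta>: "dotp d (\<theta> \<nu>) (\<theta> \<nu>) \<le> 4" if "\<nu> \<in> grid d" for \<nu>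
  proof -
    have "dotp d (\<theta> \<nu>) (\<theta> \<nu>) = real_of_int (\<Sum>i<d. (\<nu> i)\<^sup>2) / real d"
      by (simp add: dotp_def \<theta>_def sum_divide_distrib power2_eq_square)
    also have "real_of_int (\<Sum>i<d. (\<nu> i)\<^sup>2) \<le> real_of_int (int (4 * d))"
      using that unfolding grid_def by (simp only: of_int_le_iff) simp
    finally show ?thesis using d by (simp add: divide_right_mono)
  qed
  have fm: "f \<nu> \<in> borel_measurable Q" for \<nu>
    unfolding f_def[abs_def] Q_def S_def using I
    by (intro borel_measurable_times borel_measurable_noise_quadratic) auto
  have sm: "(\<lambda>s. ennreal (exp (lam / 16 * (dotp d (\<theta> \<nu>) (snd s))\<^sup>2))) \<in> borel_measurable S" for \<nu>
  proof -
    have [measurable]: "(\<lambda>s. dotp d (\<theta> \<nu>) (snd s)) \<in> borel_measurable S"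
      unfolding S_def by (intro borel_measurable_dotp borel_measurable_sample_noise) auto
    show ?thesis by measurable
  qed
  have one: "(\<integral>\<^sup>+s. ennreal (exp (lam / 16 * (dotp d (\<theta> \<nu>) (snd s))\<^sup>2)) \<partial>S) \<le> ennreal (exp 1)"
    if \<nu>: "\<nu> \<in> grid d" for \<nu>
  proof -
    have "(\<integral>\<^sup>+s. ennreal (exp (lam / 16 * (dotp d (\<theta> \<nu>) (snd s))\<^sup>2)) \<partial>S)
       = (\<integral>\<^sup>+a. (\<integral>\<^sup>+z. ennreal (exp (lam / 16 * (dotp d (\<theta> \<nu>) z)\<^sup>2)) \<partial>gauss_vec d (1 / lam)) \<partial>measure_pmf P)"
      using G.nn_integral_fst[of "\<lambda>s. ennreal (exp (lam / 16 * (dotp d (\<theta> \<nu>) (snd s))\<^sup>2))" "measure_pmf P"] sm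
      by (simp add: S_def sample_measure_def)
    also have "\<dots> \<le> (\<integral>\<^sup>+a. ennreal (sqrt 2) \<partial>measure_pmf P)"
      using lam \<theta>[OF \<nu>] by (intro nn_integral_mono nn_integral_gauss_vec_exp_dotp_square) auto
    also have "\<dots> = ennreal (sqrt 2)" by (simp add: measure_pmf.emeasure_space_1)
    also have "\<dots> \<le> ennreal (exp 1)"
    proof (rule ennreal_leI)
      have "sqrt 2 \<le> 2" by (intro real_le_lsqrt) auto
      then show "sqrt 2 \<le> exp 1" using exp_ge_add_one_self[of 1] by simp
    qed
    finally show ?thesis .
  qed
  have tail: "measure Q {t \<in> space Q. lam / 16 * B \<le> f \<nu> t} \<le> exp (- (lam / 16 * B)) * exp (real n)"
    if \<nu>: "\<nu> \<in> grid d" for \<nu>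
  proof -
    define F where "F m s = (if m \<in> I then ennreal (exp (lam / 16 * (dotp d (\<theta> \<nu>) (snd s))\<^sup>2)) else 1)"
      for m :: nat and s :: "nat \<times> (nat \<Rightarrow> real)"
    have "(\<integral>\<^sup>+t. ennreal (exp (f \<nu> t)) \<partial>Q) = (\<integral>\<^sup>+t. (\<Prod>m\<in>{1..N}. F m (t m)) \<partial>Q)"
    proof (intro nn_integral_cong)
      fix t
      have "ennreal (exp (f \<nu> t)) = (\<Prod>m\<in>I. F m (t m))"
        unfolding f_def sum_distrib_left exp_sum[OF finI] F_def by (subst prod_ennreal[symmetric]) auto
      also have "\<dots> = (\<Prod>m\<in>{1..N}. F m (t m))"
        using I by (intro prod.mono_neutral_left) (auto simp: F_def)
      finally show "ennreal (exp (f \<nu> t)) = \<dots>" .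
    qed
    also have "\<dots> = (\<Prod>m\<in>{1..N}. \<integral>\<^sup>+s. F m s \<partial>S)"
      unfolding Q_def
    proof (rule prod.product_nn_integral_prod)
      show "F m \<in> borel_measurable S" for m
        unfolding F_def[abs_def] using sm[of \<nu>] by (cases "m \<in> I") simp_all
    qed simp
    also have "\<dots> \<le> (\<Prod>m\<in>{1..N}. if m \<in> I then ennreal (exp 1) else 1)"
    proof (rule prod_mono_ennreal)
      show "(\<integral>\<^sup>+s. F m s \<partial>S) \<le> (if m \<in> I then ennreal (exp 1) else 1)" for m
        using one[OF \<nu>] by (simp add: F_def S.emeasure_space_1)
    qed
    also have "\<dots> = (\<Prod>m\<in>I. ennreal (exp 1))"
      using I by (intro prod.mono_neutral_cong_right) auto
    also have "\<dots> = ennreal (exp (real (card I)))"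
      by (simp add: ennreal_power flip: exp_of_nat_mult)
    also have "\<dots> \<le> ennreal (exp (real n))" using I by (intro ennreal_leI) simp
    finally have "emeasure Q {t \<in> space Q. lam / 16 * B \<le> f \<nu> t} \<le> ennreal (exp (- (lam / 16 * B)) * exp (real n))"
      by (intro emeasure_Chernoff fm) auto
    then show ?thesis by (simp add: Q.emeasure_eq_measure)
  qed
  have ev: "{t \<in> space Q. lam / 16 * B \<le> f \<nu> t} \<in> sets Q" for \<nu> using fm[of \<nu>] by measurable
  have "measure Q {t \<in> space Q. \<not> noise_bounded d t I B} \<le> measure Q (\<Union>\<nu>\<in>grid d. {t \<in> space Q. lam / 16 * B \<le> f \<nu> t})"
    using ev lam by (intro Q.finite_measure_mono sets.finite_UN finite_grid)
      (auto simp: noise_bounded_def f_def \<theta>_def not_le)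
  also have "\<dots> \<le> (\<Sum>\<nu>\<in>grid d. measure Q {t \<in> space Q. lam / 16 * B \<le> f \<nu> t})"
    using ev by (intro Q.finite_measure_subadditive_finite finite_grid) auto
  also have "\<dots> \<le> (\<Sum>\<nu>\<in>grid d. exp (- (lam / 16 * B)) * exp (real n))" by (intro sum_mono tail)
  also have "\<dots> = real (card (grid d)) * exp (real n - lam / 16 * B)" by (simp flip: exp_add)
  also have "\<dots> \<le> exp (6 * real d) * exp (real n - lam / 16 * B)"
    by (intro mult_right_mono card_grid_le) auto
  also have "\<dots> = exp (6 * real d + (real n - lam / 16 * B))" by (simp only: exp_add)
  also have "\<dots> \<le> exp (- real n)"
  proof -
    have "lam / 16 * B = (6 * \<kappa> + 2) * real n" using lam by (simp add: B_def)
    then show ?thesis using \<kappa> by (simp add: algebra_simps)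
  qed
  finally show ?thesis unfolding Q_def S_def B_def .
qed

section \<open>Measurability of the iterates\<close>

lemma borel_measurable_softmax:
  assumes x: "\<And>b i. b < k \<Longrightarrow> i < d \<Longrightarrow> (\<lambda>w. x w b i) \<in> borel_measurable N"
    and Y: "\<And>i. i < d \<Longrightarrow> (\<lambda>w. Y w i) \<in> borel_measurable N" and c: "c < k"
  shows "(\<lambda>w. softmax k d (x w) (Y w) c) \<in> borel_measurable N"
proof -
  have [measurable]: "(\<lambda>w. exp (dotp d (x w b) (Y w))) \<in> borel_measurable N" if "b < k" for b
    using x[OF that] Y
    by (intro measurable_compose[OF _ borel_measurable_exp] borel_measurable_dotp) auto
  show ?thesis unfolding softmax_def using c
    by (intro borel_measurable_divide borel_measurable_sum) auto
qed

lemma borel_measurable_sgd: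
  assumes label: "\<And>m. m \<in> {1..l} \<Longrightarrow> (\<lambda>w. fst (t w m)) \<in> N \<rightarrow>\<^sub>M count_space UNIV"
    and noise: "\<And>m i. m \<in> {1..l} \<Longrightarrow> i < d \<Longrightarrow> (\<lambda>w. snd (t w m) i) \<in> borel_measurable N"
    and init: "\<And>c i. c < k \<Longrightarrow> i < d \<Longrightarrow> (\<lambda>w. x0 w c i) \<in> borel_measurable N"
  shows "c < k \<Longrightarrow> i < d \<Longrightarrow> (\<lambda>w. sgd k d \<delta> \<beta> (\<lambda>m. data_point mu (t w m)) (x0 w) l c i) \<in> borel_measurable N"
  using label noise
proof (induction l arbitrary: c i)
  case 0
  then show ?case using init by simp
next
  case (Suc l)
  have IH: "(\<lambda>w. sgd k d \<delta> \<beta> (\<lambda>m. data_point mu (t w m)) (x0 w) l b j) \<in> borel_measurable N" if "b < k" "j < d" for b j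
    by (rule Suc.IH[OF that]) (use Suc.prems in auto)
  have label: "(\<lambda>w. fst (t w (Suc l))) \<in> N \<rightarrow>\<^sub>M count_space UNIV" using Suc.prems by auto
  have Y: "(\<lambda>w. snd (data_point mu (t w (Suc l))) j) \<in> borel_measurable N" if "j < d" for j
    unfolding data_point_def snd_conv
  proof (rule borel_measurable_add)
    show "(\<lambda>w. mu (fst (t w (Suc l))) j) \<in> borel_measurable N"
      by (rule measurable_compose[OF label]) simp
    show "(\<lambda>w. snd (t w (Suc l)) j) \<in> borel_measurable N" using Suc.prems that by auto
  qed
  have ind: "(\<lambda>w. if fst (data_point mu (t w (Suc l))) = c then 1 else 0 :: real) \<in> borel_measurable N"
    unfolding data_point_def fst_conv by (rule measurable_compose[OF label]) simp
  show ?case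
    unfolding sgd_Suc_eq[OF Suc.prems(1,2)] residual_def
    by (intro borel_measurable_add borel_measurable_times borel_measurable_diff borel_measurable_const
        borel_measurable_softmax ind IH Y Suc.prems)
qed

lemma sgd_cong:
  "(\<And>j. j \<in> {1..l} \<Longrightarrow> Ys j = Ys' j) \<Longrightarrow> sgd k d \<delta> \<beta> Ys x0 l = sgd k d \<delta> \<beta> Ys' x0 l"
  by (induction l) auto

section \<open>Alignment on good data\<close>

text \<open>Measurability travels together with the probability bound, so conjunctions of events
  yield a measurable set. Such a set inside the alignment event is the witness \<open>A\<close> in
  the theorem.\<close>

definition likely :: "'a measure \<Rightarrow> ('a \<Rightarrow> bool) \<Rightarrow> real \<Rightarrow> bool" where
  "likely M P e \<longleftrightarrow> {w \<in> space M. P w} \<in> sets M \<and> 1 - e \<le> measure M {w \<in> space M. P w}"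

lemma likelyI:
  assumes "prob_space M" "{w \<in> space M. P w} \<in> sets M" "measure M {w \<in> space M. \<not> P w} \<le> e"
  shows "likely M P e"
  using assms prob_space.prob_neg[OF assms(1), of P] by (simp add: likely_def)

lemma measure_not_le_likely:
  assumes "prob_space M" "likely M P e"
  shows "measure M {w \<in> space M. \<not> P w} \<le> e"
  using assms prob_space.prob_neg[OF assms(1), of P] by (simp add: likely_def)

lemma likely_conj:
  assumes M: "prob_space M" and P: "likely M P a" and Q: "likely M Q b"
  shows "likely M (\<lambda>w. P w \<and> Q w) (a + b)"
proof (rule likelyI[OF M])
  interpret prob_space M by fact
  have s: "{w \<in> space M. P w} \<in> sets M" "{w \<in> space M. Q w} \<in> sets M" using P Q by (auto simp: likely_def)
  then show "{w \<in> space M. P w \<and> Q w} \<in> sets M" by (rule sets.sets_Collect_conj[rotated])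
  have "{w \<in> space M. \<not> (P w \<and> Q w)} = {w \<in> space M. \<not> P w} \<union> {w \<in> space M. \<not> Q w}" by auto
  also have "measure M \<dots> \<le> measure M {w \<in> space M. \<not> P w} + measure M {w \<in> space M. \<not> Q w}"
    using s by (intro measure_Un_le sets.sets_Collect_neg)
  also have "\<dots> \<le> a + b" by (intro add_mono measure_not_le_likely M P Q)
  finally show "measure M {w \<in> space M. \<not> (P w \<and> Q w)} \<le> a + b" .
qed

lemma likely_all:
  assumes M: "prob_space M" and I: "finite I" and P: "\<And>i. i \<in> I \<Longrightarrow> likely M (P i) e"
  shows "likely M (\<lambda>w. \<forall>i\<in>I. P i w) (real (card I) * e)"
  using I P
proof (induction I rule: finite_induct)
  case empty
  then show ?case using prob_space.prob_space[OF M] by (simp add: likely_def)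
next
  case (insert i I)
  have "likely M (\<lambda>w. P i w \<and> (\<forall>i\<in>I. P i w)) (e + real (card I) * e)"
    using insert by (intro likely_conj M) auto
  then show ?case using insert by (simp add: algebra_simps)
qed

lemma likely_mono: "likely M P a \<Longrightarrow> a \<le> b \<Longrightarrow> likely M P b"
  unfolding likely_def by linarith

lemma likely_component:
  assumes S: "prob_space S" and i: "i \<in> I" and P: "likely S P e"
  shows "likely (PiM I (\<lambda>_. S)) (\<lambda>h. P (h i)) e"
proof -
  let ?Q = "PiM I (\<lambda>_. S)"
  have m: "(\<lambda>h. h i) \<in> ?Q \<rightarrow>\<^sub>M S" by (rule measurable_component_singleton[OF i])
  have s: "{w \<in> space S. P w} \<in> sets S" using P by (simp add: likely_def)
  have eq: "{h \<in> space ?Q. P (h i)} = (\<lambda>h. h i) -` {w \<in> space S. P w} \<inter> space ?Q"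
    using measurable_space[OF m] by auto
  have "{h \<in> space ?Q. P (h i)} \<in> sets ?Q" unfolding eq using m s by (rule measurable_sets)
  moreover have "distr ?Q S (\<lambda>h. h i) = S" using S i by (intro distr_PiM_component) auto
  then have "measure S {w \<in> space S. P w} = measure ?Q {h \<in> space ?Q. P (h i)}"
    unfolding eq using measure_distr[OF m s] by simp
  ultimately show ?thesis using P by (simp add: likely_def)
qed

text \<open>Fubini for a bound uniform in the second component. It serves to freeze the
  initialization while good training steps are counted.\<close>

lemma likely_fst_section:
  assumes M: "prob_space M" and N: "prob_space N"
    and s: "{w \<in> space (M \<Otimes>\<^sub>M N). P (fst w) (snd w)} \<in> sets (M \<Otimes>\<^sub>M N)"
    and P: "\<And>y. y \<in> space N \<Longrightarrow> likely M (\<lambda>x. P x y) e" and e: "0 \<le> e"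
  shows "likely (M \<Otimes>\<^sub>M N) (\<lambda>w. P (fst w) (snd w)) e"
proof (rule likelyI[OF prob_space_pair[OF M N] s])
  interpret M: prob_space M by fact
  interpret N: prob_space N by fact
  interpret pair_sigma_finite M N ..
  interpret MN: prob_space "M \<Otimes>\<^sub>M N" by (rule prob_space_pair[OF M N])
  let ?X = "{w \<in> space (M \<Otimes>\<^sub>M N). \<not> P (fst w) (snd w)}"
  have X: "?X \<in> sets (M \<Otimes>\<^sub>M N)" using s by (rule sets.sets_Collect_neg)
  have "emeasure (M \<Otimes>\<^sub>M N) ?X = (\<integral>\<^sup>+y. emeasure M ((\<lambda>x. (x, y)) -` ?X) \<partial>N)"
    by (rule emeasure_pair_measure_alt2[OF X])
  also have "\<dots> \<le> (\<integral>\<^sup>+y. ennreal e \<partial>N)"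
  proof (rule nn_integral_mono)
    fix y assume y: "y \<in> space N"
    have "(\<lambda>x. (x, y)) -` ?X = {x \<in> space M. \<not> P x y}" using y by (auto simp: space_pair_measure)
    then show "emeasure M ((\<lambda>x. (x, y)) -` ?X) \<le> ennreal e"
      using measure_not_le_likely[OF M P[OF y]] by (simp add: M.emeasure_eq_measure ennreal_leI)
  qed
  also have "\<dots> = ennreal e" by (simp add: N.emeasure_space_1)
  finally show "measure (M \<Otimes>\<^sub>M N) ?X \<le> e" using e by (simp add: MN.emeasure_eq_measure)
qed

lemma likely_fst:
  assumes M: "prob_space M" and N: "prob_space N" and P: "likely M P e"
  shows "likely (M \<Otimes>\<^sub>M N) (\<lambda>w. P (fst w)) e"
proof -
  interpret N: prob_space N by fact
  let ?A = "{x \<in> space M. P x}"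
  have A: "?A \<in> sets M" using P by (simp add: likely_def)
  have eq: "{w \<in> space (M \<Otimes>\<^sub>M N). P (fst w)} = ?A \<times> space N" by (auto simp: space_pair_measure)
  have "measure (M \<Otimes>\<^sub>M N) (?A \<times> space N) = measure M ?A"
    using A by (simp add: measure_def N.emeasure_pair_measure_Times N.emeasure_space_1)
  then show ?thesis using P A unfolding likely_def eq by simp
qed

lemma likely_snd:
  assumes M: "prob_space M" and N: "prob_space N" and P: "likely N P e"
  shows "likely (M \<Otimes>\<^sub>M N) (\<lambda>w. P (snd w)) e"
proof -
  interpret M: prob_space M by fact
  interpret N: prob_space N by fact
  let ?A = "{x \<in> space N. P x}"
  have A: "?A \<in> sets N" using P by (simp add: likely_def)
  have eq: "{w \<in> space (M \<Otimes>\<^sub>M N). P (snd w)} = space M \<times> ?A" by (auto simp: space_pair_measure)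
  have "measure (M \<Otimes>\<^sub>M N) (space M \<times> ?A) = measure N ?A"
    using A by (simp add: measure_def N.emeasure_pair_measure_Times M.emeasure_space_1)
  then show ?thesis using P A unfolding likely_def eq by simp
qed

lemma sets_card_ge:
  assumes "finite W" "\<And>m. m \<in> W \<Longrightarrow> {w \<in> space M. g m w} \<in> sets M"
  shows "{w \<in> space M. r \<le> real (card {m \<in> W. g m w})} \<in> sets M"
proof -
  have eq: "real (card {m \<in> W. g m w}) = (\<Sum>m\<in>W. if g m w then 1 else 0)" for w
    using assms(1) by (simp add: sum.If_cases Int_def)
  have [measurable]: "(\<lambda>w. \<Sum>m\<in>W. if g m w then 1 else 0 :: real) \<in> borel_measurable M"
    using assms(2) by (intro borel_measurable_sum measurable_If) auto
  show ?thesis unfolding eq by measurable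
qed

lemma sets_good_sample:
  assumes label: "\<And>j. j \<in> {1..m} \<Longrightarrow> (\<lambda>w. fst (t w j)) \<in> N \<rightarrow>\<^sub>M count_space UNIV"
    and noise: "\<And>j i. j \<in> {1..m} \<Longrightarrow> i < d \<Longrightarrow> (\<lambda>w. snd (t w j) i) \<in> borel_measurable N"
    and init: "\<And>c i. c < k \<Longrightarrow> i < d \<Longrightarrow> (\<lambda>w. x0 w c i) \<in> borel_measurable N"
    and m: "1 \<le> m"
  shows "{w \<in> space N. good_sample k d (sgd k d \<delta> \<beta> (\<lambda>j. data_point mu (t w j)) (x0 w)) R (t w) c m} \<in> sets N"
proof -
  let ?x = "\<lambda>w. sgd k d \<delta> \<beta> (\<lambda>j. data_point mu (t w j)) (x0 w) (m - 1)"
  have x: "(\<lambda>w. ?x w b i) \<in> borel_measurable N" if "b < k" "i < d" for b i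
    using that m by (intro borel_measurable_sgd label noise init) auto
  have 1: "{w \<in> space N. fst (t w m) = c} \<in> sets N"
  proof -
    have "{w \<in> space N. fst (t w m) = c} = (\<lambda>w. fst (t w m)) -` {c} \<inter> space N" by auto
    also have "\<dots> \<in> sets N" using m by (intro measurable_sets[OF label]) auto
    finally show ?thesis .
  qed
  have 2: "{w \<in> space N. \<bar>dotp d (?x w b) (snd (t w m))\<bar> \<le> 1} \<in> sets N" if "b < k" for b
  proof -
    have [measurable]: "(\<lambda>w. dotp d (?x w b) (snd (t w m))) \<in> borel_measurable N"
      using m by (intro borel_measurable_dotp x that noise) auto
    show ?thesis by measurable
  qed
  have 3: "{w \<in> space N. R < vnorm d (?x w b)} \<in> sets N" if "b < k" for b
  proof -
    have [measurable]: "(\<lambda>w. vnorm d (?x w b)) \<in> borel_measurable N"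
      unfolding vnorm_def by (intro measurable_compose[OF borel_measurable_dotp borel_measurable_sqrt] x that)
    show ?thesis by measurable
  qed
  have 4: "{w \<in> space N. \<forall>b\<in>{..<k}. \<bar>dotp d (?x w b) (snd (t w m))\<bar> \<le> 1} \<in> sets N"
    by (rule sets.sets_Collect_finite_All) (use 2 in auto)
  have 5: "{w \<in> space N. \<exists>b\<in>{..<k}. R < vnorm d (?x w b)} \<in> sets N"
    by (rule sets.sets_Collect_finite_Ex) (use 3 in auto)
  have "{w \<in> space N. (fst (t w m) = c \<and> (\<forall>b\<in>{..<k}. \<bar>dotp d (?x w b) (snd (t w m))\<bar> \<le> 1))
     \<or> (\<exists>b\<in>{..<k}. R < vnorm d (?x w b))}
    = ({w \<in> space N. fst (t w m) = c} \<inter> {w \<in> space N. \<forall>b\<in>{..<k}. \<bar>dotp d (?x w b) (snd (t w m))\<bar> \<le> 1})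
       \<union> {w \<in> space N. \<exists>b\<in>{..<k}. R < vnorm d (?x w b)}" by blast
  also have "\<dots> \<in> sets N" by (intro sets.Un sets.Int 1 4 5)
  finally have "{w \<in> space N. (fst (t w m) = c \<and> (\<forall>b\<in>{..<k}. \<bar>dotp d (?x w b) (snd (t w m))\<bar> \<le> 1))
     \<or> (\<exists>b\<in>{..<k}. R < vnorm d (?x w b))} \<in> sets N" .
  then show ?thesis unfolding good_sample_def by (simp add: Ball_def Bex_def)
qed

text \<open>A Markov argument in the empirical measure: by the operator norm bound at most
  \<open>k * R^2 * B * n <= q / 2 * n\<close> samples have noise larger than 1 along some
  \<open>x b\<close>, so at least half of the guaranteed count of class \<open>a\<close> keeps
  weight \<open>e\<close>. The bound holds for all \<open>x\<close> of norm at most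
  \<open>R\<close>, hence for all iterates on one event.\<close>

lemma weighted_label_count_ge:
  assumes w: "\<And>l. l \<in> {1..n} \<Longrightarrow> 0 \<le> w l"
    and weta: "\<And>l. l \<in> {1..n} \<Longrightarrow> (\<forall>b<k. \<bar>dotp d (x b) (snd (t l))\<bar> \<le> 1) \<Longrightarrow> e \<le> w l" and e: "0 \<le> e"
    and op: "\<And>z. (\<Sum>l\<in>{1..n}. (dotp d z (snd (t l)))\<^sup>2) \<le> B * real n * dotp d z z" and B: "0 \<le> B"
    and x: "\<And>b. b < k \<Longrightarrow> vnorm d (x b) \<le> R"
    and cnt: "q * real n \<le> real (card {l \<in> {1..n}. fst (t l) = a})"
    and small: "real k * R\<^sup>2 * B \<le> q / 2"
  shows "e * (q / 2) * real n \<le> (\<Sum>l\<in>{l\<in>{1..n}. fst (t l) = a}. w l)"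
proof -
  let ?A = "{l \<in> {1..n}. fst (t l) = a}"
  define bad where "bad l = (\<Sum>b<k. (dotp d (x b) (snd (t l)))\<^sup>2)" for l
  have bad0: "0 \<le> bad l" for l unfolding bad_def by (intro sum_nonneg) auto
  have "(\<Sum>l\<in>{1..n}. bad l) = (\<Sum>b<k. \<Sum>l\<in>{1..n}. (dotp d (x b) (snd (t l)))\<^sup>2)"
    unfolding bad_def by (rule sum.swap)
  also have "\<dots> \<le> (\<Sum>b<k. B * real n * R\<^sup>2)"
  proof (rule sum_mono)
    fix b assume "b \<in> {..<k}"
    then have "(vnorm d (x b))\<^sup>2 \<le> R\<^sup>2" using x by (intro power_mono) auto
    then have "B * real n * dotp d (x b) (x b) \<le> B * real n * R\<^sup>2"
      using B by (intro mult_left_mono) (auto simp: vnorm_square)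
    then show "(\<Sum>l\<in>{1..n}. (dotp d (x b) (snd (t l)))\<^sup>2) \<le> B * real n * R\<^sup>2"
      using op[of "x b"] by linarith
  qed
  also have "\<dots> = (real k * R\<^sup>2 * B) * real n" by simp
  also have "\<dots> \<le> q / 2 * real n" using small by (intro mult_right_mono) auto
  finally have badsum: "(\<Sum>l\<in>{1..n}. bad l) \<le> q / 2 * real n" .
  have "e * (q / 2) * real n \<le> e * (real (card ?A) - (\<Sum>l\<in>{1..n}. bad l))"
    using cnt badsum e mult_left_mono[of "q / 2 * real n" "real (card ?A) - (\<Sum>l\<in>{1..n}. bad l)" e]
    by (simp add: algebra_simps)
  also have "\<dots> \<le> e * (real (card ?A) - (\<Sum>l\<in>?A. bad l))"
    using bad0 e by (intro mult_left_mono diff_left_mono sum_mono2) auto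
  \<comment> \<open>\<open>1 - bad l\<close> bounds the indicator of a harmless sample from below:
    it is at most 1, and nonpositive as soon as one direction exceeds 1.\<close>
  also have "\<dots> = (\<Sum>l\<in>?A. e * (1 - bad l))"
    by (simp add: sum_distrib_left sum_subtractf algebra_simps)
  also have "\<dots> \<le> (\<Sum>l\<in>?A. w l)"
  proof (rule sum_mono)
    fix l assume l: "l \<in> ?A"
    show "e * (1 - bad l) \<le> w l"
    proof (cases "\<forall>b<k. \<bar>dotp d (x b) (snd (t l))\<bar> \<le> 1")
      case True
      have "e * (1 - bad l) \<le> e * 1" using bad0 e by (intro mult_left_mono) auto
      also have "\<dots> \<le> w l" using weta True l by simp
      finally show ?thesis .
    next
      case False
      then obtain b where b: "b < k" "1 < \<bar>dotp d (x b) (snd (t l))\<bar>" by (auto simp: not_le)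
      then have "1 \<le> (dotp d (x b) (snd (t l)))\<^sup>2"
        using power_mono[of 1 "\<bar>dotp d (x b) (snd (t l))\<bar>" 2] by simp
      also have "\<dots> \<le> bad l" unfolding bad_def using b by (intro member_le_sum) auto
      finally have "e * (1 - bad l) \<le> 0" using e by (intro mult_nonneg_nonpos) auto
      also have "0 \<le> w l" using w l by simp
      finally show ?thesis .
    qed
  qed
  finally show ?thesis .
qed

text \<open>Purely deterministic; the two matrices differ only in their weights. Hypothesis
  \<open>rem\<close> keeps the remainder, paired with the dual vector \<open>v\<close>, below half
  of the signal, so that the iterate has norm at least \<open>s0 / (2 * V)\<close>;
  \<open>err\<close> compares the squared distance to the eigenspace with the square of this
  norm.\<close>

lemma alignment_of_good_data:
  fixes k d n M J Mt :: nat and \<delta> \<beta> B R q qt :: real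
    and mu :: "nat \<Rightarrow> nat \<Rightarrow> real" and t t' :: "nat \<Rightarrow> nat \<times> (nat \<Rightarrow> real)" and x0 :: "nat \<Rightarrow> nat \<Rightarrow> real"
  defines "x \<equiv> sgd k d \<delta> \<beta> (\<lambda>m. data_point mu (t m)) x0"
    and "\<eta> \<equiv> exp (- 2 * (R + 1)) / real k"
    and "NB \<equiv> 2 * sqrt B * (1 / (1 - exp (- \<beta>)) + 1)"
  assumes k: "2 \<le> k" "k \<le> d" and \<beta>: "0 < \<beta>" and \<delta>: "0 < \<delta>" "\<delta> \<le> 1" "\<delta> * \<beta> \<le> 1 / 2"
    and n: "n = nat \<lceil>1 / \<delta>\<rceil>" and B: "0 \<le> B"
    and mu_unit: "\<And>b. b < k \<Longrightarrow> vnorm d (mu b) = 1"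
    and labels: "\<And>m. m \<in> {1..M} \<Longrightarrow> fst (t m) < k"
    and x0: "\<And>c. c < k \<Longrightarrow> vnorm d (x0 c) \<le> 2"
    and op: "\<And>j z. j \<le> J \<Longrightarrow> (\<Sum>m\<in>{j*n+1..(j+1)*n} \<inter> {1..M}. (dotp d z (snd (t m)))\<^sup>2) \<le> B * real n * dotp d z z"
    and R: "2 + real k / \<beta> + NB \<le> R"
    and count: "\<And>c j. c < k \<Longrightarrow> j \<le> J \<Longrightarrow> (j + 1) * n \<le> M \<Longrightarrow>
       q * real n \<le> real (card {m \<in> {j*n+1..(j+1)*n}. good_sample k d x R t c m})"
    and Mt: "0 < Mt"
    and labels': "\<And>l. l \<in> {1..Mt} \<Longrightarrow> fst (t' l) < k"
    and op': "\<And>z. (\<Sum>l\<in>{1..Mt}. (dotp d z (snd (t' l)))\<^sup>2) \<le> B * real Mt * dotp d z z"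
    and count': "\<And>a. a < k \<Longrightarrow> qt * real Mt \<le> real (card {l \<in> {1..Mt}. fst (t' l) = a})"
    and q: "0 < q" "0 < qt" and small: "real k * R\<^sup>2 * B \<le> qt / 2"
    and dual: "\<And>b. b < k \<Longrightarrow> dotp d (mu b) v = (if b = c then 1 else 0)" "vnorm d v \<le> V" "0 < V"
    and c: "c < k"
    and rem: "(2 * exp (- \<beta> * T0) + NB) * V \<le> exp (- 8 * \<beta>) * (\<eta> * q) / 2"
    and T0: "4 \<le> T0" and l: "l \<le> M" "T0 / \<delta> \<le> real l" "real l \<le> real J / \<delta>"
    and err: "(real k * (1 / \<beta>) * sqrt (4 * B / (\<eta>\<^sup>2 * (qt / 2))) + (2 * exp (- \<beta> * T0) + NB))\<^sup>2
       \<le> err * (exp (- 8 * \<beta>) * (\<eta> * q) / (2 * V))\<^sup>2"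
  shows "lives_in_Ek d k (emp_hess_block k d Mt (\<lambda>m. data_point mu (t' m)) (x l) c) (x l c) err"
    and "lives_in_Ek d k (emp_G_block k d Mt (\<lambda>m. data_point mu (t' m)) (x l) c) (x l c) err"
proof -
  define s where "s b = signal k d \<delta> \<beta> mu t x l c b" for b
  define r where "r = remainder k d \<delta> \<beta> mu t x0 x l c"
  define s0 where "s0 = exp (- 8 * \<beta>) * (\<eta> * q)"
  note ctx = meta_eq_to_obj_eq[OF x_def] k(1) \<beta> \<delta> n B mu_unit labels x0 op R[unfolded NB_def] count
  have \<eta>: "0 < \<eta>" using k by (simp add: \<eta>_def)
  have decomp: "x l c i = (\<Sum>b<k. s b * mu b i) + r i" if "i < d" for i
    unfolding s_def r_def by (rule sgd_decomposition[OF ctx c that l(1)]) auto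
  have s_le: "\<bar>s b\<bar> \<le> 1 / \<beta>" for b
    unfolding s_def by (rule abs_signal_le[OF ctx c]) auto
  have r_le: "vnorm d r \<le> 2 * exp (- \<beta> * T0) + NB"
  proof -
    have "vnorm d r \<le> 2 * exp (- \<beta> * (\<delta> * real l)) + NB"
      unfolding r_def NB_def by (rule vnorm_remainder_le[OF ctx c l(1,3)]) auto
    also have "T0 \<le> \<delta> * real l" using l \<delta> by (simp add: field_simps)
    then have "2 * exp (- \<beta> * (\<delta> * real l)) \<le> 2 * exp (- \<beta> * T0)" using \<beta> by simp
    finally show ?thesis by simp
  qed
  have x_le: "vnorm d (x l b) \<le> R" if "b < k" for b
    by (rule vnorm_sgd_le[OF ctx that l(1,3)]) auto
  have "4 / \<delta> \<le> real l"
    using l(2) T0 \<delta> by (smt (verit) divide_right_mono)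
  have s0_le: "s0 \<le> s c"
    unfolding s0_def s_def \<eta>_def by (rule signal_ge[OF ctx c l(1,3) \<open>4 / \<delta> \<le> real l\<close>]) auto
  have s0: "0 < s0" using \<eta> q by (simp add: s0_def)
  have low: "s0 / (2 * V) \<le> vnorm d (x l c)"
  proof -
    have "dotp d v (x l c) = dotp d v (\<lambda>i. (\<Sum>b<k. s b * mu b i) + r i)"
      using decomp by (intro dotp_cong) auto
    also have "\<dots> = (\<Sum>b<k. s b * dotp d (mu b) v) + dotp d v r"
      by (simp add: dotp_add_right dotp_sum_right dotp_scale_right dotp_commute)
    also have "(\<Sum>b<k. s b * dotp d (mu b) v) = (\<Sum>b<k. if b = c then s b else 0)"
      using dual(1) by (intro sum.cong) auto
    also have "\<dots> = s c" using c by simp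
    finally have eq: "dotp d v (x l c) = s c + dotp d v r" .
    have "\<bar>dotp d v r\<bar> \<le> vnorm d v * vnorm d r" by (rule abs_dotp_le)
    also have "\<dots> \<le> V * (2 * exp (- \<beta> * T0) + NB)" using dual r_le by (intro mult_mono) auto
    also have "\<dots> \<le> s0 / 2" using rem by (simp add: s0_def mult.commute)
    finally have "s0 / 2 \<le> dotp d v (x l c)" using eq s0_le by linarith
    also have "\<dots> \<le> vnorm d v * vnorm d (x l c)" using abs_dotp_le[of d v "x l c"] by simp
    also have "\<dots> \<le> V * vnorm d (x l c)" using dual by (intro mult_right_mono) auto
    finally show ?thesis using dual by (simp add: field_simps)
  qed
  have low0: "0 < s0 / (2 * V)" using s0 dual by simp
  \<comment> \<open>Half of the class count survives, each sample with weight at least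
    \<open>\<eta>^2\<close>. The same value serves both blocks:
    \<open>softmax * (1 - softmax)\<close> has both factors at least \<eta>, and the modulus of the
    residual is at least \<eta>.\<close>
  have q': "0 < \<eta>\<^sup>2 * (qt / 2)" using \<eta> q by simp
  let ?Y = "\<lambda>l. snd (data_point mu (t' l))"
  have Yeq: "?Y m i = mu (fst (t' m)) i + snd (t' m) i" for m i by (simp add: data_point_def)
  have sm: "\<eta> \<le> softmax k d (x l) (?Y m) c" "softmax k d (x l) (?Y m) c \<le> 1 - \<eta>"
    if "m \<in> {1..Mt}" "\<forall>b<k. \<bar>dotp d (x l b) (snd (t' m))\<bar> \<le> 1" for m
  proof -
    have "\<bar>dotp d (x l b) (?Y m)\<bar> \<le> R + 1" if b: "b < k" for b
      using \<open>m \<in> {1..Mt}\<close> \<open>\<forall>b<k. \<bar>dotp d (x l b) (snd (t' m))\<bar> \<le> 1\<close> b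
      by (intro abs_dotp_data_point_le x_le mu_unit labels') auto
    then show "\<eta> \<le> softmax k d (x l) (?Y m) c" "softmax k d (x l) (?Y m) c \<le> 1 - \<eta>"
      unfolding \<eta>_def using k c by (intro softmax_lower_bound softmax_upper_bound; simp)+
  qed
  have s01: "0 \<le> softmax k d (x l) Y c" "softmax k d (x l) Y c \<le> 1" for Y
    using softmax_bounds[OF c, of d "x l" Y] by auto
  show "lives_in_Ek d k (emp_hess_block k d Mt (\<lambda>m. data_point mu (t' m)) (x l) c) (x l c) err"
  proof (rule lives_in_Ek_weighted_gram[OF k(2) Mt emp_hess_block_eq[OF c] Yeq labels' _ op' q' _ decomp s_le r_le low0 low])
    show "0 \<le> softmax k d (x l) (?Y m) c * (1 - softmax k d (x l) (?Y m) c) \<and>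
        softmax k d (x l) (?Y m) c * (1 - softmax k d (x l) (?Y m) c) \<le> 1" for m
      using s01[of "?Y m"] by (auto intro: mult_le_one)
    fix b assume b: "b < k"
    show "\<eta>\<^sup>2 * (qt / 2) * real Mt \<le> (\<Sum>m\<in>{m \<in> {1..Mt}. fst (t' m) = b}.
        softmax k d (x l) (?Y m) c * (1 - softmax k d (x l) (?Y m) c))"
    proof (rule weighted_label_count_ge[OF _ _ _ op' B x_le count'[OF b] small])
      fix m assume m: "m \<in> {1..Mt}" "\<forall>b<k. \<bar>dotp d (x l b) (snd (t' m))\<bar> \<le> 1"
      show "\<eta>\<^sup>2 \<le> softmax k d (x l) (?Y m) c * (1 - softmax k d (x l) (?Y m) c)"
        unfolding power2_eq_square using sm[OF m] \<eta> by (intro mult_mono) auto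
    qed (use s01 in auto)
  qed (use err in \<open>auto simp: s0_def\<close>)
  show "lives_in_Ek d k (emp_G_block k d Mt (\<lambda>m. data_point mu (t' m)) (x l) c) (x l c) err"
  proof (rule lives_in_Ek_weighted_gram[OF k(2) Mt emp_G_block_eq[OF c] Yeq labels' _ op' q' _ decomp s_le r_le low0 low])
    show "0 \<le> (residual k d (x l) (data_point mu (t' m)) c)\<^sup>2 \<and> (residual k d (x l) (data_point mu (t' m)) c)\<^sup>2 \<le> 1" for m
      using abs_residual_le_1[OF c] by (simp add: abs_square_le_1)
    fix b assume b: "b < k"
    show "\<eta>\<^sup>2 * (qt / 2) * real Mt \<le> (\<Sum>m\<in>{m \<in> {1..Mt}. fst (t' m) = b}. (residual k d (x l) (data_point mu (t' m)) c)\<^sup>2)"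
    proof (rule weighted_label_count_ge[OF _ _ _ op' B x_le count'[OF b] small])
      fix m assume m: "m \<in> {1..Mt}" "\<forall>b<k. \<bar>dotp d (x l b) (snd (t' m))\<bar> \<le> 1"
      have "\<eta> \<le> \<bar>residual k d (x l) (data_point mu (t' m)) c\<bar>"
        using sm[OF m] by (auto simp: residual_def)
      then have "\<eta>\<^sup>2 \<le> \<bar>residual k d (x l) (data_point mu (t' m)) c\<bar>\<^sup>2" using \<eta> by (intro power_mono) auto
      then show "\<eta>\<^sup>2 \<le> (residual k d (x l) (data_point mu (t' m)) c)\<^sup>2" by simp
    qed auto
  qed (use err in \<open>auto simp: s0_def\<close>)
qed

section \<open>Probability of good data\<close>

lemma likely_sample_label:
  assumes lam: "0 < lam" and supp: "set_pmf P \<subseteq> {..<k}"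
  shows "likely (sample_measure P d lam) (\<lambda>s. fst s < k) 0"
  unfolding sample_measure_def
proof (rule likely_fst)
  have "measure (measure_pmf P) {a \<in> space (measure_pmf P). a < k} = 1"
    using supp by (subst measure_pmf.prob_eq_1) (auto simp: AE_measure_pmf_iff)
  then show "likely (measure_pmf P) (\<lambda>a. a < k) 0" by (simp add: likely_def)
qed (use lam in \<open>auto intro: prob_space_gauss_vec prob_space_measure_pmf\<close>)

lemma likely_labels:
  assumes lam: "0 < lam" and supp: "set_pmf P \<subseteq> {..<k}"
  shows "likely (PiM {1..N} (\<lambda>_. sample_measure P d lam)) (\<lambda>t. \<forall>m\<in>{1..(N::nat)}. fst (t m) < k) 0"
proof -
  note S = prob_space_sample_measure[OF lam, of P d]
  have "likely (PiM {1..N} (\<lambda>_. sample_measure P d lam)) (\<lambda>t. \<forall>m\<in>{1..N}. fst (t m) < k) (real (card {1..N}) * 0)"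
    by (intro likely_all likely_component prob_space_PiM S likely_sample_label lam supp) auto
  then show ?thesis by simp
qed

lemma likely_noise_bounded:
  assumes lam: "0 < lam" and d: "0 < d" and I: "I \<subseteq> {1..N}" "card I \<le> n" and \<kappa>: "real d \<le> \<kappa> * real n"
  shows "likely (PiM {1..N} (\<lambda>_. sample_measure P d lam))
     (\<lambda>t. noise_bounded d t I (16 * (6 * \<kappa> + 2) * real n / lam)) (exp (- real n))"
  by (intro likelyI prob_space_PiM prob_space_sample_measure lam sets_noise_bounded noise_bounded_tail assms)

lemma likely_label_count:
  assumes lam: "0 < lam" and p: "p \<le> pmf P a / 2"
  shows "likely (PiM {1..N} (\<lambda>_. sample_measure P d lam))
     (\<lambda>t. p / 4 * real N \<le> real (card {l \<in> {1..N}. fst (t l) = a})) (exp (- (p / 4 * real N)))"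
proof (rule likelyI)
  let ?S = "sample_measure P d lam"
  note S = prob_space_sample_measure[OF lam, of P d]
  show "prob_space (PiM {1..N} (\<lambda>_. ?S))" by (intro prob_space_PiM S)
  have label: "{h \<in> space (PiM {1..n} (\<lambda>_. ?S)). fst (h m) = a} \<in> sets (PiM {1..n} (\<lambda>_. ?S))" if "m \<in> {1..n}" for m n
  proof -
    have "{h \<in> space (PiM {1..n} (\<lambda>_. ?S)). fst (h m) = a} = (\<lambda>h. fst (h m)) -` {a} \<inter> space (PiM {1..n} (\<lambda>_. ?S))"
      by auto
    also have "\<dots> \<in> sets (PiM {1..n} (\<lambda>_. ?S))"
      by (intro measurable_sets[OF measurable_sample_component(1)[OF that]]) auto
    finally show ?thesis .
  qed
  show "{t \<in> space (PiM {1..N} (\<lambda>_. ?S)). p / 4 * real N \<le> real (card {l \<in> {1..N}. fst (t l) = a})}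
     \<in> sets (PiM {1..N} (\<lambda>_. ?S))"
    by (intro sets_card_ge label) auto
  have "measure (PiM {1..N} (\<lambda>_. ?S)) {t \<in> space (PiM {1..N} (\<lambda>_. ?S)).
     real (card {l \<in> {1..N}. fst (t l) = a}) < p / 4 * real (card {1..N})} \<le> exp (- (p / 4 * real (card {1..N})))"
  proof (rule adaptive_count_tail[OF S])
    show "{h \<in> space (PiM {1..n} (\<lambda>_. ?S)). fst (h m) = a} \<in> sets (PiM {1..n} (\<lambda>_. ?S))" if "m \<in> {1..n}" for m n
      by (rule label[OF that])
    show "{y \<in> space ?S. fst ((h(m := y)) m) = a} \<in> sets ?S" for h m
      by (rule sets_label_noise_event[where k=0]) auto
    \<comment> \<open>With \<open>k = 0\<close> directions the noise condition is void and only the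
      label remains; the radius 1 is arbitrary.\<close>
    show "p \<le> measure ?S {y \<in> space ?S. fst ((h(m := y)) m) = a}" for h m
      using measure_label_small_noise_ge[OF lam, of 0 d "\<lambda>_ _. 0" 1 P a] p lam by simp
  qed auto
  then show "measure (PiM {1..N} (\<lambda>_. ?S)) {t \<in> space (PiM {1..N} (\<lambda>_. ?S)).
     \<not> p / 4 * real N \<le> real (card {l \<in> {1..N}. fst (t l) = a})} \<le> exp (- (p / 4 * real N))"
    by (simp add: not_le)
qed

lemma likely_initial_norm:
  assumes d: "0 < d"
  shows "likely (PiM {..<k} (\<lambda>_. gauss_vec d (1 / real d))) (\<lambda>x0. \<forall>c\<in>{..<k}. vnorm d (x0 c) \<le> 2) (real k * (2 / exp 1) ^ d)"
proof -
  let ?G = "gauss_vec d (1 / real d)"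
  have G: "prob_space ?G" using d by (intro prob_space_gauss_vec) simp
  have iff: "vnorm d z \<le> 2 \<longleftrightarrow> dotp d z z \<le> 4" for z
    unfolding vnorm_def using real_sqrt_le_iff[of "dotp d z z" 4] by simp
  have one: "likely ?G (\<lambda>z. vnorm d z \<le> 2) ((2 / exp 1) ^ d)"
  proof (rule likelyI[OF G])
    have [measurable]: "(\<lambda>z. dotp d z z) \<in> borel_measurable ?G" by (intro borel_measurable_dotp) auto
    show "{z \<in> space ?G. vnorm d z \<le> 2} \<in> sets ?G" unfolding iff by measurable
    show "measure ?G {z \<in> space ?G. \<not> vnorm d z \<le> 2} \<le> (2 / exp 1) ^ d"
      using gauss_vec_norm_tail[OF d] by (simp add: iff not_le)
  qed
  have "likely (PiM {..<k} (\<lambda>_. ?G)) (\<lambda>x0. \<forall>c\<in>{..<k}. vnorm d (x0 c) \<le> 2) (real (card {..<k}) * (2 / exp 1) ^ d)"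
    by (intro likely_all likely_component prob_space_PiM G one) auto
  then show ?thesis by simp
qed

text \<open>For a fixed initialization and past, the iterate before step \<open>m\<close> is a
  constant and sample \<open>m\<close> is fresh. Either the iterate has left the ball and the step
  is good for certain, or its squared norm is at most \<open>R^2\<close> and the small-noise
  estimate applies with \<open>r = R^2\<close>.\<close>

lemma likely_good_sample_count:
  fixes R :: real
  assumes lam: "0 < lam" and d: "0 < d" and c: "c < k" and p: "p \<le> pmf P c / 2"
    and R: "0 < R" "16 * real k * R\<^sup>2 \<le> lam" and W: "W \<subseteq> {1..M}" "card W = n"
  shows "likely (PiM {1..M} (\<lambda>_. sample_measure P d lam) \<Otimes>\<^sub>M PiM {..<k} (\<lambda>_. gauss_vec d (1 / real d)))
     (\<lambda>w. p / 4 * real n \<le> real (card {m \<in> W.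
        good_sample k d (sgd k d \<delta> \<beta> (\<lambda>m. data_point mu (fst w m)) (snd w)) R (fst w) c m}))
     (exp (- (p / 4 * real n)))"
proof -
  let ?S = "sample_measure P d lam"
  let ?I = "PiM {..<k} (\<lambda>_. gauss_vec d (1 / real d))"
  define good where "good x0 m h \<longleftrightarrow> good_sample k d (sgd k d \<delta> \<beta> (\<lambda>m. data_point mu (h m)) x0) R h c m"
    for x0 m and h :: "nat \<Rightarrow> nat \<times> (nat \<Rightarrow> real)"
  note S = prob_space_sample_measure[OF lam, of P d]
  have Q: "prob_space (PiM {1..M} (\<lambda>_. ?S))" by (intro prob_space_PiM S)
  have I: "prob_space ?I" using d by (intro prob_space_PiM prob_space_gauss_vec) simp
  have finW: "finite W" using W finite_subset by blast
  have joint: "{w \<in> space (PiM {1..M} (\<lambda>_. ?S) \<Otimes>\<^sub>M ?I). good (snd w) m (fst w)} \<in> sets (PiM {1..M} (\<lambda>_. ?S) \<Otimes>\<^sub>M ?I)"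
    if m: "m \<in> W" for m
    unfolding good_def
  proof (rule sets_good_sample)
    show "(\<lambda>w. fst (fst w j)) \<in> PiM {1..M} (\<lambda>_. ?S) \<Otimes>\<^sub>M ?I \<rightarrow>\<^sub>M count_space UNIV" if "j \<in> {1..m}" for j
      using that m W by (intro measurable_compose[OF measurable_fst measurable_sample_component(1)]) auto
    show "(\<lambda>w. snd (fst w j) i) \<in> borel_measurable (PiM {1..M} (\<lambda>_. ?S) \<Otimes>\<^sub>M ?I)" if "j \<in> {1..m}" "i < d" for j i
      using that m W by (intro measurable_compose[OF measurable_fst measurable_sample_component(2)]) auto
    show "(\<lambda>w. snd w c i) \<in> borel_measurable (PiM {1..M} (\<lambda>_. ?S) \<Otimes>\<^sub>M ?I)" if "c < k" "i < d" for c i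
    proof -
      have "(\<lambda>x0. x0 c) \<in> ?I \<rightarrow>\<^sub>M gauss_vec d (1 / real d)"
        using that by (intro measurable_component_singleton) auto
      from measurable_compose[OF measurable_compose[OF measurable_snd this] borel_measurable_gauss_vec_component[OF that(2)]]
      show ?thesis .
    qed
    show "1 \<le> m" using m W by auto
  qed
  have sect: "{h \<in> space (PiM {1..n} (\<lambda>_. ?S)). good x0 m h} \<in> sets (PiM {1..n} (\<lambda>_. ?S))"
    if m: "m \<in> {1..n}" for m n x0
    unfolding good_def using m
    by (intro sets_good_sample measurable_sample_component) auto
  have past: "sgd k d \<delta> \<beta> (\<lambda>m. data_point mu (h m)) x0 (m - 1) = sgd k d \<delta> \<beta> (\<lambda>m. data_point mu (h' m)) x0 (m - 1)"
    if "\<And>j. j \<in> {1..<m} \<Longrightarrow> h j = h' j" for h h' x0 m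
    using that by (intro sgd_cong) auto
  \<comment> \<open>Replacing sample \<open>m\<close> does not affect iterate
    \<open>m - 1\<close>.\<close>
  have good_upd: "good x0 m (h(m := y)) \<longleftrightarrow> (fst y = c \<and> (\<forall>b<k. \<bar>dotp d (sgd k d \<delta> \<beta> (\<lambda>m. data_point mu (h m)) x0 (m - 1) b) (snd y)\<bar> \<le> 1))
      \<or> (\<exists>b<k. R < vnorm d (sgd k d \<delta> \<beta> (\<lambda>m. data_point mu (h m)) x0 (m - 1) b))" for x0 m h y
    unfolding good_def good_sample_def using past[of m "h(m := y)" h x0] by simp
  have tail: "likely (PiM {1..M} (\<lambda>_. ?S)) (\<lambda>h. p / 4 * real n \<le> real (card {m \<in> W. good x0 m h})) (exp (- (p / 4 * real n)))" for x0
  proof (rule likelyI[OF Q])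
    show "{h \<in> space (PiM {1..M} (\<lambda>_. ?S)). p / 4 * real n \<le> real (card {m \<in> W. good x0 m h})} \<in> sets (PiM {1..M} (\<lambda>_. ?S))"
      using W by (intro sets_card_ge finW sect) auto
    have "measure (PiM {1..M} (\<lambda>_. ?S)) {h \<in> space (PiM {1..M} (\<lambda>_. ?S)).
       real (card {m \<in> W. good x0 m h}) < p / 4 * real (card W)} \<le> exp (- (p / 4 * real (card W)))"
    proof (rule adaptive_count_tail[OF S])
      show "{h \<in> space (PiM {1..n} (\<lambda>_. ?S)). good x0 m h} \<in> sets (PiM {1..n} (\<lambda>_. ?S))" if "m \<in> {1..n}" for m n
        by (rule sect[OF that])
      show "good x0 m h = good x0 m h'" if "m \<in> {1..M}" "\<And>j. j \<in> {1..m} \<Longrightarrow> h j = h' j" for m h h'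
        unfolding good_def good_sample_def using past[of m h h' x0] that by simp
      fix m h
      let ?x = "sgd k d \<delta> \<beta> (\<lambda>m. data_point mu (h m)) x0 (m - 1)"
      show "{y \<in> space ?S. good x0 m (h(m := y))} \<in> sets ?S"
      proof (cases "\<exists>b<k. R < vnorm d (?x b)")
        case True
        then show ?thesis unfolding good_upd by simp
      next
        case False
        then show ?thesis unfolding good_upd by (intro sets_label_noise_event[where \<theta>="?x" and k=k and c=c]) auto
      qed
      show "p \<le> measure ?S {y \<in> space ?S. good x0 m (h(m := y))}"
      proof (cases "\<exists>b<k. R < vnorm d (?x b)")
        case True
        then have "{y \<in> space ?S. good x0 m (h(m := y))} = space ?S" unfolding good_upd by auto
        then show ?thesis using prob_space.prob_space[OF S] p pmf_le_1[of P c] by simp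
      next
        case False
        then have "{y \<in> space ?S. good x0 m (h(m := y))} = {y \<in> space ?S. fst y = c \<and> (\<forall>b<k. \<bar>dotp d (?x b) (snd y)\<bar> \<le> 1)}"
          unfolding good_upd by auto
        moreover have "pmf P c / 2 \<le> measure ?S {y \<in> space ?S. fst y = c \<and> (\<forall>b<k. \<bar>dotp d (?x b) (snd y)\<bar> \<le> 1)}"
        proof (rule measure_label_small_noise_ge[OF lam])
          show "dotp d (?x b) (?x b) \<le> R\<^sup>2" if "b < k" for b
          proof -
            have "vnorm d (?x b) \<le> R" using False that by (meson not_less)
            then show ?thesis unfolding vnorm_square[symmetric] by (intro power_mono) auto
          qed
        qed (use R in auto)
        ultimately show ?thesis using p by simp
      qed
    qed (use W in auto)
    then show "measure (PiM {1..M} (\<lambda>_. ?S)) {h \<in> space (PiM {1..M} (\<lambda>_. ?S)).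
       \<not> p / 4 * real n \<le> real (card {m \<in> W. good x0 m h})} \<le> exp (- (p / 4 * real n))"
      using W by (simp add: not_le)
  qed
  have "likely (PiM {1..M} (\<lambda>_. ?S) \<Otimes>\<^sub>M ?I) (\<lambda>w. p / 4 * real n \<le> real (card {m \<in> W. good (snd w) m (fst w)})) (exp (- (p / 4 * real n)))"
    by (rule likely_fst_section[OF Q I sets_card_ge[OF finW joint] tail]) auto
  then show ?thesis unfolding good_def .
qed

text \<open>The training steps are cut into windows of length \<^term>\<open>n\<close>, which is of order
  \<^term>\<open>1 / \<delta>\<close>. Only finitely many windows, independently of the dimension, meet the time horizon.\<close>
definition good_data :: "nat \<Rightarrow> nat \<Rightarrow> nat \<Rightarrow> nat \<Rightarrow> nat \<Rightarrow> real \<Rightarrow> real \<Rightarrow> (nat \<Rightarrow> nat \<Rightarrow> real) \<Rightarrow> real \<Rightarrow> real \<Rightarrow> real \<Rightarrow> nat \<Rightarrow>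
    ((nat \<Rightarrow> nat \<times> (nat \<Rightarrow> real)) \<times> (nat \<Rightarrow> nat \<Rightarrow> real)) \<times> (nat \<Rightarrow> nat \<times> (nat \<Rightarrow> real)) \<Rightarrow> bool" where
  "good_data k d n M J \<delta> \<beta> mu B R q Mt w \<longleftrightarrow>
     (((\<forall>m\<in>{1..M}. fst (fst (fst w) m) < k) \<and>
       (\<forall>j\<in>{..J}. noise_bounded d (fst (fst w)) ({j*n+1..(j+1)*n} \<inter> {1..M}) (B * real n))) \<and>
      (\<forall>c\<in>{..<k}. vnorm d (snd (fst w) c) \<le> 2) \<and>
      (\<forall>c\<in>{..<k}. \<forall>j\<in>{..J}. (j + 1) * n \<le> M \<longrightarrow> q * real n \<le> real (card {m \<in> {j*n+1..(j+1)*n}.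
         good_sample k d (sgd k d \<delta> \<beta> (\<lambda>m. data_point mu (fst (fst w) m)) (snd (fst w))) R (fst (fst w)) c m}))) \<and>
     ((\<forall>l\<in>{1..Mt}. fst (snd w l) < k) \<and> noise_bounded d (snd w) {1..Mt} (B * real Mt) \<and>
      (\<forall>a\<in>{..<k}. q * real Mt \<le> real (card {l \<in> {1..Mt}. fst (snd w l) = a})))"

lemma likely_good_data:
  fixes P :: "nat pmf" and p :: real
  assumes lam: "0 < lam" and d: "0 < d" and supp: "set_pmf P \<subseteq> {..<k}"
    and p: "\<And>c. c < k \<Longrightarrow> p \<le> pmf P c / 2"
    and R: "0 < R" "16 * real k * R\<^sup>2 \<le> lam"
    and \<kappa>: "real d \<le> \<kappa> * real n" "real d \<le> \<kappa> * real Mt" and B: "B = 16 * (6 * \<kappa> + 2) / lam"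
  shows "likely (Omega P k d lam M Mt) (good_data k d n M J \<delta> \<beta> mu B R (p / 4) Mt)
    (real (J + 1) * exp (- real n) + real k * (2 / exp 1) ^ d + real k * (real (J + 1) * exp (- (p / 4 * real n)))
      + exp (- real Mt) + real k * exp (- (p / 4 * real Mt)))"
proof -
  let ?S = "sample_measure P d lam"
  let ?T = "PiM {1..M} (\<lambda>_. ?S)" and ?I = "PiM {..<k} (\<lambda>_. gauss_vec d (1 / real d))" and ?U = "PiM {1..Mt} (\<lambda>_. ?S)"
  have T: "prob_space ?T" and U: "prob_space ?U"
    by (intro prob_space_PiM prob_space_sample_measure lam)+
  have I: "prob_space ?I" using d by (intro prob_space_PiM prob_space_gauss_vec) simp
  have TI: "prob_space (?T \<Otimes>\<^sub>M ?I)" by (rule prob_space_pair[OF T I])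
  have Bn: "B * real N = 16 * (6 * \<kappa> + 2) * real N / lam" for N by (simp add: B)
  have nb: "likely ?T (\<lambda>t. \<forall>j\<in>{..J}. noise_bounded d t ({j*n+1..(j+1)*n} \<inter> {1..M}) (B * real n)) (real (card {..J}) * exp (- real n))"
  proof (intro likely_all T)
    fix j
    have "card ({j*n+1..(j+1)*n} \<inter> {1..M}) \<le> card {j*n+1..(j+1)*n}" by (intro card_mono) auto
    then show "likely ?T (\<lambda>t. noise_bounded d t ({j*n+1..(j+1)*n} \<inter> {1..M}) (B * real n)) (exp (- real n))"
      unfolding Bn by (intro likely_noise_bounded lam d \<kappa>) auto
  qed simp
  have train: "likely (?T \<Otimes>\<^sub>M ?I) (\<lambda>w. (\<forall>m\<in>{1..M}. fst (fst w m) < k) \<and>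
       (\<forall>j\<in>{..J}. noise_bounded d (fst w) ({j*n+1..(j+1)*n} \<inter> {1..M}) (B * real n))) (0 + real (card {..J}) * exp (- real n))"
    by (intro likely_fst[OF T I] likely_conj T likely_labels lam supp nb)
  have init: "likely (?T \<Otimes>\<^sub>M ?I) (\<lambda>w. \<forall>c\<in>{..<k}. vnorm d (snd w c) \<le> 2) (real k * (2 / exp 1) ^ d)"
    by (intro likely_snd[OF T I] likely_initial_norm d)
  have good: "likely (?T \<Otimes>\<^sub>M ?I) (\<lambda>w. \<forall>c\<in>{..<k}. \<forall>j\<in>{..J}. (j + 1) * n \<le> M \<longrightarrow> p / 4 * real n \<le> real (card {m \<in> {j*n+1..(j+1)*n}.
         good_sample k d (sgd k d \<delta> \<beta> (\<lambda>m. data_point mu (fst w m)) (snd w)) R (fst w) c m}))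
      (real (card {..<k}) * (real (card {..J}) * exp (- (p / 4 * real n))))"
  proof (intro likely_all TI)
    fix c j assume c: "c \<in> {..<k}"
    show "likely (?T \<Otimes>\<^sub>M ?I) (\<lambda>w. (j + 1) * n \<le> M \<longrightarrow> p / 4 * real n \<le> real (card {m \<in> {j*n+1..(j+1)*n}.
         good_sample k d (sgd k d \<delta> \<beta> (\<lambda>m. data_point mu (fst w m)) (snd w)) R (fst w) c m})) (exp (- (p / 4 * real n)))"
    proof (cases "(j + 1) * n \<le> M")
      \<comment> \<open>Only windows lying entirely among the training samples are counted;
        otherwise the implication is vacuous.\<close>
      case True
      have "{j*n+1..(j+1)*n} \<subseteq> {1..M}" using True by auto
      then show ?thesis using True c likely_good_sample_count[OF lam d _ p R, of c "{j*n+1..(j+1)*n}" M n \<delta> \<beta> mu] by simp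
    next
      case False
      then show ?thesis using prob_space.prob_space[OF TI] by (simp add: likely_def)
    qed
  qed auto
  have test: "likely ?U (\<lambda>t. (\<forall>l\<in>{1..Mt}. fst (t l) < k) \<and> noise_bounded d t {1..Mt} (B * real Mt) \<and>
      (\<forall>a\<in>{..<k}. p / 4 * real Mt \<le> real (card {l \<in> {1..Mt}. fst (t l) = a})))
      (0 + (exp (- real Mt) + real (card {..<k}) * exp (- (p / 4 * real Mt))))"
  proof (intro likely_conj U likely_labels lam supp)
    show "likely ?U (\<lambda>t. noise_bounded d t {1..Mt} (B * real Mt)) (exp (- real Mt))"
      unfolding Bn by (intro likely_noise_bounded lam d \<kappa>) auto
    show "likely ?U (\<lambda>t. \<forall>a\<in>{..<k}. p / 4 * real Mt \<le> real (card {l \<in> {1..Mt}. fst (t l) = a}))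
       (real (card {..<k}) * exp (- (p / 4 * real Mt)))"
      by (intro likely_all U likely_label_count lam p) auto
  qed
  have "likely ((?T \<Otimes>\<^sub>M ?I) \<Otimes>\<^sub>M ?U) (good_data k d n M J \<delta> \<beta> mu B R (p / 4) Mt)
     (((0 + real (card {..J}) * exp (- real n)) + (real k * (2 / exp 1) ^ d +
       real (card {..<k}) * (real (card {..J}) * exp (- (p / 4 * real n)))))
      + (0 + (exp (- real Mt) + real (card {..<k}) * exp (- (p / 4 * real Mt)))))"
    unfolding good_data_def[abs_def]
    by (intro likely_conj[OF prob_space_pair[OF TI U]]
        likely_fst[OF TI U likely_conj[OF TI train likely_conj[OF TI init good]]]
        likely_snd[OF TI U test])
  then show ?thesis unfolding Omega_def by (simp add: add_ac)
qed

lemma alignment_of_good_sample_point: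
  fixes k d M Mt :: nat
  assumes good: "good_data k d n M J \<delta> \<beta> mu B R q Mt w"
    and w: "w \<in> space (Omega P k d lam M Mt)"
    and k: "2 \<le> k" "k \<le> d" and \<beta>: "0 < \<beta>" and \<delta>: "0 < \<delta>" "\<delta> \<le> 1" "\<delta> * \<beta> \<le> 1 / 2"
    and n: "n = nat \<lceil>1 / \<delta>\<rceil>" and B: "0 \<le> B" and Mt: "0 < Mt"
    and mu_unit: "\<And>b. b < k \<Longrightarrow> vnorm d (mu b) = 1"
    and R: "2 + real k / \<beta> + 2 * sqrt B * (1 / (1 - exp (- \<beta>)) + 1) \<le> R"
    and q: "0 < q" and small: "real k * R\<^sup>2 * B \<le> q / 2"
    and dual: "\<And>c. c < k \<Longrightarrow> \<exists>v. (\<forall>b<k. dotp d (mu b) v = (if b = c then 1 else 0)) \<and> vnorm d v \<le> V" and V: "0 < V"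
    and \<eta>: "\<eta> = exp (- 2 * (R + 1)) / real k"
    and rem: "(2 * exp (- \<beta> * T0) + 2 * sqrt B * (1 / (1 - exp (- \<beta>)) + 1)) * V \<le> exp (- 8 * \<beta>) * (\<eta> * q) / 2"
    and T0: "4 \<le> T0" and J: "Tf \<le> real J"
    and err: "(real k * (1 / \<beta>) * sqrt (4 * B / (\<eta>\<^sup>2 * (q / 2))) + (2 * exp (- \<beta> * T0) + 2 * sqrt B * (1 / (1 - exp (- \<beta>)) + 1)))\<^sup>2
       \<le> err * (exp (- 8 * \<beta>) * (\<eta> * q) / (2 * V))\<^sup>2"
  shows "w \<in> alignment_event P k d mu lam \<beta> \<delta> M Mt T0 Tf err"
  unfolding alignment_event_def
proof (intro CollectI conjI w allI impI)
  fix c l assume c: "c < k" and l: "T0 / \<delta> \<le> real l \<and> real l \<le> Tf / \<delta> \<and> l \<le> M"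
  have d: "0 < d" using k by simp
  obtain v where v: "\<And>b. b < k \<Longrightarrow> dotp d (mu b) v = (if b = c then 1 else 0)" "vnorm d v \<le> V"
    using dual[OF c] by blast
  have "Tf / \<delta> \<le> real J / \<delta>" using J \<delta> by (intro divide_right_mono) auto
  then have lJ: "real l \<le> real J / \<delta>" using l by linarith
  note g = good[unfolded good_data_def]
  have op: "(\<Sum>m\<in>{j*n+1..(j+1)*n} \<inter> {1..M}. (dotp d z (snd (fst (fst w) m)))\<^sup>2) \<le> B * real n * dotp d z z"
    if "j \<le> J" for j z
    using g that by (intro noise_bounded_quadratic_form d) auto
  have op': "(\<Sum>l\<in>{1..Mt}. (dotp d z (snd (snd w l)))\<^sup>2) \<le> B * real Mt * dotp d z z" for z
    using g by (intro noise_bounded_quadratic_form d) auto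
  note align = alignment_of_good_data[where k=k and d=d and \<beta>=\<beta> and \<delta>=\<delta> and n=n and B=B and mu=mu and M=M
      and t="fst (fst w)" and ?x0.0="snd (fst w)" and J=J and R=R and q=q and Mt=Mt and t'="snd w" and qt=q
      and v=v and c=c and V=V and ?T0.0=T0 and l=l and err=err,
      OF k \<beta> \<delta> n B mu_unit _ _ op R _ Mt _ op' _ q q small v V c rem[unfolded \<eta>] T0 _ _ lJ err[unfolded \<eta>]]
  have "lives_in_Ek d k (emp_hess_block k d Mt (\<lambda>m. data_point mu (snd w m))
      (sgd k d \<delta> \<beta> (\<lambda>m. data_point mu (fst (fst w) m)) (snd (fst w)) l) c)
      (sgd k d \<delta> \<beta> (\<lambda>m. data_point mu (fst (fst w) m)) (snd (fst w)) l c) err"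
    by (rule align(1)) (use g l in auto)
  moreover have "lives_in_Ek d k (emp_G_block k d Mt (\<lambda>m. data_point mu (snd w m))
      (sgd k d \<delta> \<beta> (\<lambda>m. data_point mu (fst (fst w) m)) (snd (fst w)) l) c)
      (sgd k d \<delta> \<beta> (\<lambda>m. data_point mu (fst (fst w) m)) (snd (fst w)) l c) err"
    by (rule align(2)) (use g l in auto)
  ultimately show "let Ys = \<lambda>m. data_point mu (fst (fst w) m); x0 = snd (fst w); Yt = \<lambda>m. data_point mu (snd w m);
      x = sgd k d \<delta> \<beta> Ys x0 l
    in lives_in_Ek d k (emp_hess_block k d Mt Yt x c) (x c) err \<and> lives_in_Ek d k (emp_G_block k d Mt Yt x c) (x c) err"
    by (simp add: Let_def)
qed

text \<open>The coefficients \<open>W\<close> of the dual basis depend on the Gram matrix alone, so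
  they are solved for once and give one bound \<open>V\<close> for all dimensions. Injectivity of
  \<open>mbar\<close> is read off in dimension \<open>k\<close>.\<close>

lemma dual_basis_bounded:
  fixes mu :: "nat \<Rightarrow> nat \<Rightarrow> nat \<Rightarrow> real"
  assumes unit: "\<And>d b. k \<le> d \<Longrightarrow> b < k \<Longrightarrow> vnorm d (mu d b) = 1"
    and gram: "\<And>d a b. k \<le> d \<Longrightarrow> a < k \<Longrightarrow> b < k \<Longrightarrow> dotp d (mu d a) (mu d b) = mbar a b"
    and indep: "\<And>d w a. k \<le> d \<Longrightarrow> (\<And>i. i < d \<Longrightarrow> (\<Sum>a<k. w a * mu d a i) = 0) \<Longrightarrow> a < k \<Longrightarrow> w a = 0"
  obtains V where "0 < V" "\<And>d c. k \<le> d \<Longrightarrow> c < k \<Longrightarrow>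
    \<exists>v. (\<forall>b<k. dotp d (mu d b) v = (if b = c then 1 else 0)) \<and> vnorm d v \<le> V"
proof -
  have inj: "w a = 0" if eq: "\<And>a. a < k \<Longrightarrow> (\<Sum>b<k. mbar a b * w b) = 0" and a: "a < k" for w a
  proof (rule indep[of k w a, OF order_refl _ a])
    fix i assume i: "i < k"
    \<comment> \<open>A kernel vector \<open>w\<close> of the Gram matrix has zero quadratic form,
      which is the squared norm of this combination.\<close>
    define u where "u = (\<lambda>i. \<Sum>b<k. w b * mu k b i)"
    have "dotp k u u = (\<Sum>a<k. w a * (\<Sum>b<k. w b * dotp k (mu k a) (mu k b)))"
      by (simp add: u_def dotp_sum_left dotp_sum_right dotp_scale_left dotp_scale_right sum_distrib_left)
    also have "\<dots> = (\<Sum>a<k. w a * (\<Sum>b<k. mbar a b * w b))"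
    proof (rule sum.cong[OF refl])
      fix a assume "a \<in> {..<k}"
      then have "(\<Sum>b<k. w b * dotp k (mu k a) (mu k b)) = (\<Sum>b<k. mbar a b * w b)"
        using gram by (intro sum.cong) (auto simp: mult.commute)
      then show "w a * (\<Sum>b<k. w b * dotp k (mu k a) (mu k b)) = w a * (\<Sum>b<k. mbar a b * w b)" by simp
    qed
    also have "\<dots> = 0" using eq by simp
    finally have "(\<Sum>i<k. u i * u i) = 0" by (simp add: dotp_def)
    then have "u i * u i = 0" using i by (subst (asm) sum_nonneg_eq_0_iff) auto
    then show "(\<Sum>a<k. w a * mu k a i) = 0" by (simp add: u_def)
  qed
  have "\<forall>c<k. \<exists>w. \<forall>a<k. (\<Sum>b<k. mbar a b * w b) = (if a = c then 1 else 0)"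
  proof (intro allI impI)
    fix c assume "c < k"
    then show "\<exists>w. \<forall>a<k. (\<Sum>b<k. mbar a b * w b) = (if a = c then 1 else 0)"
    proof (rule gram_dual_coefficients[rotated])
      fix w :: "nat \<Rightarrow> real" and a
      assume "\<And>a. a < k \<Longrightarrow> (\<Sum>b<k. mbar a b * w b) = 0" "a < k"
      then show "w a = 0" by (rule inj)
    qed
  qed
  then obtain W where W: "\<And>c a. c < k \<Longrightarrow> a < k \<Longrightarrow> (\<Sum>b<k. mbar a b * W c b) = (if a = c then 1 else 0)"
    by metis
  define V where "V = 1 + (\<Sum>c<k. \<Sum>b<k. \<bar>W c b\<bar>)"
  show ?thesis
  proof
    show "0 < V" unfolding V_def by (intro add_pos_nonneg sum_nonneg) auto
    fix d c assume d: "k \<le> d" and c: "c < k"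
    define v where "v = (\<lambda>i. \<Sum>b<k. W c b * mu d b i)"
    have "dotp d (mu d a) v = (if a = c then 1 else 0)" if a: "a < k" for a
    proof -
      have "dotp d (mu d a) v = (\<Sum>b<k. W c b * dotp d (mu d a) (mu d b))"
        by (simp add: v_def dotp_sum_right dotp_scale_right)
      also have "\<dots> = (\<Sum>b<k. mbar a b * W c b)"
        using gram d a by (intro sum.cong) auto
      finally show ?thesis using W[OF c a] by simp
    qed
    moreover have "vnorm d v \<le> V"
    proof -
      have "vnorm d v \<le> (\<Sum>b<k. vnorm d (\<lambda>i. W c b * mu d b i))" unfolding v_def by (rule vnorm_sum) simp
      also have "\<dots> = (\<Sum>b<k. \<bar>W c b\<bar>)" using unit[OF d] by (simp add: vnorm_scale)
      also have "\<dots> \<le> (\<Sum>c<k. \<Sum>b<k. \<bar>W c b\<bar>)"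
        using c by (intro member_le_sum[of c "{..<k}" "\<lambda>c. \<Sum>b<k. \<bar>W c b\<bar>"] sum_nonneg) auto
      finally show ?thesis by (simp add: V_def)
    qed
    ultimately show "\<exists>v. (\<forall>b<k. dotp d (mu d b) v = (if b = c then 1 else 0)) \<and> vnorm d v \<le> V" by blast
  qed
qed

theorem theorem2p1:
  fixes k :: nat and P :: "nat pmf" and \<beta> :: real
    and mbar :: "nat \<Rightarrow> nat \<Rightarrow> real"
    and mu :: "nat \<Rightarrow> nat \<Rightarrow> nat \<Rightarrow> real"
    and \<delta> :: "nat \<Rightarrow> real" and C\<delta> :: real
  assumes k2: "k \<ge> 2"
    and P_supp: "set_pmf P \<subseteq> {..<k}"
    and P_pos: "\<forall>a<k. 0 < pmf P a"
    and beta_pos: "\<beta> > 0"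
    and mu_unit: "\<forall>d\<ge>k. \<forall>a<k. dotp d (mu d a) (mu d a) = 1"
    and mu_gram: "\<forall>d\<ge>k. \<forall>a<k. \<forall>b<k. dotp d (mu d a) (mu d b) = mbar a b"
    and mu_indep: "\<forall>d\<ge>k. \<forall>w :: nat \<Rightarrow> real.
                      (\<forall>i<d. (\<Sum>a<k. w a * mu d a i) = 0) \<longrightarrow> (\<forall>a<k. w a = 0)"
    and delta_pos: "\<forall>d. \<delta> d > 0"
    and delta_O: "\<forall>d>0. \<delta> d \<le> C\<delta> / real d"
  shows "\<exists>C \<alpha>0 lam0. C > 0 \<and> \<alpha>0 > 0 \<and> lam0 > 0 \<and>
     (\<forall>lam \<ge> lam0. \<forall>Mt :: nat \<Rightarrow> nat. (\<forall>d>0. real (Mt d) \<ge> \<alpha>0 * real d) \<longrightarrow>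
       (\<forall>\<epsilon>>0. \<exists>T0. \<forall>Tf > T0. \<forall>M :: nat \<Rightarrow> nat. (\<forall>d>0. Tf < real (M d) / real d) \<longrightarrow>
          (\<exists>A. (\<forall>d. A d \<in> sets (Omega P k d lam (M d) (Mt d))
                   \<and> A d \<subseteq> alignment_event P k d (mu d) lam \<beta> (\<delta> d) (M d) (Mt d) T0 Tf
                              (C * (\<epsilon> + 1 / lam)))
               \<and> (\<lambda>d. measure (Omega P k d lam (M d) (Mt d)) (A d)) \<longlonglongrightarrow> 1)))"
proof -
  have unit: "vnorm d (mu d b) = 1" if "k \<le> d" "b < k" for d b
    using mu_unit that by (simp add: vnorm_def)
  obtain V where V: "0 < V" and dual: "\<And>d c. k \<le> d \<Longrightarrow> c < k \<Longrightarrow>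
    \<exists>v. (\<forall>b<k. dotp d (mu d b) v = (if b = c then 1 else 0)) \<and> vnorm d v \<le> V"
  proof (rule dual_basis_bounded[of k mu mbar])
    show "w a = 0" if "k \<le> d" "\<And>i. i < d \<Longrightarrow> (\<Sum>a<k. w a * mu d a i) = 0" "a < k" for d w a
      using mu_indep that by blast
  qed (use unit mu_gram in auto)
  \<comment> \<open>Half of the smallest class probability: the other half is given up to samples
    with large noise.\<close>
  define p where "p = Min ((\<lambda>a. pmf P a / 2) ` {..<k})"
  have p_le: "p \<le> pmf P a / 2" if "a < k" for a
    unfolding p_def using that by (intro Min_le) auto
  have "p \<in> (\<lambda>a. pmf P a / 2) ` {..<k}"
    unfolding p_def using k2 by (intro Min_in) (auto simp: lessThan_empty_iff)
  then have p: "0 < p" using P_pos by auto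
  have p1: "p \<le> 1" using p_le[of 0] k2 pmf_le_1[of P 0] by simp
  have C\<delta>: "0 < C\<delta>" using delta_O[rule_format, of 1] delta_pos[rule_format, of 1] by simp
  \<comment> \<open>One ratio for both sample sizes: \<open>d <= C\<delta> * n\<close> for windows
    and \<open>d <= Mt\<close> for the test set.\<close>
  define \<kappa> where "\<kappa> = max 1 C\<delta>"
  define K where "K = 16 * (6 * \<kappa> + 2)"
  define \<theta> where "\<theta> = 1 / (1 - exp (- \<beta>)) + 1"
  \<comment> \<open>Initialization, signal and noise. The noise part has \<open>sqrt K\<close> where
    the bound for the iterates has \<open>sqrt B\<close>; for \<open>lam >= 1\<close> it is larger,
    and it does not depend on \<open>lam\<close>.\<close>
  define R where "R = 2 + real k / \<beta> + 2 * sqrt K * \<theta>"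
  define \<eta> where "\<eta> = exp (- 2 * (R + 1)) / real k"
  define q where "q = p / 4"
  define s0 where "s0 = exp (- 8 * \<beta>) * (\<eta> * q)"
  define r0 where "r0 = s0 / (2 * V)"
  define C1 where "C1 = real k * (1 / \<beta>) * sqrt (4 * K / (\<eta>\<^sup>2 * (q / 2))) + 2 * sqrt K * \<theta>"
  \<comment> \<open>The distance to the eigenspace is at most
    \<open>C1 / sqrt lam + 2 * sqrt \<epsilon>\<close>, with square at most
    \<open>2 * C1^2 / lam + 8 * \<epsilon>\<close>; \<open>r0\<close> is the lower bound for the
    norm of the iterate.\<close>
  define C where "C = (2 * C1\<^sup>2 + 8) / r0\<^sup>2"
  \<comment> \<open>In this order: \<open>B <= K\<close>; small noise along \<open>k\<close>
    directions of length \<open>R\<close>; \<open>k * R^2 * B <= q / 2\<close>; and noise paired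
    with the dual vector at most \<open>s0 / 4\<close>.\<close>
  define lam0 where "lam0 = max 1 (max (16 * real k * R\<^sup>2) (max (2 * real k * R\<^sup>2 * K / q) ((8 * sqrt K * \<theta> * V / s0)\<^sup>2)))"
  have K: "0 < K" by (simp add: K_def \<kappa>_def add_pos_pos)
  have \<theta>: "0 < \<theta>" using beta_pos by (simp add: \<theta>_def add_pos_pos)
  have R: "0 < R" using K \<theta> beta_pos by (simp add: R_def add_pos_nonneg)
  have \<eta>: "0 < \<eta>" using k2 by (simp add: \<eta>_def)
  have q: "0 < q" using p by (simp add: q_def)
  have s0: "0 < s0" using \<eta> q by (simp add: s0_def)
  have r0: "0 < r0" using s0 V by (simp add: r0_def)
  have C: "0 < C" using r0 by (simp add: C_def add_nonneg_pos)
  have n_ge: "real d \<le> \<kappa> * real (nat \<lceil>1 / \<delta> d\<rceil>)" if d: "0 < d" for d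
  proof -
    have "real d * \<delta> d \<le> C\<delta>" using delta_O d by (simp add: field_simps)
    also have "\<dots> \<le> \<kappa>" by (simp add: \<kappa>_def)
    finally have "real d \<le> \<kappa> * (1 / \<delta> d)" using delta_pos by (simp add: field_simps)
    also have "\<dots> \<le> \<kappa> * real (nat \<lceil>1 / \<delta> d\<rceil>)"
      by (intro mult_left_mono real_nat_ceiling_ge) (simp add: \<kappa>_def)
    finally show ?thesis .
  qed
  \<comment> \<open>From this dimension on \<open>k <= d\<close>, and \<open>C\<delta> / d\<close>
    is small enough for both conditions on the step size.\<close>
  define D where "D = k + nat \<lceil>C\<delta>\<rceil> + nat \<lceil>2 * C\<delta> * \<beta>\<rceil>"
  have large: "k \<le> d" "0 < d" "\<delta> d \<le> 1" "\<delta> d * \<beta> \<le> 1 / 2" if "D \<le> d" for d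
  proof -
    show kd: "k \<le> d" using that by (simp add: D_def)
    show d: "0 < d" using kd k2 by simp
    have "C\<delta> \<le> real d" "2 * C\<delta> * \<beta> \<le> real d" using that by (auto simp: D_def) linarith+
    then have "C\<delta> / real d \<le> 1" "C\<delta> / real d * \<beta> \<le> 1 / 2" using d by (auto simp: field_simps)
    moreover have "\<delta> d \<le> C\<delta> / real d" using delta_O d by simp
    moreover from this have "\<delta> d * \<beta> \<le> C\<delta> / real d * \<beta>" using beta_pos by (intro mult_right_mono) auto
    ultimately show "\<delta> d \<le> 1" "\<delta> d * \<beta> \<le> 1 / 2" by linarith+
  qed
  have main: "\<exists>T0. \<forall>Tf > T0. \<forall>M :: nat \<Rightarrow> nat. (\<forall>d>0. Tf < real (M d) / real d) \<longrightarrow>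
          (\<exists>A. (\<forall>d. A d \<in> sets (Omega P k d lam (M d) (Mt d))
                   \<and> A d \<subseteq> alignment_event P k d (mu d) lam \<beta> (\<delta> d) (M d) (Mt d) T0 Tf
                              (C * (\<epsilon> + 1 / lam)))
               \<and> (\<lambda>d. measure (Omega P k d lam (M d) (Mt d)) (A d)) \<longlonglongrightarrow> 1)"
    if lam: "lam0 \<le> lam" and Mt: "\<forall>d>0. real (Mt d) \<ge> 1 * real d" and \<epsilon>: "0 < \<epsilon>"
    for lam \<epsilon> and Mt :: "nat \<Rightarrow> nat"
  proof -
    have lam1: "1 \<le> lam" and lamR: "16 * real k * R\<^sup>2 \<le> lam" and lamq: "2 * real k * R\<^sup>2 * K / q \<le> lam"
      and lamV: "(8 * sqrt K * \<theta> * V / s0)\<^sup>2 \<le> lam"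
      using lam by (auto simp: lam0_def)
    have lam_pos: "0 < lam" using lam1 by simp
    define B where "B = K / lam"
    have B: "0 \<le> B" using K lam_pos by (simp add: B_def)
    have BK: "sqrt B \<le> sqrt K" using K lam1 by (simp add: B_def divide_le_eq mult_left_le)
    have R_ge: "2 + real k / \<beta> + 2 * sqrt B * (1 / (1 - exp (- \<beta>)) + 1) \<le> R"
      unfolding R_def \<theta>_def[symmetric] using BK \<theta> by simp
    have small: "real k * R\<^sup>2 * B \<le> q / 2"
      using lamq q lam_pos by (simp add: B_def field_simps)
    \<comment> \<open>What is left of the initialization after time \<open>T0\<close>: the first
      entry keeps its pairing with the dual vector below \<open>s0 / 4\<close>, the second makes its
      square of order \<epsilon>.\<close>
    define e where "e = min (s0 / (8 * V)) (sqrt \<epsilon>)"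
    have e: "0 < e" using s0 V \<epsilon> by (simp add: e_def)
    define T0 where "T0 = max 4 (- ln e / \<beta>)"
    have T4: "4 \<le> T0" by (simp add: T0_def)
    have "- ln e / \<beta> \<le> T0" by (simp add: T0_def)
    then have "- \<beta> * T0 \<le> ln e" using beta_pos by (simp add: field_simps)
    then have eT: "exp (- \<beta> * T0) \<le> e" using e by (metis exp_le_cancel_iff exp_ln)
    have noise: "2 * sqrt B * \<theta> * V \<le> s0 / 4"
    proof -
      have "8 * sqrt K * \<theta> * V / s0 \<le> sqrt lam" using lamV by (intro real_le_rsqrt)
      then have "8 * sqrt K * \<theta> * V \<le> s0 * sqrt lam" using s0 by (simp add: field_simps)
      then show ?thesis using lam_pos by (simp add: B_def real_sqrt_divide field_simps)
    qed
    have rem: "(2 * exp (- \<beta> * T0) + 2 * sqrt B * (1 / (1 - exp (- \<beta>)) + 1)) * V \<le> exp (- 8 * \<beta>) * (\<eta> * q) / 2"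
    proof -
      have "exp (- \<beta> * T0) \<le> s0 / (8 * V)" using eT by (simp add: e_def)
      then have "2 * exp (- \<beta> * T0) * V \<le> s0 / 4" using V by (simp add: field_simps)
      then show ?thesis using noise unfolding s0_def[symmetric] \<theta>_def[symmetric] by (simp add: algebra_simps)
    qed
    have err: "(real k * (1 / \<beta>) * sqrt (4 * B / (\<eta>\<^sup>2 * (q / 2))) + (2 * exp (- \<beta> * T0) + 2 * sqrt B * (1 / (1 - exp (- \<beta>)) + 1)))\<^sup>2
       \<le> C * (\<epsilon> + 1 / lam) * (exp (- 8 * \<beta>) * (\<eta> * q) / (2 * V))\<^sup>2"
    proof -
      define X where "X = 4 * K / (\<eta>\<^sup>2 * (q / 2))"
      have "4 * B / (\<eta>\<^sup>2 * (q / 2)) = X / lam" by (simp add: B_def X_def)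
      then have eq: "real k * (1 / \<beta>) * sqrt (4 * B / (\<eta>\<^sup>2 * (q / 2))) + 2 * sqrt B * \<theta> = C1 / sqrt lam"
        unfolding C1_def X_def[symmetric] by (simp add: B_def real_sqrt_divide add_divide_distrib)
      have C1: "0 \<le> C1" using K \<theta> q beta_pos by (simp add: C1_def)
      have "exp (- \<beta> * T0) \<le> sqrt \<epsilon>" using eT by (simp add: e_def)
      then have "(C1 / sqrt lam + 2 * exp (- \<beta> * T0))\<^sup>2 \<le> (C1 / sqrt lam + 2 * sqrt \<epsilon>)\<^sup>2"
        using C1 lam_pos by (intro power_mono) auto
      also have "\<dots> \<le> 2 * (C1 / sqrt lam)\<^sup>2 + 2 * (2 * sqrt \<epsilon>)\<^sup>2"
        by (rule power2_sum_le)
      also have "\<dots> = 2 * C1\<^sup>2 * (1 / lam) + 8 * \<epsilon>"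
        using lam_pos \<epsilon> by (simp add: power_divide power_mult_distrib)
      also have "\<dots> \<le> (2 * C1\<^sup>2 + 8) * (\<epsilon> + 1 / lam)"
        using lam_pos \<epsilon> by (simp add: algebra_simps)
      also have "\<dots> = C * (\<epsilon> + 1 / lam) * r0\<^sup>2" using r0 by (simp add: C_def)
      finally show ?thesis
        unfolding \<theta>_def[symmetric] s0_def[symmetric] r0_def[symmetric] eq[symmetric] by (simp add: algebra_simps)
    qed
    show ?thesis
    proof (intro exI[of _ T0] allI impI)
      fix Tf :: real and M :: "nat \<Rightarrow> nat" assume Tf: "T0 < Tf"
      define J where "J = nat \<lceil>Tf\<rceil>"
      have J: "Tf \<le> real J" unfolding J_def by (rule real_nat_ceiling_ge)
      define n where "n d = nat \<lceil>1 / \<delta> d\<rceil>" for d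
      define Q where "Q d = good_data k d (n d) (M d) J (\<delta> d) \<beta> (mu d) B R (p / 4) (Mt d)" for d
      \<comment> \<open>Small dimensions do not affect the limit; there the empty set is a
        measurable subset of the event.\<close>
      define A where "A d = (if D \<le> d then {w \<in> space (Omega P k d lam (M d) (Mt d)). Q d w} else {})" for d
      \<comment> \<open>A common rate: if \<open>d <= \<kappa> * N\<close> then both
        \<open>exp (- N)\<close> and \<open>exp (- (p / 4 * N))\<close> are at most
        \<open>exp (- (a * d))\<close>, using \<open>p <= 1\<close>.\<close>
      define a where "a = p / (4 * \<kappa>)"
      have \<kappa>: "1 \<le> \<kappa>" by (simp add: \<kappa>_def)
      have a: "0 < a" using p \<kappa> by (simp add: a_def)
      define E where "E d = (real (J + 1) + real k * real (J + 1) + 1 + real k) * exp (- a) ^ d + real k * (2 / exp 1) ^ d" for d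
      have tail: "exp (- N) \<le> exp (- a) ^ d" "exp (- (p / 4 * N)) \<le> exp (- a) ^ d" if N: "real d \<le> \<kappa> * N" for d N
      proof -
        have "a * real d \<le> a * (\<kappa> * N)" using N a by (intro mult_left_mono) auto
        then have 1: "a * real d \<le> p / 4 * N" using \<kappa> by (simp add: a_def)
        have "0 \<le> N" using N \<kappa> by (smt (verit) mult_nonneg_nonpos2 mult_neg_pos of_nat_0_le_iff mult_pos_neg)
        then have "p / 4 * N \<le> 1 * N" using p1 by (intro mult_right_mono) auto
        with 1 have 2: "a * real d \<le> N" by simp
        have eq: "exp (- a) ^ d = exp (- (a * real d))" by (simp add: mult.commute flip: exp_of_nat_mult)
        show "exp (- N) \<le> exp (- a) ^ d" "exp (- (p / 4 * N)) \<le> exp (- a) ^ d"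
          using 1 2 by (simp_all add: eq)
      qed
      have like: "likely (Omega P k d lam (M d) (Mt d)) (Q d) (E d)" if d: "D \<le> d" for d
      proof -
        note l = large[OF d]
        have nd: "real d \<le> \<kappa> * real (n d)" unfolding n_def by (rule n_ge[OF l(2)])
        have "real d \<le> real (Mt d)" using Mt l by simp
        also have "\<dots> \<le> \<kappa> * real (Mt d)" using \<kappa> by (simp add: mult_le_cancel_right1)
        finally have md: "real d \<le> \<kappa> * real (Mt d)" .
        have "likely (Omega P k d lam (M d) (Mt d)) (Q d)
          (real (J + 1) * exp (- real (n d)) + real k * (2 / exp 1) ^ d + real k * (real (J + 1) * exp (- (p / 4 * real (n d))))
          + exp (- real (Mt d)) + real k * exp (- (p / 4 * real (Mt d))))"
          unfolding Q_def
          by (intro likely_good_data[OF lam_pos l(2) P_supp p_le R lamR nd md]) (auto simp: B_def K_def)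
        moreover have "(real (J + 1) * exp (- real (n d)) + real k * (2 / exp 1) ^ d + real k * (real (J + 1) * exp (- (p / 4 * real (n d))))
          + exp (- real (Mt d)) + real k * exp (- (p / 4 * real (Mt d))))
          \<le> real (J + 1) * exp (- a) ^ d + real k * (2 / exp 1) ^ d + real k * (real (J + 1) * exp (- a) ^ d)
          + exp (- a) ^ d + real k * exp (- a) ^ d"
          by (intro add_mono mult_left_mono tail nd md order_refl) auto
        ultimately show ?thesis
          by (rule likely_mono[OF _ order_trans]) (simp add: E_def algebra_simps)
      qed
      have "prob_space (Omega P k d lam (M d) (Mt d))" if "0 < d" for d
        unfolding Omega_def using lam_pos that
        by (intro prob_space_pair prob_space_PiM prob_space_sample_measure prob_space_gauss_vec) auto
      then have le1: "measure (Omega P k d lam (M d) (Mt d)) (A d) \<le> 1" if "D \<le> d" for d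
        using large[OF that] prob_space.prob_le_1 by blast
      show "\<exists>A. (\<forall>d. A d \<in> sets (Omega P k d lam (M d) (Mt d))
                   \<and> A d \<subseteq> alignment_event P k d (mu d) lam \<beta> (\<delta> d) (M d) (Mt d) T0 Tf (C * (\<epsilon> + 1 / lam)))
               \<and> (\<lambda>d. measure (Omega P k d lam (M d) (Mt d)) (A d)) \<longlonglongrightarrow> 1"
      proof (intro exI[of _ A] conjI allI)
        fix d
        show "A d \<in> sets (Omega P k d lam (M d) (Mt d))"
          using like[of d] by (simp add: A_def likely_def)
        show "A d \<subseteq> alignment_event P k d (mu d) lam \<beta> (\<delta> d) (M d) (Mt d) T0 Tf (C * (\<epsilon> + 1 / lam))"
        proof
          fix w assume "w \<in> A d"
          then have d: "D \<le> d" and w: "w \<in> space (Omega P k d lam (M d) (Mt d))" "Q d w"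
            by (auto simp: A_def split: if_splits)
          note l = large[OF d]
          have "real d \<le> real (Mt d)" using Mt l by simp
          then have Mtd: "0 < Mt d" using l by simp
          show "w \<in> alignment_event P k d (mu d) lam \<beta> (\<delta> d) (M d) (Mt d) T0 Tf (C * (\<epsilon> + 1 / lam))"
            by (rule alignment_of_good_sample_point[OF w(2)[unfolded Q_def q_def[symmetric]] w(1) k2 l(1) beta_pos
                delta_pos[rule_format] l(3,4) n_def B Mtd unit[OF l(1)] R_ge q small dual[OF l(1)] V \<eta>_def rem T4 J err])
        qed
      next
        \<comment> \<open>Hence \<open>2 / exp 1 < 1\<close>, and the failure probability of the
          initialization tends to 0.\<close>
        have "exp (1::real) \<ge> 1 + 1 + 1 / 2" using exp_lower_Taylor_quadratic[of 1] by simp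
        then have l1: "(\<lambda>d. (2 / exp 1 :: real) ^ d) \<longlonglongrightarrow> 0" by (intro LIMSEQ_realpow_zero) auto
        have l2: "(\<lambda>d. exp (- a) ^ d) \<longlonglongrightarrow> 0" using a by (intro LIMSEQ_realpow_zero) auto
        have "(\<lambda>d. 1 - E d) \<longlonglongrightarrow> 1 - ((real (J + 1) + real k * real (J + 1) + 1 + real k) * 0 + real k * 0)"
          unfolding E_def by (intro tendsto_diff tendsto_add tendsto_mult tendsto_const l1 l2)
        then have lim: "(\<lambda>d. 1 - E d) \<longlonglongrightarrow> 1" by simp
        show "(\<lambda>d. measure (Omega P k d lam (M d) (Mt d)) (A d)) \<longlonglongrightarrow> 1"
        proof (rule tendsto_sandwich[OF _ _ lim tendsto_const])
          show "\<forall>\<^sub>F d in sequentially. 1 - E d \<le> measure (Omega P k d lam (M d) (Mt d)) (A d)"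
            using eventually_ge_at_top[of D]
          proof eventually_elim
            case (elim d)
            then show ?case using like[OF elim] by (simp add: A_def likely_def)
          qed
          show "\<forall>\<^sub>F d in sequentially. measure (Omega P k d lam (M d) (Mt d)) (A d) \<le> 1"
            using eventually_ge_at_top[of D] by eventually_elim (rule le1)
        qed
      qed
    qed
  qed
  have lam0: "0 < lam0" by (simp add: lam0_def)
  \<comment> \<open>The witness for \<open>\<alpha>0\<close> is 1: any fixed ratio of test samples
    to dimension would only change \<kappa> and with it \<open>K\<close>.\<close>
  show ?thesis
    by (rule exI[of _ C], rule exI[of _ "1::real"], rule exI[of _ lam0])
      (intro conjI C zero_less_one lam0 allI impI, rule main)
qed

end
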